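(* Let $p\ge1$ be an arbitrary integer and let $\epsilon>0$ be an arbitrarily small constant. If there is a PTAS for $p$-WiggleMin or for Weighted-$p$-WiggleMin, then there is a (probabilistic) algorithm that decides whether a given SAT instance of size $n$ is satisfiable in time $2^{n^\epsilon}$.
   Context: $[n]=\{1,\dots,n\}$. An $\ell$-time series is a function $f:[\ell]\to\mathbb{R}_{\ge0}$. For a set $F=\{f_1,\dots,f_n\}$ of $\ell$-time series and a permutation (bijection) $\pi:[n]\to F$, define $W^\pi_{i,j}=\sum_{k=1}^i(\pi(k)(j+1)-\pi(k)(j))$ for $i\in\{0,\dots,n\}$, $j\in[\ell-1]$. $p$-WiggleMin: find $\pi$ minimizing $\sum_{i=1}^n\sum_{j=1}^{\ell-1}|W^\pi_{i,j}|^p$. Weighted-$p$-WiggleMin: find $\pi$ minimizing $\sum_{i=1}^n\sum_{j=1}^{\ell-1}\frac{\pi(i)(j)+\pi(i)(j+1)+\pi(i+1)(j)+\pi(i+1)(j+1)}{4}|W^\pi_{i,j}|^p$, with $\pi(n+1)$ the identically zero series. A PTAS is a family of algorithms that, for every fixed $\delta>0$, return in polynomial time a solution of value at most $(1+\delta)$ times the optimum. *)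

theory Defs
  imports "HOL-Probability.Probability" "HOL-Library.Landau_Symbols" "HOL-Library.Multiset"
begin

section \<open>Wiggle minimization\<close>

text \<open>
  An \<open>l\<close>-time series is an element of \<open>{1..l} \<rightarrow>\<^sub>E {0..}\<close>, and an ordering of a set \<open>F\<close> of
  \<open>n\<close> such series is a function \<open>\<pi>\<close> with \<open>bij_betw \<pi> {1..n} F\<close>.
\<close>

definition W :: "(nat \<Rightarrow> nat \<Rightarrow> real) \<Rightarrow> nat \<Rightarrow> nat \<Rightarrow> real" where
  "W \<pi> i j = (\<Sum>k=1..i. \<pi> k (j + 1) - \<pi> k j)"

definition wiggle :: "nat \<Rightarrow> nat \<Rightarrow> nat \<Rightarrow> (nat \<Rightarrow> nat \<Rightarrow> real) \<Rightarrow> real" where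
  "wiggle p l n \<pi> = (\<Sum>i=1..n. \<Sum>j=1..l-1. \<bar>W \<pi> i j\<bar> ^ p)"

definition weighted_wiggle :: "nat \<Rightarrow> nat \<Rightarrow> nat \<Rightarrow> (nat \<Rightarrow> nat \<Rightarrow> real) \<Rightarrow> real" where
  "weighted_wiggle p l n \<pi> =
     (let \<pi>' = \<pi>(n + 1 := (\<lambda>_. 0)) in
      \<Sum>i=1..n. \<Sum>j=1..l-1.
        (\<pi>' i j + \<pi>' i (j + 1) + \<pi>' (i + 1) j + \<pi>' (i + 1) (j + 1)) / 4 * \<bar>W \<pi> i j\<bar> ^ p)"

definition orderings :: "'a set \<Rightarrow> (nat \<Rightarrow> 'a) set" where
  "orderings F = {\<pi>. bij_betw \<pi> {1..card F} F}"

section \<open>Turing machines\<close>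

text \<open>
  Multi-tape machines with two-way infinite tapes, whose transition function may consult one
  fair coin per step.  States and tape symbols are initial segments of the natural numbers:
  state 0 is the initial and state 1 the halting state; symbol 0 is the blank, symbols 1 and 2
  are the bits 0 and 1, and symbols 3 and 4 are delimiters.  Words are lists of nonblank symbols.
  A transition yields the new state and, for every tape, the symbol to write and the head movement.
\<close>

record tm =
  num_tapes :: nat
  num_states :: nat
  num_symbols :: nat
  trans :: "bool \<Rightarrow> nat \<Rightarrow> nat list \<Rightarrow> nat \<times> (nat \<times> int) list"

definition wf_tm :: "tm \<Rightarrow> bool" where
  "wf_tm M \<longleftrightarrow>
     num_tapes M \<ge> 1 \<and> num_states M \<ge> 2 \<and> num_symbols M \<ge> 5 \<and>
     (\<forall>b q xs. q < num_states M \<and> length xs = num_tapes M \<and> set xs \<subseteq> {..<num_symbols M} \<longrightarrow>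
        fst (trans M b q xs) < num_states M \<and>
        length (snd (trans M b q xs)) = num_tapes M \<and>
        set (snd (trans M b q xs)) \<subseteq> {..<num_symbols M} \<times> {-1, 0, 1})"

definition deterministic :: "tm \<Rightarrow> bool" where
  "deterministic M \<longleftrightarrow> trans M True = trans M False"

record config =
  state :: nat
  head :: "nat \<Rightarrow> int"
  tape :: "nat \<Rightarrow> int \<Rightarrow> nat"

definition init_config :: "nat list \<Rightarrow> config" where
  "init_config w =
     \<lparr>state = 0,
      head = (\<lambda>_. 0),
      tape = (\<lambda>i z. if i = 0 \<and> 0 \<le> z \<and> z < int (length w) then w ! nat z else 0)\<rparr>"

definition step :: "tm \<Rightarrow> bool \<Rightarrow> config \<Rightarrow> config" where
  "step M b c =
     (if state c = 1 then c
      else let (q, acts) = trans M b (state c) (map (\<lambda>i. tape c i (head c i)) [0..<num_tapes M]) in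
        \<lparr>state = q,
         head = (\<lambda>i. if i < num_tapes M then head c i + snd (acts ! i) else head c i),
         tape = (\<lambda>i. if i < num_tapes M then (tape c i)(head c i := fst (acts ! i)) else tape c i)\<rparr>)"

text \<open>The configuration reached on input \<open>w\<close> after \<open>length bs\<close> steps with coin flips \<open>bs\<close>.\<close>

definition run :: "tm \<Rightarrow> nat list \<Rightarrow> bool list \<Rightarrow> config" where
  "run M w bs = fold (step M) bs (init_config w)"

text \<open>The output is what stands on tape 0 from cell 0 up to the first blank.\<close>

definition halts_with :: "config \<Rightarrow> nat list \<Rightarrow> bool" where
  "halts_with c v \<longleftrightarrow>
     state c = 1 \<and> 0 \<notin> set v \<and>
     (\<forall>i<length v. tape c 0 (int i) = v ! i) \<and> tape c 0 (int (length v)) = 0"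

definition computes_within :: "tm \<Rightarrow> nat list \<Rightarrow> nat \<Rightarrow> nat list \<Rightarrow> bool" where
  "computes_within M w t v \<longleftrightarrow> (\<forall>bs. length bs = t \<longrightarrow> halts_with (run M w bs) v)"

definition halts_within :: "tm \<Rightarrow> nat list \<Rightarrow> nat \<Rightarrow> bool" where
  "halts_within M w t \<longleftrightarrow> (\<forall>bs. length bs = t \<longrightarrow> state (run M w bs) = 1)"

definition prob_output :: "tm \<Rightarrow> nat list \<Rightarrow> nat \<Rightarrow> nat list \<Rightarrow> real" where
  "prob_output M w t v =
     measure_pmf.prob (pmf_of_set {bs. length bs = t}) {bs. halts_with (run M w bs) v}"

definition polynomially_bounded :: "(nat \<Rightarrow> nat) \<Rightarrow> bool" where
  "polynomially_bounded T \<longleftrightarrow> (\<exists>k. (\<lambda>n. real (T n)) \<in> O(\<lambda>n. real n ^ k))"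

section \<open>Encodings\<close>

text \<open>Least significant bit first; 0 is the empty word.\<close>

fun enc_nat :: "nat \<Rightarrow> nat list" where
  "enc_nat n = (if n = 0 then [] else (1 + n mod 2) # enc_nat (n div 2))"

declare enc_nat.simps [simp del]

text \<open>Only used for nonnegative rationals, which are encoded in lowest terms.\<close>

definition enc_rat :: "rat \<Rightarrow> nat list" where
  "enc_rat r = (case quotient_of r of (a, b) \<Rightarrow> enc_nat (nat a) @ [3] @ enc_nat (nat b) @ [3])"

definition enc_series_list :: "rat list list \<Rightarrow> nat list" where
  "enc_series_list I = concat (map (\<lambda>xs. concat (map enc_rat xs) @ [4]) I)"

section \<open>Approximation schemes\<close>

text \<open>
  Algorithms receive and return rational-valued series, as lists of rationals; the input is a
  duplicate-free list of series and the output is a rearrangement of it.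
\<close>

definition series_of :: "rat list \<Rightarrow> nat \<Rightarrow> real" where
  "series_of xs = restrict (\<lambda>j. of_rat (xs ! (j - 1))) {1..length xs}"

definition ordering_of :: "rat list list \<Rightarrow> nat \<Rightarrow> nat \<Rightarrow> real" where
  "ordering_of J k = series_of (J ! (k - 1))"

definition series_instance :: "nat \<Rightarrow> rat list list \<Rightarrow> bool" where
  "series_instance l I \<longleftrightarrow>
     distinct I \<and> (\<forall>xs\<in>set I. length xs = l \<and> (\<forall>x\<in>set xs. 0 \<le> x))"

lemma series_of_PiE:
  assumes "series_instance l I" and "xs \<in> set I"
  shows "series_of xs \<in> {1..l} \<rightarrow>\<^sub>E {0..}"
  using assms by (auto simp: series_instance_def series_of_def)

lemma inj_on_series_of:
  assumes "series_instance l I"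
  shows "inj_on series_of (set I)"
proof (rule inj_onI)
  fix xs ys
  assume xy: "xs \<in> set I" "ys \<in> set I" and eq: "series_of xs = series_of ys"
  from xy assms have len: "length xs = l" "length ys = l"
    by (auto simp: series_instance_def)
  show "xs = ys"
  proof (rule nth_equalityI)
    fix i assume "i < length xs"
    with len fun_cong[OF eq, of "Suc i"] show "xs ! i = ys ! i"
      by (simp add: series_of_def)
  qed (simp add: len)
qed

lemma card_series_of:
  assumes "series_instance l I"
  shows "card (series_of ` set I) = length I"
  using card_image[OF inj_on_series_of[OF assms]] assms
  by (simp add: series_instance_def distinct_card)

lemma ordering_of_in_orderings:
  assumes "series_instance l I" and "mset J = mset I"
  shows "ordering_of J \<in> orderings (series_of ` set I)"
proof -
  have J: "distinct J" "set J = set I" "length J = length I"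
    using assms mset_eq_imp_distinct_iff[of J I] mset_eq_setD[of J I] mset_eq_length[of J I]
    by (simp_all add: series_instance_def)
  have "bij_betw (\<lambda>k. k - 1) {1..length J} {..<length J}"
    by (rule bij_betw_byWitness[where f' = Suc]) auto
  moreover have "bij_betw ((!) J) {..<length J} (set J)"
    using J(1) by (simp add: bij_betw_nth)
  moreover have "bij_betw series_of (set J) (series_of ` set J)"
    using inj_on_series_of[OF assms(1)] J(2) by (simp add: bij_betw_def)
  ultimately have "bij_betw (series_of \<circ> ((!) J \<circ> (\<lambda>k. k - 1))) {1..length J} (series_of ` set J)"
    by (intro bij_betw_trans)
  moreover have "series_of \<circ> ((!) J \<circ> (\<lambda>k. k - 1)) = ordering_of J"
    by (auto simp: ordering_of_def)
  ultimately show ?thesis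
    using J card_series_of[OF assms(1)] by (simp add: orderings_def)
qed

definition has_ptas :: "(nat \<Rightarrow> nat \<Rightarrow> (nat \<Rightarrow> nat \<Rightarrow> real) \<Rightarrow> real) \<Rightarrow> bool" where
  "has_ptas cost \<longleftrightarrow>
     (\<forall>\<delta>>0. \<exists>M T. wf_tm M \<and> deterministic M \<and> polynomially_bounded T \<and>
        (\<forall>l I. series_instance l I \<longrightarrow>
           (\<exists>J. mset J = mset I \<and>
                computes_within M (enc_series_list I) (T (length (enc_series_list I)))
                  (enc_series_list J) \<and>
                cost l (length I) (ordering_of J) \<le>
                  (1 + \<delta>) * (INF \<pi>\<in>orderings (series_of ` set I). cost l (length I) \<pi>))))"

section \<open>Satisfiability\<close>

text \<open>A literal is a variable together with its polarity, a CNF formula a list of clauses.\<close>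

type_synonym cnf = "(bool \<times> nat) list list"

definition satisfiable :: "cnf \<Rightarrow> bool" where
  "satisfiable \<phi> \<longleftrightarrow> (\<exists>\<alpha>. \<forall>C\<in>set \<phi>. \<exists>(s, x)\<in>set C. \<alpha> x = s)"

definition enc_bool :: "bool \<Rightarrow> nat" where
  "enc_bool b = (if b then 2 else 1)"

definition enc_cnf :: "cnf \<Rightarrow> nat list" where
  "enc_cnf \<phi> = concat (map (\<lambda>C. concat (map (\<lambda>(s, x). enc_bool s # enc_nat x @ [3]) C) @ [4]) \<phi>)"

text \<open>Bounded two-sided error; the time bound holds for all outcomes of the coin flips.\<close>

definition decides_sat_within :: "tm \<Rightarrow> (nat \<Rightarrow> nat) \<Rightarrow> bool" where
  "decides_sat_within M T \<longleftrightarrow>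
     (\<forall>\<phi>. let w = enc_cnf \<phi>; t = T (length w) in
        halts_within M w t \<and> prob_output M w t [enc_bool (satisfiable \<phi>)] \<ge> 2 / 3)"

end

theory Submission
  imports Defs
begin

text \<open>
  A PTAS even puts SAT into deterministic polynomial time. A formula is first turned into an exact cover
  instance over \<open>z\<close> elements with row set \<open>R\<close>. Its time series have the difference vectors
  (up to sign duplicates) of a full row, entering with sign \<open>-1\<close>, the rows of \<open>R\<close>, and \<open>N\<close>
  zero rows, where every element is repeated in \<open>N\<close> columns, and every row \<open>j\<close> has in addition a private
  column: row \<open>j \<noteq> 0\<close> goes up there while row 0 goes down in all private columns. As long as row 0 is
  absent, the private columns cost as much as there are rows present, afterwards as many as
  there are rows missing. Hence, if an exact cover exists, it is best to put row 0 in the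
  middle, followed at once by the cover, which cancels the repeated columns. If there is none,
  after row 0 at least one repeated element contributes at least \<open>N\<close> in every prefix, so that row 0 has to be
  put near the end. A fixed factor separates the two cases, and the position
  of row 0 in a near-optimal ordering, recognisable by its first bit, answers the question.
  A large common offset makes all weights of the weighted problem nearly equal and serves as
  identifier of a row. Polynomial time is below \<open>2 powr (n powr \<epsilon>)\<close> eventually.
\<close>

section \<open>A programming language for multi-tape machines\<close>

text \<open>In a good ordering almost every prefix sum is -1, 0 or 1, so its \<open>p\<close>-th
  power is independent of \<open>p\<close>, and the accuracy 1/40 serves for every \<open>p\<close>
  and both problems. Let \<open>A\<close> rows precede row 0 and \<open>b\<close> follow it. Up to a
  common factor the private columns cost about (A^2 + b^2)/2. With a cover the middle position costs
  about N^2/4, whereas A > 2 b costs at least about 5 N^2/18. Without a cover the repeated columns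
  add N b: a late row 0 costs about N^2/2, whereas A \<le> 2 b costs at least about 11 N^2/18. The
  ratios 10/9 and 11/9 exceed 1.042, which is above 41/40 (approximation) times 129/128 (uneven
  weights). The exceptional prefixes, with an incomplete cover or surplus rows, number at most R + 1
  for R pattern rows, but have entries up to R + 1 in absolute value. \<open>N\<close> is chosen so
  large that their total N z (R + 1)^(p + 1) is negligible against N^2; for fixed \<open>p\<close>
  it remains polynomial. Hypothesis and conclusion both speak of Turing machines, so the reduction
  has to be an actual machine that runs the given one on extra tapes, with an explicit bound on its
  steps.\<close>

text \<open>\<open>Prim r r' g\<close> acts on tape \<open>r'\<close> only, depending on the symbols scanned on \<open>r\<close> and \<open>r'\<close>.
  \<open>Call M q off h\<close> simulates \<open>M\<close> from state \<open>q\<close> on the tapes from \<open>off\<close> on and logs the head movements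
  of its tape 0 on tape \<open>h\<close> (\<open>-1, 0, 1\<close> as \<open>1, 2, 3\<close>), because afterwards the head has to find its way
  back to cell 0.\<close>

datatype com =
    Skip
  | Prim nat nat "nat \<Rightarrow> nat \<Rightarrow> nat \<times> int"
  | Seq com com (infixr \<open>;;\<close> 60)
  | If nat nat "nat \<Rightarrow> nat \<Rightarrow> bool" com com
  | While nat nat "nat \<Rightarrow> nat \<Rightarrow> bool" com
  | Call tm nat nat nat

section \<open>Small-step semantics of programs\<close>

definition noop :: "nat list \<Rightarrow> (nat \<times> int) list" where
  "noop xs = map (\<lambda>x. (x, 0)) xs"

text \<open>The symbol test for \<open>Call\<close> is there because the compiled machine must
  behave well on its whole alphabet, while \<open>wf_tm M\<close> restricts \<open>M\<close> only on
  symbols below \<open>num_symbols M\<close>. The coin is fixed to \<open>False\<close>, as the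
  machines called are deterministic.\<close>

fun nxt :: "com \<Rightarrow> nat list \<Rightarrow> com \<times> (nat \<times> int) list" where
  "nxt Skip xs = (Skip, noop xs)"
| "nxt (Prim r r' g) xs = (Skip, (noop xs)[r' := g (xs ! r) (xs ! r')])"
| "nxt (c ;; d) xs =
     (if c = Skip then (d, noop xs) else (fst (nxt c xs) ;; d, snd (nxt c xs)))"
| "nxt (If r r' P c d) xs = (if P (xs ! r) (xs ! r') then c else d, noop xs)"
| "nxt (While r r' P c) xs =
     (if P (xs ! r) (xs ! r') then c ;; While r r' P c else Skip, noop xs)"
| "nxt (Call M q off h) xs =
     (if q = 1 \<or> \<not> set (drop off xs) \<subseteq> {..<num_symbols M} then (Skip, noop xs)
      else let (q', as) = trans M False q (drop off xs) in
        (Call M q' off h, (take off (noop xs) @ as)[h := (nat (2 + snd (as ! 0)), 1)]))"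

text \<open>Here \<open>k\<close> is the number of tapes and \<open>m\<close> the alphabet size of
  the compiled machine. The condition \<open>4 \<le> m\<close> makes room for the codes 1, 2, 3 of
  the movement log.\<close>

primrec wfc :: "nat \<Rightarrow> nat \<Rightarrow> com \<Rightarrow> bool" where
  "wfc k m Skip = True"
| "wfc k m (Prim r r' g) = (r < k \<and> r' < k \<and> (\<forall>x<m. \<forall>y<m. g x y \<in> {..<m} \<times> {-1, 0, 1}))"
| "wfc k m (c ;; d) = (wfc k m c \<and> wfc k m d)"
| "wfc k m (If r r' P c d) = (wfc k m c \<and> wfc k m d)"
| "wfc k m (While r r' P c) = wfc k m c"
| "wfc k m (Call M q off h) =
     (wf_tm M \<and> q < num_states M \<and> off + num_tapes M = k \<and> h < off \<and> 4 \<le> m \<and> num_symbols M \<le> m)"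

text \<open>A finite superset of the programs that execution can reach, although
  \<open>While\<close> keeps unfolding; its elements become the states of the compiled
  machine.\<close>

primrec conts :: "com \<Rightarrow> com set" where
  "conts Skip = {Skip}"
| "conts (Prim r r' g) = {Prim r r' g, Skip}"
| "conts (c ;; d) = (\<lambda>c'. c' ;; d) ` conts c \<union> conts d"
| "conts (If r r' P c d) = {If r r' P c d} \<union> conts c \<union> conts d"
| "conts (While r r' P c) = {While r r' P c, Skip} \<union> (\<lambda>c'. c' ;; While r r' P c) ` conts c"
| "conts (Call M q off h) = {Skip, Call M q off h} \<union> (\<lambda>q. Call M q off h) ` {..<num_states M}"

lemma finite_conts: "finite (conts c)"
  by (induction c) auto

lemma self_in_conts: "c \<in> conts c"
  by (induction c) auto

lemma Skip_in_conts: "Skip \<in> conts c"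
  by (induction c) auto

lemma trans_wf:
  assumes "wf_tm M" "q < num_states M" "length xs = num_tapes M" "set xs \<subseteq> {..<num_symbols M}"
    and "trans M b q xs = (q', as)"
  shows "q' < num_states M" "length as = num_tapes M"
    "set as \<subseteq> {..<num_symbols M} \<times> {-1, 0, 1}"
proof -
  have "fst (trans M b q xs) < num_states M \<and> length (snd (trans M b q xs)) = num_tapes M \<and>
      set (snd (trans M b q xs)) \<subseteq> {..<num_symbols M} \<times> {-1, 0, 1}"
    using assms(1-4) unfolding wf_tm_def by blast
  then show "q' < num_states M" "length as = num_tapes M"
    "set as \<subseteq> {..<num_symbols M} \<times> {-1, 0, 1}" using assms(5) by simp_all
qed

lemma conts_nxt:
  assumes "wfc k m c" "c' \<in> conts c" "length xs = k"
  shows "fst (nxt c' xs) \<in> conts c"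
  using assms
proof (induction c arbitrary: c')
  case (Seq c d)
  then show ?case using self_in_conts[of d] by (auto split: if_splits)
next
  case (If r r' P c d)
  then show ?case using self_in_conts[of d] self_in_conts[of c] by (auto split: if_splits)
next
  case (While r r' P c)
  then show ?case using self_in_conts[of c] by (auto split: if_splits)
next
  case (Call M q off h)
  show ?case
  proof (cases "c' = Skip")
    case False
    with Call.prems obtain q1 where q1: "c' = Call M q1 off h" "q1 < num_states M" by auto
    show ?thesis
    proof (cases "q1 = 1 \<or> \<not> set (drop off xs) \<subseteq> {..<num_symbols M}")
      case False
      obtain q' as where t: "trans M False q1 (drop off xs) = (q', as)" by force
      have "q' < num_states M"
        by (rule trans_wf(1)[OF _ q1(2) _ _ t]) (use Call.prems False in auto)
      with False t q1 show ?thesis by simp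
    qed (auto simp: q1)
  qed simp
qed auto

lemma length_nxt:
  assumes "wfc k m c" "c' \<in> conts c" "length xs = k"
  shows "length (snd (nxt c' xs)) = k"
  using assms
proof (induction c arbitrary: c')
  case (Call M q off h)
  show ?case
  proof (cases "c' = Skip")
    case False
    with Call.prems obtain q1 where q1: "c' = Call M q1 off h" "q1 < num_states M" by auto
    show ?thesis
    proof (cases "q1 = 1 \<or> \<not> set (drop off xs) \<subseteq> {..<num_symbols M}")
      case False
      obtain q' as where t: "trans M False q1 (drop off xs) = (q', as)" by force
      have "length as = num_tapes M"
        by (rule trans_wf(2)[OF _ q1(2) _ _ t]) (use Call.prems False in auto)
      with False t q1 Call.prems show ?thesis by (simp add: noop_def)
    qed (use Call.prems q1 in \<open>auto simp: noop_def\<close>)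
  qed (use Call.prems in \<open>simp add: noop_def\<close>)
qed (auto simp: noop_def split: if_splits)

definition valid :: "nat \<Rightarrow> (nat \<times> int) list \<Rightarrow> bool" where
  "valid m as \<longleftrightarrow> set as \<subseteq> {..<m} \<times> {-1, 0, 1}"

lemma valid_noop: "set xs \<subseteq> {..<m} \<Longrightarrow> valid m (noop xs)"
  by (auto simp: valid_def noop_def)

lemma valid_update: "valid m as \<Longrightarrow> a \<in> {..<m} \<times> {-1, 0, 1} \<Longrightarrow> valid m (as[i := a])"
  unfolding valid_def by (intro order_trans[OF set_update_subset_insert] insert_subsetI)

lemma valid_nxt:
  assumes "wfc k m c" "c' \<in> conts c" "length xs = k" "set xs \<subseteq> {..<m}"
  shows "valid m (snd (nxt c' xs))"
  using assms
proof (induction c arbitrary: c')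
  case (Prim r r' g)
  have "xs ! r \<in> set xs" "xs ! r' \<in> set xs" using Prim.prems by simp_all
  then have "xs ! r < m" "xs ! r' < m" using Prim.prems(4) by auto
  then have "g (xs ! r) (xs ! r') \<in> {..<m} \<times> {-1, 0, 1}" using Prim.prems by simp
  then show ?case using Prim.prems(2) valid_noop[OF Prim.prems(4)]
    by (auto intro!: valid_update)
next
  case (Call M q off h)
  note no = valid_noop[OF Call.prems(4)]
  show ?case
  proof (cases "c' = Skip")
    case False
    with Call.prems obtain q1 where q1: "c' = Call M q1 off h" "q1 < num_states M" by auto
    show ?thesis
    proof (cases "q1 = 1 \<or> \<not> set (drop off xs) \<subseteq> {..<num_symbols M}")
      case False
      obtain q' as where t: "trans M False q1 (drop off xs) = (q', as)" by force
      have as: "length as = num_tapes M" "set as \<subseteq> {..<num_symbols M} \<times> {-1, 0, 1}"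
        by (rule trans_wf(2)[OF _ q1(2) _ _ t] trans_wf(3)[OF _ q1(2) _ _ t]; use Call.prems False in auto)+
      have "num_tapes M \<ge> 1" using Call.prems by (auto simp: wf_tm_def)
      then have "as ! 0 \<in> set as" using as(1) by (intro nth_mem) auto
      with as(2) have "snd (as ! 0) \<in> {-1, 0, 1}" by auto
      then have new: "(nat (2 + snd (as ! 0)), 1::int) \<in> {..<m} \<times> {-1, 0, 1}"
        using Call.prems(1) by (elim insertE) auto
      have "{..<num_symbols M} \<subseteq> {..<m}" using Call.prems(1) by auto
      then have "set as \<subseteq> {..<m} \<times> {-1, 0, 1}"
        using order_trans[OF as(2) Sigma_mono[OF _ order_refl]] by simp
      then have "valid m (take off (noop xs) @ as)"
        using no set_take_subset[of off "noop xs"] unfolding valid_def by simp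
      with False t q1 new show ?thesis by (auto intro!: valid_update)
    qed (use no q1 in \<open>auto\<close>)
  qed (use no in auto)
qed (auto simp: valid_noop split: if_splits)

section \<open>Compilation into Turing machines\<close>

type_synonym store = "nat \<Rightarrow> int \<times> (int \<Rightarrow> nat)"

definition rd :: "int \<times> (int \<Rightarrow> nat) \<Rightarrow> nat" where
  "rd t = snd t (fst t)"

definition act :: "nat \<times> int \<Rightarrow> int \<times> (int \<Rightarrow> nat) \<Rightarrow> int \<times> (int \<Rightarrow> nat)" where
  "act a t = (fst t + snd a, (snd t)(fst t := fst a))"

definition cstep :: "nat \<Rightarrow> com \<times> store \<Rightarrow> com \<times> store" where
  "cstep k x = (let (c, as) = nxt (fst x) (map (\<lambda>i. rd (snd x i)) [0..<k]) in
     (c, \<lambda>i. if i < k then act (as ! i) (snd x i) else snd x i))"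

lemma act_noop: "act (rd t, 0) t = t"
  by (simp add: act_def rd_def)

lemma cstep_noop:
  assumes "nxt c (map (\<lambda>i. rd (s i)) [0..<k]) = (c', noop (map (\<lambda>i. rd (s i)) [0..<k]))"
  shows "cstep k (c, s) = (c', s)"
  using assms by (auto simp: cstep_def noop_def act_noop fun_eq_iff)

lemma cstep_Skip: "cstep k (Skip, s) = (Skip, s)"
  by (rule cstep_noop) simp

lemma cstep_Skip_pow: "(cstep k ^^ t) (Skip, s) = (Skip, s)"
  by (induction t) (simp_all add: cstep_Skip)

definition conf :: "nat \<Rightarrow> store \<Rightarrow> config" where
  "conf q s = \<lparr>state = q, head = (\<lambda>i. fst (s i)), tape = (\<lambda>i. snd (s i))\<rparr>"

text \<open>One machine step simulates one \<open>cstep\<close>, with continuations as states. Since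
  \<open>Skip\<close> and the halting state are both absorbing, every coin sequence of length at
  least \<open>t\<close> ends in the same configuration, so an upper bound on the running time
  suffices.\<close>

theorem compile:
  assumes wf: "wfc k m c" and k: "k \<ge> 1" and m: "m \<ge> 5" and c: "c \<noteq> Skip"
  obtains M where "wf_tm M" "deterministic M" "num_tapes M = k"
    "\<And>s s' t bs. (cstep k ^^ t) (c, s) = (Skip, s') \<Longrightarrow> length bs \<ge> t \<Longrightarrow>
       fold (step M) bs (conf 0 s) = conf 1 s'"
proof -
  obtain ys where ys: "set ys = conts c - {c, Skip}" "distinct ys"
    using finite_distinct_list[of "conts c - {c, Skip}"] finite_conts by auto
  \<comment> \<open>The numbering gives the start program state 0 and \<open>Skip\<close> state 1,
    as the machine model prescribes; this is why \<open>c\<close> must differ from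
    \<open>Skip\<close>.\<close>
  define L where "L = c # Skip # ys"
  have L: "set L = conts c" "distinct L"
    using ys c self_in_conts[of c] Skip_in_conts[of c] by (auto simp: L_def)
  define enc where "enc c' = (THE i. i < length L \<and> L ! i = c')" for c'
  have encI: "enc (L ! i) = i" if "i < length L" for i
    unfolding enc_def by (rule the_equality) (use that L(2) nth_eq_iff_index_eq in \<open>auto\<close>)
  have enc: "enc c' < length L" "L ! enc c' = c'" if "c' \<in> conts c" for c'
  proof -
    from that L(1) have "c' \<in> set L" by simp
    then obtain i where "i < length L" "L ! i = c'" by (auto simp: in_set_conv_nth)
    with encI[of i] show "enc c' < length L" "L ! enc c' = c'" by auto
  qed
  have enc0: "enc c = 0" "enc Skip = 1"
    using encI[of 0] encI[of 1] by (auto simp: L_def)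
  define M where "M = \<lparr>num_tapes = k, num_states = length L, num_symbols = m,
    trans = (\<lambda>b q xs. let (c', as) = nxt (L ! q) xs in (enc c', as))\<rparr>"
  have Mk: "num_tapes M = k" "num_symbols M = m" by (simp_all add: M_def)
  show thesis
  proof
    show "wf_tm M"
      unfolding wf_tm_def
    proof (intro conjI allI impI)
      fix b q xs assume "q < num_states M \<and> length xs = num_tapes M \<and> set xs \<subseteq> {..<num_symbols M}"
      then have a: "q < num_states M" "length xs = num_tapes M" "set xs \<subseteq> {..<num_symbols M}"
        by simp_all
      have q: "L ! q \<in> conts c" using a(1) L(1) nth_mem[of q L] by (simp add: M_def)
      have "fst (nxt (L ! q) xs) \<in> conts c"
        by (rule conts_nxt[OF wf q]) (use a in \<open>simp add: M_def\<close>)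
      then show "fst (trans M b q xs) < num_states M"
        using enc(1) by (simp add: M_def split_beta)
      show "length (snd (trans M b q xs)) = num_tapes M"
        using length_nxt[OF wf q, of xs] a by (simp add: M_def split_beta)
      show "set (snd (trans M b q xs)) \<subseteq> {..<num_symbols M} \<times> {-1, 0, 1}"
        using valid_nxt[OF wf q, of xs] a by (simp add: M_def split_beta valid_def)
    qed (use k m in \<open>simp_all add: M_def L_def\<close>)
    show "deterministic M" by (simp add: deterministic_def M_def fun_eq_iff)
    show "num_tapes M = k" by (simp add: Mk)
    have sim: "step M b (conf (enc c') s) = conf (enc (fst (cstep k (c', s)))) (snd (cstep k (c', s)))"
      if c': "c' \<in> conts c" for b c' s
    proof (cases "enc c' = 1")
      case True
      then have "c' = Skip" using enc(2)[OF c'] by (simp add: L_def)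
      then show ?thesis using enc0 by (simp add: cstep_Skip step_def conf_def)
    next
      case False
      obtain c2 as where n: "nxt c' (map (\<lambda>i. rd (s i)) [0..<k]) = (c2, as)" by force
      from False show ?thesis
        by (simp add: step_def conf_def M_def enc(2)[OF c'] cstep_def n[unfolded rd_def] n rd_def act_def
            fun_eq_iff)
    qed
    have inv: "fst (cstep k (c', s)) \<in> conts c" if "c' \<in> conts c" for c' s
      using conts_nxt[OF wf that] by (simp add: cstep_def split_beta)
    have main: "fold (step M) bs (conf (enc c') s) = conf 1 s'"
      if "c' \<in> conts c" "(cstep k ^^ t) (c', s) = (Skip, s')" "length bs \<ge> t" for c' s s' t bs
      using that
    proof (induction bs arbitrary: c' s t)
      case Nil
      then show ?case by (simp add: enc0)
    next
      case (Cons b bs)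
      obtain c2 s2 where x: "cstep k (c', s) = (c2, s2)" by force
      have c2: "c2 \<in> conts c" using inv[OF Cons.prems(1), of s] x by simp
      have eq: "fold (step M) (b # bs) (conf (enc c') s) = fold (step M) bs (conf (enc c2) s2)"
        using sim[OF Cons.prems(1), of b s] x by simp
      show ?case
      proof (cases t)
        case 0
        then have "c2 = Skip" "s2 = s'" using Cons.prems(2) x by (auto simp: cstep_Skip)
        then show ?thesis unfolding eq using Cons.IH[OF c2, of 0 s2] by simp
      next
        case (Suc u)
        then have "(cstep k ^^ u) (c2, s2) = (Skip, s')"
          using Cons.prems(2) x by (simp add: funpow_swap1[of "cstep k"] funpow_Suc_right del: funpow.simps)
        then show ?thesis unfolding eq using Cons.prems(3) Suc by (intro Cons.IH[OF c2]) auto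
      qed
    qed
    show "fold (step M) bs (conf 0 s) = conf 1 s'"
      if "(cstep k ^^ t) (c, s) = (Skip, s')" "length bs \<ge> t" for s s' t bs
      using main[OF self_in_conts that] enc0 by simp
  qed
qed

section \<open>Tapes as stacks\<close>

text \<open>The blank in cell 0 marks the bottom of the stack, and the head scans the top.\<close>

definition stk :: "nat list \<Rightarrow> int \<times> (int \<Rightarrow> nat)" where
  "stk xs = (int (length xs),
     \<lambda>z. if 1 \<le> z \<and> z \<le> int (length xs) then xs ! (length xs - nat z) else 0)"

lemma rd_stk_Nil [simp]: "rd (stk []) = 0"
  by (simp add: rd_def stk_def)

lemma rd_stk_Cons [simp]: "rd (stk (x # xs)) = x"
  by (simp add: rd_def stk_def)

lemma act_pop: "act (0, -1) (stk (x # xs)) = stk xs"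
proof -
  have "length xs + 1 - nat z = Suc (length xs - nat z)" if "1 \<le> z" "z \<le> int (length xs)" for z
    using that by linarith
  then show ?thesis by (auto simp: act_def stk_def fun_eq_iff)
qed

lemma act_push: "act (y, 0) (act (rd (stk xs), 1) (stk xs)) = stk (y # xs)"
proof -
  have "length xs + 1 - nat z = Suc (length xs - nat z)" if "1 \<le> z" "z \<le> int (length xs)" for z
    using that by linarith
  then show ?thesis by (auto simp: act_def stk_def rd_def fun_eq_iff)
qed

text \<open>A machine action writes before it moves, so a push takes two steps: move to the fresh
  cell, leaving the old top unchanged, and write there.\<close>

definition put :: "nat \<Rightarrow> (nat \<Rightarrow> nat) \<Rightarrow> nat \<Rightarrow> com" where
  "put r f r' = (Prim r' r' (\<lambda>_ x. (x, 1)) ;; Prim r r' (\<lambda>a _. (f a, 0)))"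

definition push :: "nat \<Rightarrow> nat \<Rightarrow> com" where
  "push r a = put r (\<lambda>_. a) r"

definition pop :: "nat \<Rightarrow> com" where
  "pop r = Prim r r (\<lambda>_ _. (0, -1))"

abbreviation WhileNE :: "nat \<Rightarrow> com \<Rightarrow> com" where
  "WhileNE r c \<equiv> While r r (\<lambda>x _. x \<noteq> 0) c"

definition move :: "nat \<Rightarrow> nat \<Rightarrow> com" where
  "move r r' = WhileNE r (put r id r' ;; pop r)"

text \<open>An element is popped only after \<open>c\<close> has run, so that \<open>c\<close> can
  scan it on \<open>r\<close>. Moving everything to \<open>r'\<close> and back reverses twice and
  hence restores \<open>r\<close>.\<close>

definition foreach :: "nat \<Rightarrow> nat \<Rightarrow> com \<Rightarrow> com" where
  "foreach r r' c = WhileNE r (c ;; put r id r' ;; pop r) ;; move r' r"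

definition clear :: "nat \<Rightarrow> com" where
  "clear r = WhileNE r (pop r)"

section \<open>Time-bounded execution\<close>

text \<open>A step count is always of the form \<open>B ^ e\<close>: this is closed under sequencing, and under loops
  with at most \<open>B\<close> iterations.\<close>

locale tapes =
  fixes k B :: nat
  assumes k: "40 \<le> k" and B: "16 \<le> B"
begin

definition runs :: "nat \<Rightarrow> com \<Rightarrow> store \<Rightarrow> store \<Rightarrow> bool" where
  "runs e c s s' \<longleftrightarrow> (\<exists>t\<le>B ^ e. (cstep k ^^ t) (c, s) = (Skip, s'))"

lemma reg [simp]: "r < 40 \<Longrightarrow> r < k"
  using k by simp

lemma runs_weaken: "runs e c s s' \<Longrightarrow> e \<le> e' \<Longrightarrow> runs e' c s s'"
proof -
  assume "runs e c s s'" "e \<le> e'"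
  moreover from this have "B ^ e \<le> B ^ e'" using B by (intro power_increasing) simp_all
  ultimately show ?thesis unfolding runs_def by (meson le_trans)
qed

lemma runs_eq: "runs e c s s1 \<Longrightarrow> s1 = s' \<Longrightarrow> e \<le> e' \<Longrightarrow> runs e' c s s'"
  using runs_weaken by blast

lemma runs_Skip: "runs 0 Skip s s"
  unfolding runs_def by (rule exI[of _ 0]) simp

text \<open>The count may drop below \<open>t\<close>: \<open>c\<close> may have been resting in
  \<open>Skip\<close>, whereas the sequence would already have passed on to
  \<open>d\<close>.\<close>

lemma cstep_Seq:
  assumes "(cstep k ^^ t) (c, s) = (Skip, s')"
  shows "\<exists>t'\<le>t. (cstep k ^^ t') (c ;; d, s) = (Skip ;; d, s')"
  using assms
proof (induction t arbitrary: c s)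
  case (Suc t)
  show ?case
  proof (cases "c = Skip")
    case True
    then have "s = s'" using Suc.prems cstep_Skip_pow[where t = "Suc t"] by (simp del: funpow.simps)
    with True show ?thesis by (intro exI[of _ 0]) simp
  next
    case False
    obtain c2 s2 where x: "cstep k (c, s) = (c2, s2)" by force
    with Suc.prems have "(cstep k ^^ t) (c2, s2) = (Skip, s')"
      by (simp add: funpow_Suc_right del: funpow.simps)
    from Suc.IH[OF this] obtain t' where t': "t' \<le> t" "(cstep k ^^ t') (c2 ;; d, s2) = (Skip ;; d, s')"
      by blast
    have "cstep k (c ;; d, s) = (c2 ;; d, s2)"
      using x False by (auto simp: cstep_def split_beta)
    with t' show ?thesis
      by (intro exI[of _ "Suc t'"]) (simp add: funpow_Suc_right del: funpow.simps)
  qed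
qed (auto intro!: exI[of _ 0])

lemma steps_Seq:
  assumes "(cstep k ^^ t) (c, s) = (Skip, s1)" "(cstep k ^^ u) (d, s1) = (Skip, s')"
  shows "\<exists>v\<le>t + u + 1. (cstep k ^^ v) (c ;; d, s) = (Skip, s')"
proof -
  from cstep_Seq[OF assms(1)] obtain t' where
    t': "t' \<le> t" "(cstep k ^^ t') (c ;; d, s) = (Skip ;; d, s1)" by blast
  have "cstep k (Skip ;; d, s1) = (d, s1)" by (rule cstep_noop) simp
  with t'(2) assms(2) have "(cstep k ^^ (u + (1 + t'))) (c ;; d, s) = (Skip, s')"
    unfolding funpow_add by simp
  with t'(1) show ?thesis by (intro exI[of _ "u + (1 + t')"]) simp
qed

text \<open>The size of \<open>B\<close> pays for the addition, so exponents simply add up with one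
  extra and no multiplicative constants have to be carried along.\<close>

lemma pow_sum: "B ^ e1 + B ^ e2 + 2 \<le> B ^ (e1 + e2 + 1)"
proof -
  have p: "1 \<le> B ^ e1" "1 \<le> B ^ e2" using B by simp_all
  have "B ^ e1 \<le> B ^ e1 * B ^ e2" "B ^ e2 \<le> B ^ e1 * B ^ e2" "1 \<le> B ^ e1 * B ^ e2"
    using p by (simp_all add: mult_le_mono1 mult_le_mono2)
  then have "B ^ e1 + B ^ e2 + 2 \<le> 16 * (B ^ e1 * B ^ e2)" by linarith
  also have "\<dots> \<le> B * (B ^ e1 * B ^ e2)" using B by simp
  finally show ?thesis by (simp add: power_add algebra_simps)
qed

lemma runs_Seq:
  assumes "runs e1 c s s1" "runs e2 d s1 s'"
  shows "runs (e1 + e2 + 1) (c ;; d) s s'"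
proof -
  from assms obtain t u where "t \<le> B ^ e1" "(cstep k ^^ t) (c, s) = (Skip, s1)"
    "u \<le> B ^ e2" "(cstep k ^^ u) (d, s1) = (Skip, s')" by (auto simp: runs_def)
  moreover from steps_Seq[OF this(2,4)] obtain v where
    "v \<le> t + u + 1" "(cstep k ^^ v) (c ;; d, s) = (Skip, s')" by blast
  ultimately show ?thesis unfolding runs_def using pow_sum[of e1 e2] by (intro exI[of _ v]) auto
qed

lemma runs_step:
  assumes "cstep k (c, s) = (c', s1)" "runs e c' s1 s'"
  shows "runs (e + 1) c s s'"
proof -
  from assms(2) obtain t where t: "t \<le> B ^ e" "(cstep k ^^ t) (c', s1) = (Skip, s')"
    by (auto simp: runs_def)
  have "(cstep k ^^ Suc t) (c, s) = (Skip, s')"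
    using t(2) assms(1) by (simp add: funpow_Suc_right del: funpow.simps)
  moreover have "Suc t \<le> B ^ (e + 1)" using t(1) pow_sum[of e 0] by simp
  ultimately show ?thesis unfolding runs_def by blast
qed

lemma runs_Prim:
  assumes "r < k" "r' < k" "s' = s(r' := act (g (rd (s r)) (rd (s r'))) (s r'))"
  shows "runs 0 (Prim r r' g) s s'"
proof -
  have "cstep k (Prim r r' g, s) = (Skip, s')"
    using assms by (auto simp: cstep_def noop_def act_noop fun_eq_iff nth_list_update)
  then show ?thesis unfolding runs_def by (intro exI[of _ 1]) simp
qed

lemma runs_If:
  assumes "r < k" "r' < k"
    and "P (rd (s r)) (rd (s r')) \<Longrightarrow> runs e c s s'" "\<not> P (rd (s r)) (rd (s r')) \<Longrightarrow> runs e d s s'"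
  shows "runs (e + 1) (If r r' P c d) s s'"
proof (cases "P (rd (s r)) (rd (s r'))")
  case True
  then have "cstep k (If r r' P c d, s) = (c, s)" by (intro cstep_noop) (simp add: assms)
  from runs_step[OF this assms(3)[OF True]] show ?thesis .
next
  case False
  then have "cstep k (If r r' P c d, s) = (d, s)" by (intro cstep_noop) (simp add: assms)
  from runs_step[OF this assms(4)[OF False]] show ?thesis .
qed

text \<open>One of the two additional factors \<open>B\<close> bounds the number of iterations, the
  other absorbs the steps spent on testing and on returning to the loop.\<close>

lemma runs_loop:
  assumes r: "r < k" "r' < k"
    and P: "\<And>i. i < n \<Longrightarrow> P (rd (f i r)) (rd (f i r'))" "\<not> P (rd (f n r)) (rd (f n r'))"
    and body: "\<And>i. i < n \<Longrightarrow> runs e c (f i) (f (Suc i))"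
    and n: "n \<le> B"
  shows "runs (e + 2) (While r r' P c) (f 0) (f n)"
proof -
  \<comment> \<open>Induction on the number \<open>j\<close> of iterations that remain. Each pays 2
    extra steps, for the test and for leaving the finished body; the last 1 is the failing
    test.\<close>
  have "\<exists>t\<le>j * (B ^ e + 2) + 1. (cstep k ^^ t) (While r r' P c, f (n - j)) = (Skip, f n)"
    if "j \<le> n" for j
    using that
  proof (induction j)
    case 0
    have "cstep k (While r r' P c, f n) = (Skip, f n)"
      by (rule cstep_noop) (use P(2) r in simp)
    then show ?case by (intro exI[of _ 1]) simp
  next
    case (Suc j)
    let ?i = "n - Suc j"
    have i: "?i < n" "Suc ?i = n - j" using Suc.prems by auto
    have st: "cstep k (While r r' P c, f ?i) = (c ;; While r r' P c, f ?i)"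
      by (rule cstep_noop) (use P(1)[OF i(1)] r in simp)
    from Suc obtain t where t: "t \<le> j * (B ^ e + 2) + 1"
      "(cstep k ^^ t) (While r r' P c, f (n - j)) = (Skip, f n)" by auto
    from body[OF i(1)] i(2) obtain u where u: "u \<le> B ^ e" "(cstep k ^^ u) (c, f ?i) = (Skip, f (n - j))"
      by (auto simp: runs_def)
    from steps_Seq[OF u(2) t(2)] obtain v where v: "v \<le> u + t + 1"
      "(cstep k ^^ v) (c ;; While r r' P c, f ?i) = (Skip, f n)" by blast
    have "(cstep k ^^ Suc v) (While r r' P c, f ?i) = (Skip, f n)"
      using v(2) st by (simp add: funpow_Suc_right del: funpow.simps)
    moreover have "Suc v \<le> Suc j * (B ^ e + 2) + 1" using v(1) u(1) t(1) by simp
    ultimately show ?case by blast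
  qed
  from this[of n] obtain t where
    t: "t \<le> n * (B ^ e + 2) + 1" "(cstep k ^^ t) (While r r' P c, f 0) = (Skip, f n)" by auto
  have "n * (B ^ e + 2) + 1 \<le> B * (B ^ e + 2) + 1"
    using n by (intro add_right_mono mult_right_mono) simp_all
  also have "\<dots> \<le> B * (3 * B ^ e) + 1 * B ^ e" using B by (intro add_mono mult_left_mono) simp_all
  also have "\<dots> \<le> B * (3 * B ^ e) + B * B ^ e" using B by (intro add_mono mult_right_mono) simp_all
  also have "\<dots> = 4 * (B * B ^ e)" by simp
  also have "\<dots> \<le> B * (B * B ^ e)" using B by (intro mult_right_mono) simp_all
  finally have "t \<le> B ^ (e + 2)" using t(1) by simp
  with t(2) show ?thesis by (auto simp: runs_def)
qed

lemma runs_put: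
  assumes "r < k" "r' < k" "r \<noteq> r'" "s r' = stk xs"
  shows "runs 1 (put r f r') s (s(r' := stk (f (rd (s r)) # xs)))"
proof -
  have "runs (0 + 0 + 1) (put r f r') s (s(r' := stk (f (rd (s r)) # xs)))"
    unfolding put_def
    by (rule runs_Seq, rule runs_Prim[OF assms(2,2) refl], rule runs_Prim[OF assms(1,2)])
      (use assms in \<open>simp add: act_push[of _ xs]\<close>)
  then show ?thesis by simp
qed

lemma runs_push:
  assumes "r < k" "s r = stk xs"
  shows "runs 1 (push r a) s (s(r := stk (a # xs)))"
proof -
  have "runs (0 + 0 + 1) (push r a) s (s(r := stk (a # xs)))"
    unfolding put_def push_def
    by (rule runs_Seq, rule runs_Prim[OF assms(1,1) refl], rule runs_Prim[OF assms(1,1)])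
      (use assms in \<open>simp add: act_push[of _ xs]\<close>)
  then show ?thesis by simp
qed

lemma runs_pop:
  assumes "r < k" "s r = stk (x # xs)"
  shows "runs 0 (pop r) s (s(r := stk xs))"
  unfolding pop_def by (rule runs_Prim) (use assms act_pop in simp_all)

text \<open>The store is indexed by the prefix consumed so far instead of by a counter. Stacked
  words contain no blank, so the test for 0 detects exactly the bottom.\<close>

lemma runs_consume:
  assumes r: "r < k" and z: "0 \<notin> set xs" and n: "length xs \<le> B"
    and F: "\<And>ys zs. xs = ys @ zs \<Longrightarrow> F ys r = stk zs"
    and body: "\<And>ys z zs. xs = ys @ z # zs \<Longrightarrow> z \<noteq> 0 \<Longrightarrow> runs e c (F ys) (F (ys @ [z]))"
  shows "runs (e + 2) (WhileNE r c) (F []) (F xs)"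
proof -
  have "runs (e + 2) (WhileNE r c) (F (take 0 xs)) (F (take (length xs) xs))"
  proof (rule runs_loop[where f = "\<lambda>i. F (take i xs)"])
    fix i assume i: "i < length xs"
    have x: "xs = take i xs @ xs ! i # drop (Suc i) xs" using id_take_nth_drop[OF i] .
    have nz: "xs ! i \<noteq> 0" using i z nth_mem[OF i] by metis
    show "rd (F (take i xs) r) \<noteq> 0" using F[OF x] nz by simp
    show "runs e c (F (take i xs)) (F (take (Suc i) xs))"
      using body[OF x nz] i by (simp add: take_Suc_conv_app_nth)
  qed (use r n F[of xs "[]"] in auto)
  then show ?thesis by simp
qed

lemma runs_move:
  assumes "r < k" "r' < k" "r \<noteq> r'" "s r = stk xs" "s r' = stk ys" "0 \<notin> set xs" "length xs \<le> B"
  shows "runs 4 (move r r') s (s(r := stk [], r' := stk (rev xs @ ys)))"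
proof -
  let ?F = "\<lambda>us :: nat list. s(r := stk (drop (length us) xs), r' := stk (rev us @ ys))"
  have "runs (2 + 2) (move r r') (?F []) (?F xs)"
    unfolding move_def
  proof (rule runs_consume[where F = ?F])
    fix us z zs assume x: "xs = us @ z # zs"
    have "runs (1 + 0 + 1) (put r id r' ;; pop r) (?F us) (?F (us @ [z]))"
      by (rule runs_eq, rule runs_Seq, rule runs_put[where xs = "rev us @ ys"], (use assms x in \<open>simp; fail\<close>)+,
          rule runs_pop[of _ _ z zs]) (use assms x in \<open>auto simp: fun_eq_iff\<close>)
    then show "runs 2 (put r id r' ;; pop r) (?F us) (?F (us @ [z]))" by (simp add: numeral_2_eq_2)
  qed (use assms in auto)
  moreover have "?F [] = s" using assms by (auto simp: fun_eq_iff)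
  ultimately show ?thesis by simp
qed

lemma runs_clear:
  assumes "r < k" "s r = stk xs" "0 \<notin> set xs" "length xs \<le> B"
  shows "runs 2 (clear r) s (s(r := stk []))"
proof -
  let ?F = "\<lambda>us :: nat list. s(r := stk (drop (length us) xs))"
  have "runs (0 + 2) (clear r) (?F []) (?F xs)"
    unfolding clear_def
  proof (rule runs_consume[where F = ?F])
    fix us z zs assume x: "xs = us @ z # zs"
    show "runs 0 (pop r) (?F us) (?F (us @ [z]))"
      by (rule runs_eq, rule runs_pop[of _ _ z zs]) (use assms x in \<open>auto simp: fun_eq_iff\<close>)
  qed (use assms in auto)
  moreover have "?F [] = s" using assms by (auto simp: fun_eq_iff)
  ultimately show ?thesis by (simp add: numeral_2_eq_2)
qed

text \<open>\<open>F ys\<close> describes the effect of the processed prefix \<open>ys\<close> on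
  the other tapes; its values at \<open>r\<close> and \<open>r'\<close> are always
  overwritten.\<close>

lemma runs_foreach:
  assumes r: "r < k" "r' < k" "r \<noteq> r'" and z: "0 \<notin> set xs" and n: "length xs \<le> B"
    and body: "\<And>ys z zs. xs = ys @ z # zs \<Longrightarrow> z \<noteq> 0 \<Longrightarrow> runs e c
       ((F ys)(r := stk (z # zs), r' := stk (rev ys))) ((F (ys @ [z]))(r := stk (z # zs), r' := stk (rev ys)))"
    and s: "s = (F [])(r := stk xs, r' := stk [])"
  shows "runs (e + 10) (foreach r r' c) s ((F xs)(r := stk xs, r' := stk []))"
proof -
  let ?F = "\<lambda>us :: nat list. (F us)(r := stk (drop (length us) xs), r' := stk (rev us))"
  have "runs ((e + (1 + 0 + 1) + 1) + 2) (WhileNE r (c ;; put r id r' ;; pop r)) (?F []) (?F xs)"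
  proof (rule runs_consume[where F = ?F])
    fix us z zs assume x: "xs = us @ z # zs" and nz: "z \<noteq> 0"
    have "runs (1 + 0 + 1) (put r id r' ;; pop r)
        ((F (us @ [z]))(r := stk (z # zs), r' := stk (rev us))) (?F (us @ [z]))"
      by (rule runs_eq, rule runs_Seq, rule runs_put[where xs = "rev us"], (use assms x in \<open>simp; fail\<close>)+,
          rule runs_pop[of _ _ z zs]) (use assms x in \<open>auto simp: fun_eq_iff\<close>)
    from runs_Seq[OF body[OF x nz] this]
    show "runs (e + (1 + 0 + 1) + 1) (c ;; put r id r' ;; pop r) (?F us) (?F (us @ [z]))"
      using x by simp
  qed (use assms in auto)
  moreover have "runs 4 (move r' r) (?F xs) ((?F xs)(r' := stk [], r := stk (rev (rev xs) @ [])))"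
    by (rule runs_move) (use assms in auto)
  ultimately have "runs ((e + (1 + 0 + 1) + 1) + 2 + 4 + 1) (foreach r r' c) s
      ((?F xs)(r' := stk [], r := stk (rev (rev xs) @ [])))"
    unfolding foreach_def s by (intro runs_Seq) simp_all
  then show ?thesis by (rule runs_eq) (use r in \<open>auto simp: fun_eq_iff\<close>)
qed

end

section \<open>The program of the reduction\<close>

text \<open>A formula as a list of its literals, with \<open>None\<close> at the end of every clause.\<close>

type_synonym tok = "(bool \<times> nat) option"

definition lstr :: "bool \<times> nat \<Rightarrow> nat list" where
  "lstr l = enc_bool (fst l) # enc_nat (snd l)"

definition etok :: "tok \<Rightarrow> nat list" where
  "etok t = (case t of None \<Rightarrow> [4] | Some l \<Rightarrow> lstr l @ [3])"

abbreviation etoks :: "tok list \<Rightarrow> nat list" where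
  "etoks ts \<equiv> concat (map etok ts)"

text \<open>The entries at token \<open>t\<close> in the row that makes \<open>l\<close> true, with
  symbols 1, 2 for 0, 1. At an occurrence of the same variable the first entry is set always and the
  second only if that occurrence becomes false.\<close>

definition bitsA :: "bool \<times> nat \<Rightarrow> tok \<Rightarrow> nat list" where
  "bitsA l t = (case t of None \<Rightarrow> [1]
     | Some l' \<Rightarrow> (if snd l' = snd l then [2, if fst l' = fst l then 1 else 2] else [1, 1]))"

text \<open>The part of a slack or witness row to the right of its literal. Only the delimiters of
  the remaining formula matter: two zeros per literal and \<open>a\<close> at the next clause end,
  which closes the clause of that literal.\<close>

fun tb :: "nat \<Rightarrow> nat list \<Rightarrow> nat list" where
  "tb a [] = []"
| "tb a (x # xs) = (if x = 3 then 1 # 1 # tb a xs else if x = 4 then a # tb 1 xs else tb a xs)"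

text \<open>The value of the parameter of \<open>tb\<close> after reading \<open>xs\<close>: the
  special symbol is spent at the first clause end.\<close>

definition fl :: "nat \<Rightarrow> nat list \<Rightarrow> nat" where
  "fl a xs = (if 4 \<in> set xs then 1 else a)"

lemma tb_append: "tb a (xs @ ys) = tb a xs @ tb (fl a xs) ys"
  by (induction a xs rule: tb.induct) (auto simp: fl_def)

lemma enc_nat_bits: "set (enc_nat n) \<subseteq> {1, 2}"
  by (induction n rule: enc_nat.induct) (subst enc_nat.simps, auto)

lemma enc_nat_inj: "enc_nat m = enc_nat n \<longleftrightarrow> m = n"
proof (induction m arbitrary: n rule: less_induct)
  case (less m)
  show ?case
  proof (cases "m = 0 \<or> n = 0")
    case True
    then show ?thesis by (auto simp: enc_nat.simps[of m] enc_nat.simps[of n] enc_nat.simps[of 0])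
  next
    case False
    then have "enc_nat m = enc_nat n \<longleftrightarrow> m mod 2 = n mod 2 \<and> m div 2 = n div 2"
      using less[of "m div 2" "n div 2"] by (simp add: enc_nat.simps[of m] enc_nat.simps[of n])
    then show ?thesis by (metis div_mult_mod_eq)
  qed
qed

lemma lstr_bits: "set (lstr l) \<subseteq> {1, 2}"
  using enc_nat_bits by (auto simp: lstr_def enc_bool_def)

lemma etoks_syms: "set (etoks ts) \<subseteq> {1, 2, 3, 4}"
  using lstr_bits by (fastforce simp: etok_def split: option.splits)

section \<open>Writing the rows of the exact cover instance\<close>

definition "cmp_step =
  If 1 5 (\<lambda>x y. x = y) Skip (push 8 1) ;; put 1 id 2 ;; pop 1 ;;
  If 5 5 (\<lambda>x _. x \<noteq> 0) (put 5 id 6 ;; pop 5) Skip"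

text \<open>The literal under scrutiny is on tape 1, the fixed one on tape 5. Tape 7 keeps the
  comparison of the signs, and tape 8 is nonempty iff the variables differ. Tape 6 restores tape 5
  at once; tape 2 restores tape 1 at the end of \<open>rowA\<close>.\<close>

definition "cmp_lit =
  If 1 5 (\<lambda>x y. x = y) (push 7 1) (push 7 2) ;;
  (put 1 id 2 ;; pop 1 ;; put 5 id 6 ;; pop 5) ;;
  While 1 1 (\<lambda>x _. x \<noteq> 3) cmp_step ;;
  If 5 5 (\<lambda>x _. x \<noteq> 0) (push 8 1) Skip ;;
  (put 1 id 2 ;; pop 1 ;; move 6 5) ;;
  If 8 8 (\<lambda>x _. x = 0) (push 9 2 ;; put 7 id 9) (push 9 1 ;; push 9 1) ;;
  clear 8 ;; pop 7"

definition "rowA =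
  WhileNE 1 (If 1 1 (\<lambda>x _. x = 4) (push 9 1 ;; put 1 id 2 ;; pop 1) cmp_lit) ;; move 2 1"

text \<open>Parameter 2 yields the witness row and 1 the slack row of the current literal. Tape 25
  holds in unary the number of columns to the left of the literal, tape 3 the formula to its
  right.\<close>

definition "rowBS a =
  push 7 a ;; push 9 4 ;; foreach 25 26 (push 9 1) ;; push 9 1 ;; push 9 2 ;;
  foreach 3 4 (If 3 3 (\<lambda>x _. x = 3) (push 9 1 ;; push 9 1)
    (If 3 3 (\<lambda>x _. x = 4) (put 7 id 9 ;; pop 7 ;; push 7 1) Skip)) ;; pop 7"

text \<open>The three rows are pushed in the order truth, witness, slack, so that reading from the
  top meets them as \<open>(i, 0)\<close>, \<open>(i, 1)\<close>, \<open>(i, 2)\<close>, with later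
  tokens before earlier ones.\<close>

definition "lit_rows =
  WhileNE 3 (If 3 3 (\<lambda>x _. x = 4) (push 25 1 ;; pop 3)
    (While 3 3 (\<lambda>x _. x \<noteq> 3) (put 3 id 6 ;; pop 3) ;; pop 3 ;; move 6 5 ;; push 9 4 ;;
     rowA ;; rowBS 2 ;; rowBS 1 ;; push 25 1 ;; push 25 1 ;; clear 5))"

text \<open>The number of marks on tape 8 after \<open>i\<close> symbols. A position beyond the end
  of \<open>ys\<close> counts as a mismatch because the head there scans a blank. Surplus symbols of
  \<open>ys\<close> are detected separately after the loop.\<close>

definition mm :: "nat list \<Rightarrow> nat list \<Rightarrow> nat \<Rightarrow> nat" where
  "mm xs ys i = card {j. j < i \<and> \<not> (j < length ys \<and> xs ! j = ys ! j)}"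

lemma mm_Suc: "mm xs ys (Suc i) = (if i < length ys \<and> xs ! i = ys ! i then 0 else 1) + mm xs ys i"
proof -
  have "{j. j < Suc i \<and> \<not> (j < length ys \<and> xs ! j = ys ! j)} =
      (if i < length ys \<and> xs ! i = ys ! i then {} else {i}) \<union>
      {j. j < i \<and> \<not> (j < length ys \<and> xs ! j = ys ! j)}"
    by (auto simp: less_Suc_eq)
  then show ?thesis by (simp add: mm_def)
qed

lemma mm_eq: "mm xs ys (length xs) = 0 \<and> drop (length xs) ys = [] \<longleftrightarrow> xs = ys"
  by (auto simp: mm_def list_eq_iff_nth_eq) (metis le_neq_implies_less nat_less_le)

definition cmpst :: "store \<Rightarrow> nat list \<Rightarrow> nat list \<Rightarrow> nat list \<Rightarrow> nat list \<Rightarrow> nat list \<Rightarrow> nat list \<Rightarrow> store" where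
  "cmpst s w w' l l' f g = s(1 := stk w, 2 := stk w', 5 := stk l, 6 := stk l', 7 := stk f, 8 := stk g)"

definition rowst :: "store \<Rightarrow> nat list \<Rightarrow> nat list \<Rightarrow> nat list \<Rightarrow> nat list \<Rightarrow> store" where
  "rowst s w w' l x = s(1 := stk w, 2 := stk w', 5 := stk l, 6 := stk [], 7 := stk [], 8 := stk [], 9 := stk x)"

lemma etok_Cons: "etok t \<noteq> []"
  by (simp add: etok_def split: option.splits)

lemma length_etoks: "length ts \<le> length (etoks ts)"
proof (induction ts)
  case (Cons t ts)
  have "1 \<le> length (etok t)" using etok_Cons[of t] by (cases "etok t") auto
  with Cons show ?case by simp
qed simp

lemma etoks_nz: "0 \<notin> set (etoks ts)"
  using etoks_syms[of ts] by auto

lemma length_etok_le: "t \<in> set ts \<Longrightarrow> length (etok t) \<le> length (etoks ts)"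
  by (induction ts) auto

context tapes
begin

lemma runs_If_True:
  "P (rd (s r)) (rd (s r')) \<Longrightarrow> r < k \<Longrightarrow> r' < k \<Longrightarrow> runs e c s s' \<Longrightarrow>
   runs (e + 1) (If r r' P c d) s s'"
  by (rule runs_If) auto

lemma runs_If_False:
  "\<not> P (rd (s r)) (rd (s r')) \<Longrightarrow> r < k \<Longrightarrow> r' < k \<Longrightarrow> runs e d s s' \<Longrightarrow>
   runs (e + 1) (If r r' P c d) s s'"
  by (rule runs_If) auto

lemmas sx = runs_Seq runs_put runs_push runs_pop runs_Skip
lemmas ifs = runs_If_True runs_If_False

lemma cmp_step_runs:
  assumes "x \<noteq> 0" "0 \<notin> set l"
  shows "runs 20 cmp_step (cmpst s (x # w) w' l l' f g)
    (cmpst s w (x # w') (tl l) (if l = [] then l' else hd l # l') f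
      (if l \<noteq> [] \<and> x = hd l then g else 1 # g))"
proof (cases l)
  case Nil
  show ?thesis unfolding cmp_step_def cmpst_def Nil
    by (rule runs_eq, ((rule sx runs_If_False | (use assms in \<open>simp; fail\<close>)))+)
     (auto simp: fun_eq_iff)
next
  case (Cons y ys)
  show ?thesis
  proof (cases "x = y")
    case True
    show ?thesis unfolding cmp_step_def cmpst_def Cons
      by (rule runs_eq, ((rule sx runs_If_True | (use assms Cons True in \<open>simp; fail\<close>)))+)
        (use True in \<open>auto simp: fun_eq_iff\<close>)
  next
    case False
    show ?thesis unfolding cmp_step_def cmpst_def Cons
      by (rule runs_eq, rule runs_Seq, rule runs_If_False,
         ((rule sx runs_If_True | (use assms Cons False in \<open>simp; fail\<close>)))+)
        (use False in \<open>auto simp: fun_eq_iff\<close>)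
  qed
qed


lemma cmp_loop_runs:
  assumes "set xs \<subseteq> {1, 2}" "0 \<notin> set ys" "length xs \<le> B"
  shows "runs 22 (While 1 1 (\<lambda>x _. x \<noteq> 3) cmp_step) (cmpst s (xs @ 3 # w) w' ys l' f [])
    (cmpst s (3 # w) (rev xs @ w') (drop (length xs) ys) (rev (take (length xs) ys) @ l') f
      (replicate (mm xs ys (length xs)) 1))"
proof -
  let ?f = "\<lambda>i. cmpst s (drop i xs @ 3 # w) (rev (take i xs) @ w') (drop i ys) (rev (take i ys) @ l') f
      (replicate (mm xs ys i) 1)"
  have "runs (20 + 2) (While 1 1 (\<lambda>x _. x \<noteq> 3) cmp_step) (?f 0) (?f (length xs))"
  proof (rule runs_loop)
    fix i assume i: "i < length xs"
    have nth: "xs ! i \<in> {1, 2}" using assms(1) nth_mem[OF i] by blast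
    have d: "drop i xs = xs ! i # drop (Suc i) xs" using i by (simp add: Cons_nth_drop_Suc)
    show "rd (?f i 1) \<noteq> 3" using nth by (auto simp: cmpst_def d)
    have z: "xs ! i \<noteq> 0" "0 \<notin> set (drop i ys)" using nth assms(2) by (auto dest: in_set_dropD)
    have dy: "drop i ys = (if i < length ys then ys ! i # drop (Suc i) ys else [])"
      by (simp add: Cons_nth_drop_Suc)
    have ty: "take (Suc i) ys = (if i < length ys then take i ys @ [ys ! i] else take i ys)"
      by (simp add: take_Suc_conv_app_nth)
    have "?f (Suc i) = cmpst s (drop (Suc i) xs @ 3 # w) (xs ! i # rev (take i xs) @ w') (tl (drop i ys))
        (if drop i ys = [] then rev (take i ys) @ l' else hd (drop i ys) # rev (take i ys) @ l') f
      (if drop i ys \<noteq> [] \<and> xs ! i = hd (drop i ys) then replicate (mm xs ys i) 1 else 1 # replicate (mm xs ys i) 1)"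
      using i by (simp add: take_Suc_conv_app_nth ty mm_Suc dy drop_Suc tl_drop)
    then have "runs 20 cmp_step (cmpst s (xs ! i # drop (Suc i) xs @ 3 # w) (rev (take i xs) @ w') (drop i ys)
        (rev (take i ys) @ l') f (replicate (mm xs ys i) 1)) (?f (Suc i))"
      by (simp only:) (rule cmp_step_runs[OF z])
    then show "runs 20 cmp_step (?f i) (?f (Suc i))" by (simp only: d append_Cons)
  qed (use assms in \<open>simp_all add: cmpst_def\<close>)
  then show ?thesis by (simp add: mm_def)
qed

lemma cmp_loop_runs':
  assumes "set xs \<subseteq> {1, 2}" "0 \<notin> set ys" "length xs \<le> B"
    and "s 1 = stk (xs @ 3 # w)" "s 2 = stk w'" "s 5 = stk ys" "s 6 = stk l'" "s 7 = stk f" "s 8 = stk []"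
  shows "runs 22 (While 1 1 (\<lambda>x _. x \<noteq> 3) cmp_step) s
    (s(1 := stk (3 # w), 2 := stk (rev xs @ w'), 5 := stk (drop (length xs) ys),
       6 := stk (rev (take (length xs) ys) @ l'), 8 := stk (replicate (mm xs ys (length xs)) 1)))"
proof -
  have "s = cmpst s (xs @ 3 # w) w' ys l' f []" using assms by (auto simp: cmpst_def fun_eq_iff)
  then have "runs 22 (While 1 1 (\<lambda>x _. x \<noteq> 3) cmp_step) s
     (cmpst s (3 # w) (rev xs @ w') (drop (length xs) ys) (rev (take (length xs) ys) @ l') f
      (replicate (mm xs ys (length xs)) 1))"
    using cmp_loop_runs[OF assms(1-3), of s w w' l' f] by simp
  then show ?thesis by (rule runs_eq) (use assms(8) in \<open>auto simp: cmpst_def fun_eq_iff\<close>)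
qed

lemma cmp_lit_runs:
  assumes "length (lstr l) \<le> B" "length (lstr l') \<le> B"
  shows "runs 60 cmp_lit (rowst s (lstr l' @ 3 # w) w' (lstr l) x)
    (rowst s w (3 # rev (lstr l') @ w') (lstr l) (rev (bitsA l (Some l')) @ x))"
proof -
  define p q xs ys where d: "p = enc_bool (fst l)" "q = enc_bool (fst l')" "xs = enc_nat (snd l')" "ys = enc_nat (snd l)"
  have l: "lstr l = p # ys" "lstr l' = q # xs" by (simp_all add: lstr_def d)
  have bits: "set xs \<subseteq> {1, 2}" "0 \<notin> set ys"
    using enc_nat_bits[of "snd l"] enc_nat_bits[of "snd l'"] by (auto simp: d)
  have len: "length xs \<le> B" "length ys \<le> B" using assms by (simp_all add: l)
  have pq: "q = p \<longleftrightarrow> fst l' = fst l" by (auto simp: d enc_bool_def)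
  \<comment> \<open>\<open>g\<close> is the content of tape 8 after the loop and \<open>g'\<close>
    after the additional check for a longer \<open>ys\<close>; thus \<open>g'\<close> is empty
    exactly if the variables agree.\<close>
  define g where "g = (replicate (mm xs ys (length xs)) 1 :: nat list)"
  define g' where "g' = (if drop (length xs) ys = [] then g else 1 # g)"
  have nz: "p \<noteq> 0" "q \<noteq> 0" by (simp_all add: d enc_bool_def)
  have mmle: "mm xs ys (length xs) \<le> length xs"
    unfolding mm_def using card_mono[of "{..<length xs}" "{j. j < length xs \<and> \<not> (j < length ys \<and> xs ! j = ys ! j)}"]
    by auto
  have g': "0 \<notin> set g'" "length g' \<le> B" "g' = [] \<longleftrightarrow> snd l' = snd l"
    using mm_eq[of xs ys] mmle assms by (auto simp: g'_def g_def l d enc_nat_inj)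
  define f where "f = (if q = p then 1 else 2 :: nat)"
  let ?s0 = "rowst s (q # xs @ 3 # w) w' (p # ys) x"
  let ?s1 = "?s0(7 := stk [f])"
  let ?s2 = "?s1(1 := stk (xs @ 3 # w), 2 := stk (q # w'), 5 := stk ys, 6 := stk [p])"
  let ?s3 = "?s2(1 := stk (3 # w), 2 := stk (rev xs @ q # w'), 5 := stk (drop (length xs) ys),
       6 := stk (rev (take (length xs) ys) @ [p]), 8 := stk g)"
  let ?s4 = "?s3(8 := stk g')"
  let ?s5 = "?s4(1 := stk w, 2 := stk (3 # rev xs @ q # w'), 5 := stk (p # ys), 6 := stk [])"
  let ?s6 = "?s5(9 := stk (rev (bitsA l (Some l')) @ x))"
  have 1: "runs 2 (If 1 5 (\<lambda>x y. x = y) (push 7 1) (push 7 2)) ?s0 ?s1"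
    by (cases "q = p"; rule runs_eq, (rule sx | (rule runs_If_True, (simp add: rowst_def; fail)) |
       (rule runs_If_False, (simp add: rowst_def; fail)) | (simp add: rowst_def; fail))+)
      (auto simp: f_def)
  have 2: "runs 5 (put 1 id 2 ;; pop 1 ;; put 5 id 6 ;; pop 5) ?s1 ?s2"
    by (rule runs_eq, (rule sx | (simp add: rowst_def; fail))+) (auto simp: fun_eq_iff rowst_def)
  have 3: "runs 22 (While 1 1 (\<lambda>x _. x \<noteq> 3) cmp_step) ?s2 ?s3"
    by (rule runs_eq, rule cmp_loop_runs'[where xs = xs and ys = ys and w = w and w' = "q # w'" and l' = "[p]" and f = "[f]"])
      (use bits len in \<open>auto simp: rowst_def fun_eq_iff g_def\<close>)
  have 4: "runs 2 (If 5 5 (\<lambda>x _. x \<noteq> 0) (push 8 1) Skip) ?s3 ?s4"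
  proof (cases "drop (length xs) ys")
    case Nil
    show ?thesis
      by (rule runs_eq, rule runs_If_False, (rule sx | (use Nil in \<open>simp add: rowst_def; fail\<close>))+)
       (use Nil in \<open>auto simp: g'_def\<close>)
  next
    case (Cons z zs)
    have "z \<noteq> 0" using bits(2) Cons by (metis in_set_dropD list.set_intros(1))
    then show ?thesis
      by (intro runs_eq[OF runs_If_True[OF _ _ _ runs_push[where xs = g]]])
       (use Cons in \<open>auto simp: g'_def rowst_def\<close>)
  qed
  have r: "rev (rev (take (length xs) ys) @ [p]) @ drop (length xs) ys = p # ys" by simp
  have 5: "runs 7 (put 1 id 2 ;; pop 1 ;; move 6 5) ?s4 ?s5"
    by (rule runs_eq, (rule sx runs_move[where xs = "rev (take (length xs) ys) @ [p]" and ys = "drop (length xs) ys"]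
       | (use bits nz assms in \<open>simp add: rowst_def l; fail\<close>)
       | (use bits nz assms in \<open>auto simp: rowst_def l fun_eq_iff dest: in_set_takeD; fail\<close>))+)
  have 6: "runs 4 (If 8 8 (\<lambda>x _. x = 0) (push 9 2 ;; put 7 id 9) (push 9 1 ;; push 9 1)) ?s5 ?s6"
  proof (cases g')
    case Nil
    then have "snd l' = snd l" using g'(3) by simp
    then show ?thesis
      by (intro runs_eq[OF runs_If_True[OF _ _ _ runs_Seq[OF runs_push[where xs = x] runs_put[where xs = "2 # x"]]]])
        (use Nil pq in \<open>auto simp: rowst_def bitsA_def f_def\<close>)
  next
    case (Cons z zs)
    then have "snd l' \<noteq> snd l" "z \<noteq> 0" using g' by auto
    then show ?thesis
      by (intro runs_eq[OF runs_If_False[OF _ _ _ runs_Seq[OF runs_push[where xs = x] runs_push[where xs = "1 # x"]]]])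
        (use Cons in \<open>auto simp: rowst_def bitsA_def\<close>)
  qed
  have 7: "runs 4 (clear 8 ;; pop 7) ?s6 (rowst s w (3 # rev (lstr l') @ w') (lstr l) (rev (bitsA l (Some l')) @ x))"
    by (rule runs_eq, (rule sx runs_clear[where xs = g'] | (use g' in \<open>simp add: rowst_def l; fail\<close>))+)
      (auto simp: fun_eq_iff rowst_def l)
  have "runs 60 cmp_lit ?s0 (rowst s w (3 # rev (lstr l') @ w') (lstr l) (rev (bitsA l (Some l')) @ x))"
    unfolding cmp_lit_def
    by (rule runs_weaken[OF runs_Seq[OF 1 runs_Seq[OF 2 runs_Seq[OF 3 runs_Seq[OF 4 runs_Seq[OF 5
        runs_Seq[OF 6 7]]]]]]]) simp
  then show ?thesis by (simp add: l)
qed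


lemma rowA_runs:
  assumes "s 1 = stk (etoks ts)" "s 2 = stk []" "s 5 = stk (lstr l)" "s 6 = stk []" "s 7 = stk []"
    "s 8 = stk []" "s 9 = stk x" and len: "length (etoks ts) \<le> B" "length (lstr l) \<le> B"
  shows "runs 80 rowA s (s(9 := stk (rev (concat (map (bitsA l) ts)) @ x)))"
proof -
  let ?f = "\<lambda>i. rowst s (etoks (drop i ts)) (rev (etoks (take i ts))) (lstr l)
    (rev (concat (map (bitsA l) (take i ts))) @ x)"
  have s: "s = ?f 0" using assms by (auto simp: rowst_def fun_eq_iff)
  have 1: "runs (61 + 2) (WhileNE 1 (If 1 1 (\<lambda>x _. x = 4) (push 9 1 ;; put 1 id 2 ;; pop 1) cmp_lit))
      (?f 0) (?f (length ts))"
  proof (rule runs_loop)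
    fix i assume i: "i < length ts"
    have dr: "drop i ts = ts ! i # drop (Suc i) ts" using i by (simp add: Cons_nth_drop_Suc)
    have tk: "take (Suc i) ts = take i ts @ [ts ! i]" using i by (simp add: take_Suc_conv_app_nth)
    obtain y ys where y: "etok (ts ! i) = y # ys" using etok_Cons by (cases "etok (ts ! i)") auto
    have "y \<noteq> 0" using etoks_nz[of "drop i ts"] by (simp add: dr y)
    then show "rd (?f i 1) \<noteq> 0" by (simp add: rowst_def dr y)
    show "runs 61 (If 1 1 (\<lambda>x _. x = 4) (push 9 1 ;; put 1 id 2 ;; pop 1) cmp_lit) (?f i) (?f (Suc i))"
    proof (cases "ts ! i")
      case None
      have "runs (1 + (1 + 0 + 1) + 1) (push 9 1 ;; put 1 id 2 ;; pop 1) (?f i) (?f (Suc i))"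
        by (rule runs_eq, (rule sx | (use None in \<open>simp add: rowst_def dr etok_def; fail\<close>))+)
         (use None in \<open>auto simp: fun_eq_iff rowst_def dr tk etok_def bitsA_def\<close>)
      then show ?thesis
        by (intro runs_weaken[OF runs_If_True]) (use None in \<open>auto simp: rowst_def dr etok_def\<close>)
    next
      case (Some l')
      have e: "etok (ts ! i) = lstr l' @ [3]" by (simp add: Some etok_def)
      have "ts ! i \<in> set ts" using i by simp
      from length_etok_le[OF this] have "length (lstr l') \<le> B" using e len(1) by simp
      from cmp_lit_runs[OF len(2) this, of s "etoks (drop (Suc i) ts)" "rev (etoks (take i ts))"
          "rev (concat (map (bitsA l) (take i ts))) @ x"]
      have "runs 60 cmp_lit (?f i) (?f (Suc i))"
        by (simp add: dr tk e) (simp add: Some)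
      moreover have "rd (?f i 1) \<noteq> 4" using enc_bool_def by (simp add: rowst_def dr e lstr_def)
      ultimately show ?thesis by (intro runs_weaken[OF runs_If_False]) auto
    qed
  qed (use len length_etoks[of ts] in \<open>auto simp: rowst_def\<close>)
  show ?thesis unfolding rowA_def
    by (rule runs_eq, rule runs_Seq[OF 1[folded s]],
        rule runs_move[where xs = "rev (etoks ts)" and ys = "[]"])
     (use assms etoks_nz in \<open>auto simp: rowst_def fun_eq_iff\<close>)
qed

text \<open>The common pattern of a loop whose only net effect is to push a word \<open>h z\<close>
  for every scanned \<open>z\<close>. The reversal arises because the last word pushed is on
  top.\<close>

lemma runs_emit:
  fixes s :: store and xs :: "nat list"
  assumes r: "r < k" "r' < k" "r \<noteq> r'" "q \<noteq> r" "q \<noteq> r'"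
    and s: "s r = stk xs" "s r' = stk []" "s q = stk y" and z: "0 \<notin> set xs" "length xs \<le> B"
    and body: "\<And>\<sigma> y' z zs. \<sigma> r = stk (z # zs) \<Longrightarrow> \<sigma> q = stk y' \<Longrightarrow> z \<in> set xs \<Longrightarrow>
       (\<And>i. i \<noteq> r \<Longrightarrow> i \<noteq> r' \<Longrightarrow> i \<noteq> q \<Longrightarrow> \<sigma> i = s i) \<Longrightarrow> runs e c \<sigma> (\<sigma>(q := stk (h z @ y')))"
  shows "runs (e + 10) (foreach r r' c) s (s(q := stk (concat (map h (rev xs)) @ y)))"
proof -
  let ?F = "\<lambda>ys. s(q := stk (concat (map h (rev ys)) @ y))"
  have "runs (e + 10) (foreach r r' c) s ((?F xs)(r := stk xs, r' := stk []))"
  proof (rule runs_foreach[where F = ?F])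
    fix ys u zs assume x: "xs = ys @ u # zs"
    have "runs e c ((?F ys)(r := stk (u # zs), r' := stk (rev ys)))
       (((?F ys)(r := stk (u # zs), r' := stk (rev ys)))(q := stk (h u @ concat (map h (rev ys)) @ y)))"
      by (rule body) (use r x in auto)
    then show "runs e c ((?F ys)(r := stk (u # zs), r' := stk (rev ys)))
       ((?F (ys @ [u]))(r := stk (u # zs), r' := stk (rev ys)))"
      by (rule runs_eq) (use r in \<open>auto simp: fun_eq_iff\<close>)
  qed (use r s z in \<open>auto simp: fun_eq_iff\<close>)
  then show ?thesis by (rule runs_eq) (use r s in \<open>auto simp: fun_eq_iff\<close>)
qed

lemma runs_emit_const:
  assumes "r < k" "r' < k" "q < k" "r \<noteq> r'" "q \<noteq> r" "q \<noteq> r'"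
    and s: "s r = stk xs" "s r' = stk []" "s q = stk y" and z: "0 \<notin> set xs" "length xs \<le> B"
  shows "runs 11 (foreach r r' (push q a)) s (s(q := stk (replicate (length xs) a @ y)))"
proof -
  have "runs (1 + 10) (foreach r r' (push q a)) s (s(q := stk (concat (map (\<lambda>_. [a]) (rev xs)) @ y)))"
  proof (rule runs_emit)
    fix \<sigma> y' and z :: nat assume "\<sigma> q = stk y'"
    then show "runs 1 (push q a) \<sigma> (\<sigma>(q := stk ([a] @ y')))" using runs_push[of q \<sigma> y' a] assms by simp
  qed (use assms in auto)
  then show ?thesis by (simp add: map_replicate_const)
qed

lemma rowBS_runs:
  assumes "s 3 = stk (etoks ts)" "s 4 = stk []" "s 7 = stk []" "s 9 = stk x" "s 25 = stk (replicate z 1)"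
    "s 26 = stk []" and len: "length (etoks ts) \<le> B" "z \<le> B"
  shows "runs 50 (rowBS a) s (s(9 := stk (rev (tb a (etoks ts)) @ 2 # 1 # replicate z 1 @ 4 # x)))"
proof -
  let ?s1 = "s(7 := stk [a], 9 := stk (4 # x))"
  have 1: "runs 11 (foreach 25 26 (push 9 1)) ?s1 (?s1(9 := stk (replicate z 1 @ 4 # x)))"
    using runs_emit_const[of 25 26 9 ?s1 "replicate z 1" "4 # x" 1] assms by simp
  have 2: "runs (8 + 10) (foreach 3 4 (If 3 3 (\<lambda>x _. x = 3) (push 9 1 ;; push 9 1)
    (If 3 3 (\<lambda>x _. x = 4) (put 7 id 9 ;; pop 7 ;; push 7 1) Skip))) \<sigma>
      (\<sigma>(7 := stk [fl a (etoks ts)], 9 := stk (rev (tb a (etoks ts)) @ y)))"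
    if \<sigma>: "\<sigma> 3 = stk (etoks ts)" "\<sigma> 4 = stk []" "\<sigma> 7 = stk [a]" "\<sigma> 9 = stk y" for \<sigma> y
  proof -
    let ?F = "\<lambda>ys. \<sigma>(7 := stk [fl a ys], 9 := stk (rev (tb a ys) @ y))"
    have "runs (8 + 10) (foreach 3 4 (If 3 3 (\<lambda>x _. x = 3) (push 9 1 ;; push 9 1)
      (If 3 3 (\<lambda>x _. x = 4) (put 7 id 9 ;; pop 7 ;; push 7 1) Skip))) \<sigma>
        ((?F (etoks ts))(3 := stk (etoks ts), 4 := stk []))"
    proof (rule runs_foreach[where F = ?F])
      fix ys u zs
      show "runs 8 (If 3 3 (\<lambda>x _. x = 3) (push 9 1 ;; push 9 1)
        (If 3 3 (\<lambda>x _. x = 4) (put 7 id 9 ;; pop 7 ;; push 7 1) Skip))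
        ((?F ys)(3 := stk (u # zs), 4 := stk (rev ys))) ((?F (ys @ [u]))(3 := stk (u # zs), 4 := stk (rev ys)))"
        by (cases "u = 3"; cases "u = 4"; rule runs_eq, (rule sx | (rule runs_If_True, (simp; fail)) |
         (rule runs_If_False, (simp; fail)) | (simp; fail) | (auto simp: fun_eq_iff tb_append fl_def; fail))+)
    qed (use \<sigma> len etoks_nz in \<open>auto simp: fun_eq_iff fl_def\<close>)
    then show ?thesis by (rule runs_eq) (use \<sigma> in \<open>auto simp: fun_eq_iff\<close>)
  qed
  show ?thesis unfolding rowBS_def
    by (rule runs_eq, (rule sx 1 2 | (use assms in \<open>simp; fail\<close>) |
       (use assms in \<open>auto simp: fun_eq_iff; fail\<close>))+)
qed

end

text \<open>The elements to be covered: two for every literal occurrence and one for every clause.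
  Bits are represented by the symbols 1 and 2 throughout.\<close>

fun tw :: "tok \<Rightarrow> nat" where
  "tw None = 1"
| "tw (Some l) = 2"

definition width :: "tok list \<Rightarrow> nat" where
  "width ts = sum_list (map tw ts)"

text \<open>Slack, witness and truth row of literal \<open>i\<close>, in this order;
  \<open>rowsT_blocks\<close> identifies them with the rows \<open>(i, 0)\<close>,
  \<open>(i, 1)\<close>, \<open>(i, 2)\<close> of the exact cover instance.\<close>

definition rowsT :: "tok list \<Rightarrow> nat \<Rightarrow> nat list list" where
  "rowsT ts i = (case ts ! i of None \<Rightarrow> [] | Some l \<Rightarrow>
     [replicate (width (take i ts)) 1 @ [1, 2] @ tb 1 (etoks (drop (Suc i) ts)),
      replicate (width (take i ts)) 1 @ [1, 2] @ tb 2 (etoks (drop (Suc i) ts)),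
      concat (map (bitsA l) ts)])"

text \<open>Tape 9 read from the top. The terminator 4 is pushed before its row, and the row from
  left to right, so each row appears reversed with its terminator behind it.\<close>

definition rtext :: "nat list list \<Rightarrow> nat list" where
  "rtext ps = concat (map (\<lambda>p. rev p @ [4]) ps)"

lemma width_le: "width ts \<le> length (etoks ts)"
proof (induction ts)
  case (Cons t ts)
  have "tw t \<le> length (etok t)" by (cases t) (auto simp: etok_def lstr_def)
  with Cons show ?case by (simp add: width_def)
qed (simp add: width_def)

lemma width_take_le: "width (take i ts) \<le> length (etoks ts)"
proof -
  have "length (etoks (take i ts)) \<le> length (etoks ts)"
    by (metis append_take_drop_id concat_append le_add1 length_append map_append)
  then show ?thesis using width_le[of "take i ts"] by simp
qed

context tapes
begin

lemma lit_rows_runs: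
  assumes "s 1 = stk (etoks ts)" "s 2 = stk []" "s 3 = stk (etoks ts)" "s 4 = stk []" "s 5 = stk []" "s 6 = stk []"
    "s 7 = stk []" "s 8 = stk []" "s 9 = stk []" "s 25 = stk []" "s 26 = stk []" and len: "length (etoks ts) \<le> B"
  shows "runs 300 lit_rows s (s(3 := stk [], 25 := stk (replicate (width ts) 1),
     9 := stk (rtext (concat (rev (map (rowsT ts) [0..<length ts]))))))"
proof -
  let ?X = "\<lambda>i. rtext (concat (rev (map (rowsT ts) [0..<i])))"
  let ?f = "\<lambda>i. s(3 := stk (etoks (drop i ts)), 25 := stk (replicate (width (take i ts)) 1), 9 := stk (?X i))"
  have s: "s = ?f 0" using assms by (auto simp: fun_eq_iff width_def rtext_def)
  have "runs (290 + 2) lit_rows (?f 0) (?f (length ts))"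
    unfolding lit_rows_def
  proof (rule runs_loop)
    fix i assume i: "i < length ts"
    have dr: "drop i ts = ts ! i # drop (Suc i) ts" using i by (simp add: Cons_nth_drop_Suc)
    have tk: "take (Suc i) ts = take i ts @ [ts ! i]" using i by (simp add: take_Suc_conv_app_nth)
    have w: "width (take (Suc i) ts) = width (take i ts) + tw (ts ! i)" by (simp add: tk width_def)
    obtain y ys where y: "etok (ts ! i) = y # ys" using etok_Cons by (cases "etok (ts ! i)") auto
    have "y \<noteq> 0" using etoks_nz[of "drop i ts"] by (simp add: dr y)
    then show "rd (?f i 3) \<noteq> 0" by (simp add: dr y)
    let ?lit = "While 3 3 (\<lambda>x _. x \<noteq> 3) (put 3 id 6 ;; pop 3) ;; pop 3 ;; move 6 5 ;; push 9 4 ;;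
        rowA ;; rowBS 2 ;; rowBS 1 ;; push 25 1 ;; push 25 1 ;; clear 5"
    show "runs 290 (If 3 3 (\<lambda>x _. x = 4) (push 25 1 ;; pop 3) ?lit) (?f i) (?f (Suc i))"
    proof (cases "ts ! i")
      case None
      show ?thesis
        by (rule runs_eq, rule runs_If_True, (rule sx | (use None in \<open>simp add: dr etok_def; fail\<close>))+)
          (use None in \<open>auto simp: fun_eq_iff dr w rowsT_def etok_def replicate_append_same[symmetric]\<close>)
    next
      case (Some l)
      have e: "etok (ts ! i) = lstr l @ [3]" by (simp add: Some etok_def)
      have "ts ! i \<in> set ts" using i by simp
      from length_etok_le[OF this] have ll: "length (lstr l) \<le> B" using e len(1) by simp
      have lz: "0 \<notin> set (lstr l)" using lstr_bits[of l] by auto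
      have dl: "length (etoks (drop (Suc i) ts)) \<le> B"
        using len by (metis append_take_drop_id concat_append le_add2 le_trans length_append map_append)
      have wl: "width (take i ts) \<le> B" using width_take_le[of i ts] len by simp
      let ?u = "\<lambda>j. (?f i)(3 := stk (drop j (lstr l) @ 3 # etoks (drop (Suc i) ts)), 6 := stk (rev (take j (lstr l))))"
      have "runs (2 + 2) (While 3 3 (\<lambda>x _. x \<noteq> 3) (put 3 id 6 ;; pop 3)) (?u 0) (?u (length (lstr l)))"
      proof (rule runs_loop)
        fix j assume j: "j < length (lstr l)"
        have d: "drop j (lstr l) = lstr l ! j # drop (Suc j) (lstr l)" using j by (simp add: Cons_nth_drop_Suc)
        have "lstr l ! j \<in> {1, 2}" using lstr_bits nth_mem[OF j] by blast
        then show "rd (?u j 3) \<noteq> 3" by (auto simp: d)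
        show "runs 2 (put 3 id 6 ;; pop 3) (?u j) (?u (Suc j))"
          by (rule runs_eq, (rule sx | (simp add: d; fail))+)
            (use j in \<open>auto simp: fun_eq_iff d take_Suc_conv_app_nth\<close>)
      qed (use ll in auto)
      moreover have "?u 0 = ?f i" using assms by (auto simp: fun_eq_iff dr e)
      ultimately have 1: "runs 4 (While 3 3 (\<lambda>x _. x \<noteq> 3) (put 3 id 6 ;; pop 3)) (?f i)
          ((?f i)(3 := stk (3 # etoks (drop (Suc i) ts)), 6 := stk (rev (lstr l))))" by simp
      have "runs 280 ?lit (?f i) (?f (Suc i))"
        by (rule runs_eq, (rule sx 1 runs_move[where xs = "rev (lstr l)" and ys = "[]"]
            runs_clear[where xs = "lstr l"]
            rowA_runs[where ts = ts and l = l] rowBS_runs[where ts = "drop (Suc i) ts" and z = "width (take i ts)"] |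
          (use lz ll dl wl len assms in \<open>simp; fail\<close>))+)
         (use Some assms in \<open>auto simp: fun_eq_iff w rowsT_def rtext_def\<close>)
      moreover have "rd (?f i 3) \<noteq> 4" using enc_bool_def by (simp add: dr e lstr_def)
      ultimately show ?thesis by (intro runs_weaken[OF runs_If_False]) auto
    qed
  qed (use len length_etoks[of ts] in \<open>auto\<close>)
  then show ?thesis unfolding s[symmetric] by (rule runs_eq) (auto simp: fun_eq_iff)
qed

end

section \<open>Writing the wiggle instance\<close>

definition "copy_in =
  foreach 28 29 (put 28 id 1 ;; put 28 id 3 ;; push 10 1 ;; push 10 1 ;;
    If 28 28 (\<lambda>x _. x = 3) (push 24 1 ;; push 24 1) (If 28 28 (\<lambda>x _. x = 4) (push 24 1) Skip))"

primrec pushes :: "nat \<Rightarrow> nat \<Rightarrow> com" where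
  "pushes r 0 = Skip"
| "pushes r (Suc n) = push r 1 ;; pushes r n"

definition "mul = foreach 12 13 (foreach 10 11 (push 14 1)) ;; clear 12 ;; move 14 12"

primrec power_prog :: "nat \<Rightarrow> com" where
  "power_prog 0 = push 12 1"
| "power_prog (Suc h) = power_prog h ;; mul"

text \<open>Row 0 is pushed last and is therefore emitted with number 0; it is a zero row with its
  own terminator 5, by which later steps recognise it.\<close>

definition "dummies = foreach 12 13 (push 9 4 ;; foreach 24 27 (push 9 1)) ;;
  push 9 5 ;; foreach 24 27 (push 9 1)"

definition "count_rows = foreach 9 14 (If 9 9 (\<lambda>x _. x = 4) (push 17 1) Skip)"

text \<open>Pushes \<open>tailw j n\<close> from its end, with \<open>j\<close> and
  \<open>n - 1 - j\<close> in unary on tapes 15 and 17.\<close>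

definition "tail =
  push 23 3 ;; push 23 2 ;; push 23 3 ;; push 23 2 ;; push 23 1 ;; push 23 1 ;; push 23 1 ;; push 23 1 ;;
  push 23 1 ;; push 23 1 ;; push 23 1 ;; foreach 17 18 (push 23 1) ;; push 23 2 ;; foreach 15 16 (push 23 1)"

definition "base_bit = put 9 (\<lambda>x. if x = 5 then 2 else 1) 23"

definition "emit_col = tail ;; If 9 9 (\<lambda>x _. x = 5) (push 23 1) (put 19 id 23) ;; tail ;; base_bit ;; pop 19"

definition "mk_cols =
  While 9 9 (\<lambda>x _. x < 4) (put 9 id 21 ;; pop 9) ;;
  foreach 12 13 (foreach 21 22 (put 21 id 19)) ;;
  foreach 15 16 (push 19 1) ;; push 19 2 ;; foreach 17 18 (push 19 1)"

definition "emit_row = mk_cols ;; (push 23 4 ;; tail ;; base_bit) ;; WhileNE 19 emit_col ;;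
  clear 21 ;; pop 9 ;; push 15 1 ;; If 17 17 (\<lambda>x _. x \<noteq> 0) (pop 17) Skip"

definition "emit_rows = WhileNE 9 emit_row"

text \<open>The code of a value \<open>2 * ident n j + b\<close> without its lowest bit
  \<open>b\<close>: the number 2^j + 2^(n + 7) in binary, a delimiter, the denominator 1, a
  delimiter. It is the same for all values of a row.\<close>

definition tailw :: "nat \<Rightarrow> nat \<Rightarrow> nat list" where
  "tailw j n = replicate j 1 @ [2] @ replicate (n - 1 - j) 1 @ replicate 7 1 @ [2, 3, 2, 3]"

definition cols :: "nat \<Rightarrow> nat \<Rightarrow> nat \<Rightarrow> nat list \<Rightarrow> nat list" where
  "cols N n j p = concat (replicate N p) @ replicate j 1 @ [2] @ replicate (n - 1 - j) 1"

text \<open>A column yields two values, the base level and the level after the jump; the return to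
  the base level is the beginning of the next column or the final value added in
  \<open>rowtext\<close>.\<close>

definition colw :: "nat \<Rightarrow> nat \<Rightarrow> nat \<Rightarrow> nat \<Rightarrow> nat list" where
  "colw x j n e = (if x = 5 then 2 else 1) # tailw j n @ (if x = 5 then 1 else e) # tailw j n"

definition rowtext :: "nat \<Rightarrow> nat \<Rightarrow> nat \<Rightarrow> nat \<times> nat list \<Rightarrow> nat list" where
  "rowtext N n j xp = concat (map (colw (fst xp) j n) (cols N n j (snd xp))) @
     (if fst xp = 5 then 2 else 1) # tailw j n @ [4]"

definition ftext :: "(nat \<times> nat list) list \<Rightarrow> nat list" where
  "ftext rs = concat (map (\<lambda>(x, p). rev p @ [x]) rs)"

definition zc :: "nat \<Rightarrow> nat" where
  "zc x = (if x = 3 then 2 else if x = 4 then 1 else 0)"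

lemma zc_width: "sum_list (map zc (etoks ts)) = width ts"
proof (induction ts)
  case (Cons t ts)
  have z: "sum_list (map zc (lstr l)) = 0" for l
    using lstr_bits[of l] by (fastforce simp: zc_def)
  have "sum_list (map zc (etok t)) = tw t"
    by (cases t) (simp_all add: etok_def z, simp_all add: zc_def)
  with Cons show ?case by (simp add: width_def)
qed (simp add: width_def)

context tapes
begin

lemmas ems = runs_emit_const

text \<open>Tape 10 collects the basis of the power \<open>N\<close>. Two marks per symbol, together
  with an even constant pushed later, make \<open>N\<close> even, so that the zero rows can be split
  in halves.\<close>

lemma copy_in_runs:
  assumes "s 28 = stk (rev (etoks ts))" "s 29 = stk []" "s 1 = stk []" "s 3 = stk []" "s 10 = stk []"
    "s 24 = stk []" and len: "length (etoks ts) \<le> B"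
  shows "runs 40 copy_in s (s(1 := stk (etoks ts), 3 := stk (etoks ts),
    10 := stk (replicate (2 * length (etoks ts)) 1), 24 := stk (replicate (width ts) 1)))"
proof -
  let ?F = "\<lambda>ys. s(1 := stk (rev ys), 3 := stk (rev ys), 10 := stk (replicate (2 * length ys) 1),
     24 := stk (replicate (sum_list (map zc ys)) 1))"
  have "runs (30 + 10) copy_in s ((?F (rev (etoks ts)))(28 := stk (rev (etoks ts)), 29 := stk []))"
    unfolding copy_in_def
  proof (rule runs_foreach[where F = ?F])
    fix ys u zs
    show "runs 30 (put 28 id 1 ;; put 28 id 3 ;; push 10 1 ;; push 10 1 ;;
    If 28 28 (\<lambda>x _. x = 3) (push 24 1 ;; push 24 1) (If 28 28 (\<lambda>x _. x = 4) (push 24 1) Skip))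
      ((?F ys)(28 := stk (u # zs), 29 := stk (rev ys))) ((?F (ys @ [u]))(28 := stk (u # zs), 29 := stk (rev ys)))"
      by (cases "u = 3"; cases "u = 4"; rule runs_eq, (rule sx | (rule runs_If_True, (simp; fail)) |
        (rule runs_If_False, (simp; fail)) | (simp; fail) | (auto simp: fun_eq_iff zc_def; fail))+)
  qed (use assms etoks_nz[of ts] in \<open>auto simp: fun_eq_iff\<close>)
  then show ?thesis
    by (rule runs_eq) (use assms in \<open>auto simp: fun_eq_iff zc_width rev_map[symmetric]\<close>)
qed

lemma pushes_runs:
  assumes "r < k" "s r = stk xs"
  shows "runs (2 * n) (pushes r n) s (s(r := stk (replicate n 1 @ xs)))"
  using assms
proof (induction n arbitrary: s xs)
  case 0
  then have "s(r := stk xs) = s" by auto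
  then show ?case using runs_Skip by simp
next
  case (Suc n)
  have "runs (1 + 2 * n + 1) (pushes r (Suc n)) s (s(r := stk (1 # xs), r := stk (replicate n 1 @ 1 # xs)))"
    unfolding pushes.simps by (rule runs_Seq[OF runs_push Suc.IH]) (use Suc.prems in auto)
  then show ?case by (rule runs_eq) (auto simp: fun_eq_iff replicate_app_Cons_same)
qed

lemma mul_runs:
  assumes "s 10 = stk (replicate a 1)" "s 11 = stk []" "s 12 = stk (replicate b 1)" "s 13 = stk []" "s 14 = stk []"
    "a \<le> B" "b \<le> B" "b * a \<le> B"
  shows "runs 40 mul s (s(12 := stk (replicate (b * a) 1)))"
proof -
  have c: "concat (replicate n (replicate m x)) = replicate (n * m) x" for n m and x :: nat
    by (induction n) (simp_all add: replicate_add)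
  have "runs (11 + 10) (foreach 12 13 (foreach 10 11 (push 14 1))) s
     (s(14 := stk (concat (map (\<lambda>_. replicate a 1) (rev (replicate b (1::nat)))) @ [])))"
  proof (rule runs_emit)
    fix \<sigma> :: store and y' z zs
    assume \<sigma>: "\<sigma> 14 = stk y'" "\<And>i. i \<noteq> 12 \<Longrightarrow> i \<noteq> 13 \<Longrightarrow> i \<noteq> 14 \<Longrightarrow> \<sigma> i = s i"
    show "runs 11 (foreach 10 11 (push 14 1)) \<sigma> (\<sigma>(14 := stk (replicate a 1 @ y')))"
      using runs_emit_const[of 10 11 14 \<sigma> "replicate a 1" y' 1] \<sigma> assms by simp
  qed (use assms in auto)
  then have 1: "runs 21 (foreach 12 13 (foreach 10 11 (push 14 1))) s (s(14 := stk (replicate (b * a) 1)))"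
    by (simp add: map_replicate_const c)
  show ?thesis unfolding mul_def
    by (rule runs_eq, (rule 1 sx runs_clear[where xs = "replicate b 1"] runs_move[where xs = "replicate (b * a) 1" and ys = "[]"]
      | (use assms in \<open>simp; fail\<close>) | (use assms in \<open>auto simp: fun_eq_iff; fail\<close>))+)
qed

lemma pow_runs:
  assumes "s 10 = stk (replicate a 1)" "s 11 = stk []" "s 12 = stk []" "s 13 = stk []" "s 14 = stk []"
    "a ^ h \<le> B" "1 \<le> a" "a \<le> B"
  shows "runs (41 * h + 1) (power_prog h) s (s(12 := stk (replicate (a ^ h) 1)))"
  using assms
proof (induction h)
  case 0
  then show ?case using runs_push[of 12 s "[]" 1] by (simp add: fun_upd_def)
next
  case (Suc h)
  have "a ^ h \<le> a ^ Suc h" using Suc.prems(7) by (intro power_increasing) simp_all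
  then have le: "a ^ h \<le> B" by (rule le_trans[OF _ Suc.prems(6)])
  have "runs ((41 * h + 1) + 40 + 1) (power_prog h ;; mul) s
      (s(12 := stk (replicate (a ^ h) 1), 12 := stk (replicate (a ^ h * a) 1)))"
    by (rule runs_Seq[OF Suc.IH mul_runs]) (use Suc.prems le in \<open>auto simp: mult.commute\<close>)
  then show ?case unfolding power_prog.simps by (rule runs_eq) (auto simp: fun_eq_iff mult.commute)
qed

lemma dummies_runs:
  assumes "s 12 = stk (replicate N 1)" "s 13 = stk []" "s 24 = stk (replicate z 1)" "s 27 = stk []"
    "s 9 = stk (rtext ps)" "N \<le> B" "z \<le> B"
  shows "runs 60 dummies s (s(9 := stk (ftext ((5, replicate z 1) # replicate N (4, replicate z 1) @ map (Pair 4) ps))))"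
proof -
  have "runs (13 + 10) (foreach 12 13 (push 9 4 ;; foreach 24 27 (push 9 1))) s
     (s(9 := stk (concat (map (\<lambda>_. replicate z 1 @ [4]) (rev (replicate N (1::nat)))) @ rtext ps)))"
  proof (rule runs_emit)
    fix \<sigma> :: store and y' u zs
    assume \<sigma>: "\<sigma> 9 = stk y'" "\<And>i. i \<noteq> 12 \<Longrightarrow> i \<noteq> 13 \<Longrightarrow> i \<noteq> 9 \<Longrightarrow> \<sigma> i = s i"
    show "runs 13 (push 9 4 ;; foreach 24 27 (push 9 1)) \<sigma> (\<sigma>(9 := stk ((replicate z 1 @ [4]) @ y')))"
      by (rule runs_eq, (rule sx ems[where xs = "replicate z 1"] | (use \<sigma> assms in \<open>simp; fail\<close>)
           | (use assms in \<open>auto simp: fun_eq_iff; fail\<close>))+)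
  qed (use assms in auto)
  then have 1: "runs 23 (foreach 12 13 (push 9 4 ;; foreach 24 27 (push 9 1))) s
     (s(9 := stk (concat (replicate N (replicate z 1 @ [4])) @ rtext ps)))"
    by (simp add: map_replicate_const)
  show ?thesis unfolding dummies_def
    by (rule runs_eq, (rule 1 sx ems[where xs = "replicate z 1"]
      | (use assms in \<open>simp; fail\<close>) | (use assms in \<open>auto simp: fun_eq_iff ftext_def rtext_def o_def; fail\<close>))+)
qed

lemma count_rows_runs:
  assumes "s 9 = stk xs" "s 14 = stk []" "s 17 = stk []" "0 \<notin> set xs" "length xs \<le> B"
  shows "runs 20 count_rows s (s(17 := stk (replicate (length (filter (\<lambda>x. x = 4) xs)) 1)))"
proof -
  have "runs (5 + 10) count_rows s (s(17 := stk (concat (map (\<lambda>x. if x = 4 then [1] else []) (rev xs)) @ [])))"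
    unfolding count_rows_def
  proof (rule runs_emit)
    fix \<sigma> :: store and y' u zs
    assume \<sigma>: "\<sigma> 9 = stk (u # zs)" "\<sigma> 17 = stk y'"
    show "runs 5 (If 9 9 (\<lambda>x _. x = 4) (push 17 1) Skip) \<sigma> (\<sigma>(17 := stk ((if u = 4 then [1] else []) @ y')))"
      by (cases "u = 4"; rule runs_eq, (rule sx | (rule runs_If_True, (use \<sigma> in \<open>simp; fail\<close>)) |
        (rule runs_If_False, (use \<sigma> in \<open>simp; fail\<close>)) | (use \<sigma> in \<open>simp; fail\<close>) |
        (use \<sigma> in \<open>auto simp: fun_eq_iff; fail\<close>))+)
  qed (use assms in auto)
  moreover have "concat (map (\<lambda>x. if x = 4 then [1] else []) xs) = replicate (length (filter (\<lambda>x. x = 4) xs)) (1::nat)"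
    for xs :: "nat list" by (induction xs) auto
  ultimately show ?thesis by (elim runs_eq) (simp_all flip: rev_filter)
qed

lemma tail_runs:
  assumes "s 15 = stk (replicate j 1)" "s 16 = stk []" "s 17 = stk (replicate (n - 1 - j) 1)" "s 18 = stk []"
    "s 23 = stk y" "j \<le> B" "n \<le> B"
  shows "runs 60 tail s (s(23 := stk (tailw j n @ y)))"
proof -
  have seven: "replicate 7 x = [x, x, x, x, x, x, x]" for x :: nat by (simp add: numeral_eq_Suc)
  show ?thesis
    unfolding tail_def
    by (rule runs_eq, (rule sx ems[where r = 17 and xs = "replicate (n - 1 - j) 1"] ems[where r = 15 and xs = "replicate j 1"] |
      (use assms in \<open>simp; fail\<close>) | (use assms in \<open>auto simp: fun_eq_iff tailw_def seven; fail\<close>))+)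
qed

lemma mk_cols_runs:
  assumes "s 9 = stk (rev p @ x # xs)" "s 12 = stk (replicate N 1)" "s 13 = stk []" "s 21 = stk []" "s 22 = stk []"
    "s 15 = stk (replicate j 1)" "s 16 = stk []" "s 17 = stk (replicate (n - 1 - j) 1)" "s 18 = stk []" "s 19 = stk []"
    and x: "4 \<le> x" and p: "set p \<subseteq> {1, 2}" and B: "length p \<le> B" "N \<le> B" "j \<le> B" "n \<le> B"
  shows "runs 80 mk_cols s (s(9 := stk (x # xs), 21 := stk p, 19 := stk (rev (cols N n j p))))"
proof -
  let ?f = "\<lambda>i. s(9 := stk (drop i (rev p) @ x # xs), 21 := stk (rev (take i (rev p))))"
  have "runs (2 + 2) (While 9 9 (\<lambda>x _. x < 4) (put 9 id 21 ;; pop 9)) (?f 0) (?f (length p))"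
  proof (rule runs_loop)
    fix i assume i: "i < length p"
    have d: "drop i (rev p) = rev p ! i # drop (Suc i) (rev p)" using i by (simp add: Cons_nth_drop_Suc)
    have "rev p ! i \<in> set p" using i nth_mem[of i "rev p"] by simp
    then show "rd (?f i 9) < 4" using p by (auto simp: d)
    show "runs 2 (put 9 id 21 ;; pop 9) (?f i) (?f (Suc i))"
      by (rule runs_eq, (rule sx | (simp add: d; fail))+)
        (use i in \<open>auto simp: fun_eq_iff d take_Suc_conv_app_nth\<close>)
  qed (use B x in auto)
  moreover have "?f 0 = s" using assms by (auto simp: fun_eq_iff)
  ultimately have 1: "runs 4 (While 9 9 (\<lambda>x _. x < 4) (put 9 id 21 ;; pop 9)) s (s(9 := stk (x # xs), 21 := stk p))"
    by simp
  let ?s1 = "s(9 := stk (x # xs), 21 := stk p)"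
  have "runs (11 + 10) (foreach 12 13 (foreach 21 22 (put 21 id 19))) ?s1
     (?s1(19 := stk (concat (map (\<lambda>_. rev p) (rev (replicate N (1::nat)))) @ [])))"
  proof (rule runs_emit)
    fix \<sigma> :: store and y' u zs
    assume \<sigma>: "\<sigma> 19 = stk y'" "\<And>i. i \<noteq> 12 \<Longrightarrow> i \<noteq> 13 \<Longrightarrow> i \<noteq> 19 \<Longrightarrow> \<sigma> i = ?s1 i"
    have "runs (1 + 10) (foreach 21 22 (put 21 id 19)) \<sigma> (\<sigma>(19 := stk (concat (map (\<lambda>b. [b]) (rev p)) @ y')))"
    proof (rule runs_emit)
      fix \<sigma>' :: store and y' u zs
      assume "\<sigma>' 21 = stk (u # zs)" "\<sigma>' 19 = stk y'"
      then show "runs 1 (put 21 id 19) \<sigma>' (\<sigma>'(19 := stk ([u] @ y')))"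
        using runs_put[of 21 19 \<sigma>' y' id] by simp
    qed (use assms \<sigma> in auto)
    then show "runs 11 (foreach 21 22 (put 21 id 19)) \<sigma> (\<sigma>(19 := stk (rev p @ y')))" by simp
  qed (use assms in auto)
  then have 2: "runs 21 (foreach 12 13 (foreach 21 22 (put 21 id 19))) ?s1
     (?s1(19 := stk (concat (replicate N (rev p)))))"
    by (simp add: map_replicate_const)
  have r: "rev (concat (replicate N p)) = concat (replicate N (rev p))" by (simp add: rev_concat)
  show ?thesis unfolding mk_cols_def
    by (rule runs_eq, (rule sx 1 2 ems[where r = 17 and xs = "replicate (n - 1 - j) 1"] ems[where r = 15 and xs = "replicate j 1"] |
      (use assms in \<open>simp; fail\<close>) | (use assms in \<open>auto simp: fun_eq_iff cols_def r; fail\<close>))+)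
qed

text \<open>The trailing base value is pushed before the columns, and the columns are consumed from
  the last to the first, because the output is built on a stack. The unary counters for
  \<open>j\<close> and \<open>n - 1 - j\<close> are advanced for the next row.\<close>

lemma emit_row_runs:
  assumes "s 9 = stk (rev p @ x # xs)" "s 12 = stk (replicate N 1)" "s 13 = stk []" "s 21 = stk []" "s 22 = stk []"
    "s 15 = stk (replicate j 1)" "s 16 = stk []" "s 17 = stk (replicate (n - 1 - j) 1)" "s 18 = stk []" "s 19 = stk []"
    "s 23 = stk y"
    and x: "4 \<le> x" and p: "set p \<subseteq> {1, 2}" and B: "length p \<le> B" "N \<le> B" "j \<le> B" "n \<le> B"
      "N * length p + n + j + 1 \<le> B"
  shows "runs 400 emit_row s (s(9 := stk xs, 15 := stk (replicate (Suc j) 1),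
     17 := stk (replicate (n - 1 - Suc j) 1), 23 := stk (rowtext N n j (x, p) @ y)))"
proof -
  define nb where "nb = (if x = 5 then 2 else 1 :: nat)"
  define E where "E = rev (cols N n j p)"
  have E: "set E \<subseteq> {1, 2}" using p by (auto simp: E_def cols_def)
  have lE: "length E \<le> B" using B by (simp add: E_def cols_def length_concat sum_list_replicate)
  let ?s1 = "s(9 := stk (x # xs), 21 := stk p, 19 := stk E)"
  have 1: "runs 80 mk_cols s ?s1" unfolding E_def by (rule mk_cols_runs) (use assms in auto)
  have t: "runs 60 tail \<sigma> (\<sigma>(23 := stk (tailw j n @ z)))" if "\<sigma> 15 = s 15" "\<sigma> 16 = s 16" "\<sigma> 17 = s 17"
     "\<sigma> 18 = s 18" "\<sigma> 23 = stk z" for \<sigma> z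
    by (rule tail_runs) (use that assms in auto)
  have bb: "runs 1 base_bit \<sigma> (\<sigma>(23 := stk (nb # z)))" if "\<sigma> 9 = stk (x # xs)" "\<sigma> 23 = stk z" for \<sigma> z
    unfolding base_bit_def by (rule runs_eq, rule runs_put) (use that in \<open>auto simp: nb_def\<close>)
  let ?Y = "nb # tailw j n @ 4 # y"
  let ?F = "\<lambda>us. ?s1(19 := stk (drop (length us) E), 23 := stk (concat (map (colw x j n) (rev us)) @ ?Y))"
  have "runs (140 + 2) (WhileNE 19 emit_col) (?F []) (?F E)"
  proof (rule runs_consume[where F = ?F])
    fix us u zs assume e: "E = us @ u # zs"
    have 3: "runs 2 (If 9 9 (\<lambda>x _. x = 5) (push 23 1) (put 19 id 23)) \<sigma>
        (\<sigma>(23 := stk ((if x = 5 then 1 else u) # z)))"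
      if \<sigma>: "\<sigma> 9 = stk (x # xs)" "\<sigma> 19 = stk (u # zs)" "\<sigma> 23 = stk z" for \<sigma> z
      by (cases "x = 5"; rule runs_eq, (rule sx | (rule runs_If_True, (use \<sigma> in \<open>simp; fail\<close>)) |
        (rule runs_If_False, (use \<sigma> in \<open>simp; fail\<close>)) | (use \<sigma> in \<open>simp; fail\<close>) |
        (use \<sigma> in \<open>auto simp: fun_eq_iff; fail\<close>))+)
    show "runs 140 emit_col (?F us) (?F (us @ [u]))"
      unfolding emit_col_def
      by (rule runs_eq, (rule t bb 3 sx | (use e assms in \<open>simp; fail\<close>) |
        (use e assms in \<open>auto simp: fun_eq_iff colw_def nb_def; fail\<close>))+)
  qed (use E lE in \<open>auto simp: E_def\<close>)
  then have 2: "runs 142 (WhileNE 19 emit_col) (?F []) (?F E)" by simp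
  have F: "?F [] = ?s1(23 := stk ?Y)" by (auto simp: fun_eq_iff)
  have 4: "runs 2 (If 17 17 (\<lambda>x _. x \<noteq> 0) (pop 17) Skip) \<sigma> (\<sigma>(17 := stk (replicate (n - 1 - Suc j) 1)))"
    if \<sigma>: "\<sigma> 17 = stk (replicate (n - 1 - j) 1)" for \<sigma>
  proof (cases "n - 1 - j")
    case 0
    then have "n - 1 - Suc j = 0" by simp
    with 0 \<sigma> show ?thesis
      by (intro runs_eq[OF runs_If_False[OF _ _ _ runs_Skip]]) (auto simp: fun_eq_iff)
  next
    case (Suc d)
    then have "n - 1 - Suc j = d" by simp
    with Suc \<sigma> show ?thesis
      by (intro runs_eq[OF runs_If_True[OF _ _ _ runs_pop[where x = 1 and xs = "replicate d 1"]]]) auto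
  qed
  have 0: "runs 65 (push 23 4 ;; tail ;; base_bit) ?s1 (?F [])" unfolding F
    by (rule runs_eq, (rule t bb sx | (use assms in \<open>simp; fail\<close>) |
        (use assms in \<open>auto simp: fun_eq_iff; fail\<close>))+)
  have 5: "runs 12 (clear 21 ;; pop 9 ;; push 15 1 ;; If 17 17 (\<lambda>x _. x \<noteq> 0) (pop 17) Skip) (?F E)
     (s(9 := stk xs, 15 := stk (replicate (Suc j) 1),
     17 := stk (replicate (n - 1 - Suc j) 1), 23 := stk (rowtext N n j (x, p) @ y)))"
    by (rule runs_eq, (rule 4 runs_clear[where xs = p] sx | (use B p assms in \<open>simp; fail\<close>) |
        (use B p assms in \<open>auto simp: fun_eq_iff rowtext_def E_def nb_def; fail\<close>))+)
  show ?thesis unfolding emit_row_def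
    by (rule runs_weaken[OF runs_Seq[OF 1 runs_Seq[OF 0 runs_Seq[OF 2 5]]]]) simp
qed

lemma emit_rows_runs:
  assumes "s 9 = stk (ftext rs)" "s 12 = stk (replicate N 1)" "s 13 = stk []" "s 21 = stk []" "s 22 = stk []"
    "s 15 = stk []" "s 16 = stk []" "s 17 = stk (replicate (length rs - 1) 1)" "s 18 = stk []" "s 19 = stk []"
    "s 23 = stk []"
    and rs: "\<And>x p. (x, p) \<in> set rs \<Longrightarrow> 4 \<le> x \<and> set p \<subseteq> {1, 2} \<and> length p = z"
    and B: "z \<le> B" "N \<le> B" "N * z + 2 * length rs + 1 \<le> B"
  shows "runs 402 emit_rows s (s(9 := stk [], 15 := stk (replicate (length rs) 1), 17 := stk [],
     23 := stk (concat (rev (map (\<lambda>j. rowtext N (length rs) j (rs ! j)) [0..<length rs])))))"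
proof -
  let ?n = "length rs"
  let ?f = "\<lambda>i. s(9 := stk (ftext (drop i rs)), 15 := stk (replicate i 1), 17 := stk (replicate (?n - 1 - i) 1),
     23 := stk (concat (rev (map (\<lambda>j. rowtext N ?n j (rs ! j)) [0..<i]))))"
  have "runs (400 + 2) emit_rows (?f 0) (?f ?n)"
    unfolding emit_rows_def
  proof (rule runs_loop)
    fix i assume i: "i < ?n"
    obtain x p where xp: "rs ! i = (x, p)" by force
    have d: "drop i rs = (x, p) # drop (Suc i) rs" using i xp by (metis Cons_nth_drop_Suc)
    have m: "(x, p) \<in> set rs" using nth_mem[OF i] xp by simp
    have ft: "ftext (drop i rs) = rev p @ x # ftext (drop (Suc i) rs)" by (simp add: d ftext_def)
    show "rd (?f i 9) \<noteq> 0"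
    proof (cases "rev p")
      case Nil
      then show ?thesis using rs[OF m] by (simp add: ft)
    next
      case (Cons b bs)
      then have "b \<in> set p" by (metis list.set_intros(1) set_rev)
      then show ?thesis using rs[OF m] Cons by (auto simp: ft)
    qed
    show "runs 400 emit_row (?f i) (?f (Suc i))"
      by (rule runs_eq, rule emit_row_runs[where p = p and x = x and n = ?n and N = N and j = i and
          xs = "ftext (drop (Suc i) rs)"])
        (use assms rs[OF m] i xp in \<open>auto simp: ft fun_eq_iff\<close>)
  qed (use B in \<open>auto simp: ftext_def\<close>)
  moreover have "?f 0 = s" using assms by (auto simp: fun_eq_iff)
  ultimately have "runs 402 emit_rows s (?f ?n)" by simp
  then show ?thesis by (rule runs_eq) (auto simp: ftext_def)
qed

end

section \<open>Input, output and verdict\<close>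

definition rtape :: "nat list \<Rightarrow> int \<Rightarrow> int \<times> (int \<Rightarrow> nat)" where
  "rtape w h = (h, \<lambda>z. if 0 \<le> z \<and> z < int (length w) then w ! nat z else 0)"

definition right :: "nat \<Rightarrow> com" where "right r = Prim r r (\<lambda>_ x. (x, 1))"
definition left :: "nat \<Rightarrow> com" where "left r = Prim r r (\<lambda>_ x. (x, -1))"

text \<open>The way back to the left end erases the input, so that tape 0 is blank with its head at
  cell 0 when the answer is written there.\<close>

definition "read_in =
  WhileNE 0 (put 0 id 28 ;; right 0) ;; left 0 ;; WhileNE 0 (Prim 0 0 (\<lambda>_ _. (0, -1))) ;; right 0"

definition "load = WhileNE 23 (Prim 23 40 (\<lambda>a _. (a, 1)) ;; pop 23) ;;
  left 40 ;; WhileNE 40 (left 40) ;; right 40"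

text \<open>The specification of an output leaves open the final head position and the cells outside
  the word, so cell 0 cannot be found from the tape contents. Reversing the logged movements leads
  back to it.\<close>

definition "undo = WhileNE 20
  (If 20 20 (\<lambda>x _. x = 1) (right 40) (If 20 20 (\<lambda>x _. x = 3) (left 40) Skip) ;; pop 20)"

definition "read_out = WhileNE 40 (put 40 id 33 ;; right 40) ;; move 33 34"

definition popg :: "nat \<Rightarrow> com" where "popg r = If r r (\<lambda>x _. x \<noteq> 0) (pop r) Skip"

text \<open>Tape 35 counts the rows before row 0 and, once tape 36 signals that row 0 has been seen,
  loses two marks for every further row (stopping at zero). It ends up empty iff the number of rows
  before row 0 is at most twice the number of rows after it.\<close>

definition "decode_step =
  If 34 34 (\<lambda>x _. x = 2) (push 36 1) (If 36 36 (\<lambda>x _. x = 0) (push 35 1) (popg 35 ;; popg 35)) ;;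
  While 34 34 (\<lambda>x _. x \<noteq> 4) (pop 34) ;; pop 34"

definition "decode = WhileNE 34 decode_step ;;
  If 35 35 (\<lambda>x _. x = 0) (Prim 0 0 (\<lambda>_ _. (2, 0))) (Prim 0 0 (\<lambda>_ _. (1, 0)))"

lemma rd_rtape: "0 \<le> h \<Longrightarrow> h < int (length w) \<Longrightarrow> rd (rtape w h) = w ! nat h"
  "h < 0 \<or> int (length w) \<le> h \<Longrightarrow> rd (rtape w h) = 0"
  by (auto simp: rd_def rtape_def)

lemma act_move: "act (rd t, d) t = (fst t + d, snd t)"
  by (simp add: act_def rd_def)

context tapes
begin

lemma runs_right: "r < k \<Longrightarrow> runs 0 (right r) s (s(r := (fst (s r) + 1, snd (s r))))"
  unfolding right_def by (rule runs_Prim) (auto simp: act_move)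

lemma runs_left: "r < k \<Longrightarrow> runs 0 (left r) s (s(r := (fst (s r) - 1, snd (s r))))"
  unfolding left_def by (rule runs_Prim) (auto simp: act_move)

lemma read_in_runs:
  assumes "s 0 = rtape w 0" "s 28 = stk []" and w: "0 \<notin> set w" "length w \<le> B"
  shows "runs 20 read_in s (s(0 := rtape [] 0, 28 := stk (rev w)))"
proof -
  let ?f = "\<lambda>i. s(0 := rtape w (int i), 28 := stk (rev (take i w)))"
  have "runs (2 + 2) (WhileNE 0 (put 0 id 28 ;; right 0)) (?f 0) (?f (length w))"
  proof (rule runs_loop)
    fix i assume i: "i < length w"
    have nz: "w ! i \<noteq> 0" using w nth_mem[OF i] by metis
    then show "rd (?f i 0) \<noteq> 0" using i by (simp add: rd_rtape)
    show "runs 2 (put 0 id 28 ;; right 0) (?f i) (?f (Suc i))"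
      by (rule runs_eq, (rule sx runs_right | (simp; fail))+)
        (use i in \<open>auto simp: fun_eq_iff rd_rtape take_Suc_conv_app_nth, auto simp: rtape_def\<close>)
  qed (use w in \<open>auto simp: rd_rtape\<close>)
  moreover have "?f 0 = s" using assms by (auto simp: fun_eq_iff)
  ultimately have 1: "runs 4 (WhileNE 0 (put 0 id 28 ;; right 0)) s (s(0 := rtape w (int (length w)), 28 := stk (rev w)))"
    by simp
  let ?g = "\<lambda>i. s(0 := rtape (take (length w - i) w) (int (length w) - 1 - int i), 28 := stk (rev w))"
  have 2: "runs (0 + 2) (WhileNE 0 (Prim 0 0 (\<lambda>_ _. (0, -1)))) (?g 0) (?g (length w))"
  proof (rule runs_loop)
    fix i assume i: "i < length w"
    then have j: "length w - Suc i < length w" by simp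
    have nz: "w ! (length w - Suc i) \<noteq> 0" using w nth_mem[OF j] by metis
    have nt: "nat (int (length w) - 1 - int i) = length w - Suc i" using i by simp
    show "rd (?g i 0) \<noteq> 0" using i nz by (simp add: rd_rtape nt)
    have t: "take (length w - i) w = take (length w - Suc i) w @ [w ! (length w - Suc i)]"
      using i by (metis Suc_diff_Suc j take_Suc_conv_app_nth)
    have "act (0, -1) (rtape (take (length w - i) w) (int (length w) - 1 - int i)) =
       rtape (take (length w - Suc i) w) (int (length w) - 1 - int (Suc i))"
      using i by (auto simp: act_def rtape_def fun_eq_iff)
    then show "runs 0 (Prim 0 0 (\<lambda>_ _. (0, -1))) (?g i) (?g (Suc i))"
      by (intro runs_Prim) (auto simp: fun_eq_iff)
  qed (use w in \<open>auto simp: rd_rtape\<close>)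
  have 2: "runs 2 (WhileNE 0 (Prim 0 0 (\<lambda>_ _. (0, -1)))) \<sigma> (?g (length w))" if "\<sigma> = ?g 0" for \<sigma>
    using 2 that by (simp add: numeral_2_eq_2)
  show ?thesis unfolding read_in_def
    by (rule runs_eq, (rule 1 2 sx runs_right runs_left | (simp; fail) | (auto simp: fun_eq_iff rtape_def; fail))+)
qed

lemma load_runs:
  assumes "s 23 = stk v" "s 40 = rtape [] 0" and w: "0 \<notin> set v" "length v \<le> B" and k40: "40 < k"
  shows "runs 20 load s (s(23 := stk [], 40 := rtape v 0))"
proof -
  let ?f = "\<lambda>i. s(40 := rtape (take i v) (int i), 23 := stk (drop i v))"
  have "runs (1 + 2) (WhileNE 23 (Prim 23 40 (\<lambda>a _. (a, 1)) ;; pop 23)) (?f 0) (?f (length v))"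
  proof (rule runs_loop)
    fix i assume i: "i < length v"
    have nz: "v ! i \<noteq> 0" using w nth_mem[OF i] by metis
    have d: "drop i v = v ! i # drop (Suc i) v" using i by (simp add: Cons_nth_drop_Suc)
    show "rd (?f i 23) \<noteq> 0" using nz by (simp add: d)
    have "act (v ! i, 1) (rtape (take i v) (int i)) = rtape (take (Suc i) v) (int (Suc i))"
      using i by (auto simp: act_def rtape_def fun_eq_iff nth_append take_Suc_conv_app_nth)
    then have "runs (0 + 0 + 1) (Prim 23 40 (\<lambda>a _. (a, 1)) ;; pop 23) (?f i) (?f (Suc i))"
      by (intro runs_eq[OF runs_Seq[OF runs_Prim[OF _ k40 refl] runs_pop[where x = "v ! i" and xs = "drop (Suc i) v"]]])
        (auto simp: d fun_eq_iff)
    then show "runs 1 (Prim 23 40 (\<lambda>a _. (a, 1)) ;; pop 23) (?f i) (?f (Suc i))" by simp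
  qed (use w k40 in auto)
  moreover have "?f 0 = s" using assms by (auto simp: fun_eq_iff)
  ultimately have 1: "runs 3 (WhileNE 23 (Prim 23 40 (\<lambda>a _. (a, 1)) ;; pop 23)) s
      (s(40 := rtape v (int (length v)), 23 := stk []))"
    by (simp add: numeral_3_eq_3)
  let ?g = "\<lambda>i. s(40 := rtape v (int (length v) - 1 - int i), 23 := stk [])"
  have 2: "runs (0 + 2) (WhileNE 40 (left 40)) (?g 0) (?g (length v))"
  proof (rule runs_loop)
    fix i assume i: "i < length v"
    then have j: "length v - Suc i < length v" by simp
    have nz: "v ! (length v - Suc i) \<noteq> 0" using w nth_mem[OF j] by metis
    have nt: "nat (int (length v) - 1 - int i) = length v - Suc i" using i by simp
    show "rd (?g i 40) \<noteq> 0" using i nz by (simp add: rd_rtape nt)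
    show "runs 0 (left 40) (?g i) (?g (Suc i))"
      by (rule runs_eq, rule runs_left) (use k40 in \<open>auto simp: fun_eq_iff rtape_def\<close>)
  qed (use w k40 in \<open>auto simp: rd_rtape\<close>)
  have 2: "runs 2 (WhileNE 40 (left 40)) \<sigma> (?g (length v))" if "\<sigma> = ?g 0" for \<sigma>
    using 2 that by (simp add: numeral_2_eq_2)
  show ?thesis unfolding load_def
    by (rule runs_eq, (rule 1 2 sx runs_right runs_left | (use k40 in \<open>simp; fail\<close>)
      | (auto simp: fun_eq_iff rtape_def; fail))+)
qed

lemma undo_runs:
  assumes "s 20 = stk cs" "s 40 = (sum_list (map (\<lambda>c. int c - 2) cs), T)" and cs: "set cs \<subseteq> {1, 2, 3}" "length cs \<le> B"
    and k40: "40 < k"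
  shows "runs 10 undo s (s(20 := stk [], 40 := (0, T)))"
proof -
  let ?F = "\<lambda>us :: nat list. s(20 := stk (drop (length us) cs), 40 := (sum_list (map (\<lambda>c. int c - 2) (drop (length us) cs)), T))"
  have "runs (6 + 2) undo (?F []) (?F cs)"
    unfolding undo_def
  proof (rule runs_consume[where F = ?F])
    fix us u zs assume e: "cs = us @ u # zs"
    then have u: "u = 1 \<or> u = 2 \<or> u = 3" using cs by auto
    have F: "?F us = s(20 := stk (u # zs), 40 := (int u - 2 + sum_list (map (\<lambda>c. int c - 2) zs), T))"
      "?F (us @ [u]) = s(20 := stk zs, 40 := (sum_list (map (\<lambda>c. int c - 2) zs), T))"
      using e by simp_all
    show "runs 6 (If 20 20 (\<lambda>x _. x = 1) (right 40) (If 20 20 (\<lambda>x _. x = 3) (left 40) Skip) ;; pop 20)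
        (?F us) (?F (us @ [u]))"
      unfolding F
    proof (cases "u = 1"; cases "u = 3")
      assume "u = 1" "u \<noteq> 3"
      then show "runs 6 (If 20 20 (\<lambda>x _. x = 1) (right 40) (If 20 20 (\<lambda>x _. x = 3) (left 40) Skip) ;; pop 20)
        (s(20 := stk (u # zs), 40 := (int u - 2 + sum_list (map (\<lambda>c. int c - 2) zs), T)))
        (s(20 := stk zs, 40 := (sum_list (map (\<lambda>c. int c - 2) zs), T)))"
        by (intro runs_eq[OF runs_Seq[OF runs_If_True[OF _ _ _ runs_right] runs_pop[where x = u and xs = zs]]])
          (use k40 in \<open>auto simp: fun_eq_iff\<close>)
    next
      assume "u \<noteq> 1" "u = 3"
      then show "runs 6 (If 20 20 (\<lambda>x _. x = 1) (right 40) (If 20 20 (\<lambda>x _. x = 3) (left 40) Skip) ;; pop 20)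
        (s(20 := stk (u # zs), 40 := (int u - 2 + sum_list (map (\<lambda>c. int c - 2) zs), T)))
        (s(20 := stk zs, 40 := (sum_list (map (\<lambda>c. int c - 2) zs), T)))"
        by (intro runs_eq[OF runs_Seq[OF runs_If_False[OF _ _ _ runs_If_True[OF _ _ _ runs_left]]
             runs_pop[where x = u and xs = zs]]]) (use k40 in \<open>auto simp: fun_eq_iff\<close>)
    next
      assume "u \<noteq> 1" "u \<noteq> 3"
      then show "runs 6 (If 20 20 (\<lambda>x _. x = 1) (right 40) (If 20 20 (\<lambda>x _. x = 3) (left 40) Skip) ;; pop 20)
        (s(20 := stk (u # zs), 40 := (int u - 2 + sum_list (map (\<lambda>c. int c - 2) zs), T)))
        (s(20 := stk zs, 40 := (sum_list (map (\<lambda>c. int c - 2) zs), T)))" using u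
        by (intro runs_eq[OF runs_Seq[OF runs_If_False[OF _ _ _ runs_If_False[OF _ _ _ runs_Skip]]
             runs_pop[where x = u and xs = zs]]]) (auto simp: fun_eq_iff)
    qed simp
  qed (use cs in auto)
  moreover have "?F [] = s" using assms by (auto simp: fun_eq_iff)
  ultimately have "runs 8 undo s (?F cs)" by simp
  then show ?thesis by (rule runs_eq) auto
qed

lemma read_out_runs:
  assumes "s 40 = (0, T)" "s 33 = stk []" "s 34 = stk []" and v: "0 \<notin> set v" "length v \<le> B"
    and T: "\<And>i. i < length v \<Longrightarrow> T (int i) = v ! i" "T (int (length v)) = 0" and k40: "40 < k"
  shows "runs 10 read_out s (s(34 := stk v, 40 := (int (length v), T)))"
proof -
  let ?f = "\<lambda>i. s(40 := (int i, T), 33 := stk (rev (take i v)))"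
  have "runs (2 + 2) (WhileNE 40 (put 40 id 33 ;; right 40)) (?f 0) (?f (length v))"
  proof (rule runs_loop)
    fix i assume i: "i < length v"
    have nz: "v ! i \<noteq> 0" using v nth_mem[OF i] by metis
    then show "rd (?f i 40) \<noteq> 0" using i T by (simp add: rd_def)
    show "runs 2 (put 40 id 33 ;; right 40) (?f i) (?f (Suc i))"
      by (rule runs_eq, (rule sx runs_right | (use k40 in \<open>simp; fail\<close>))+)
        (use i T in \<open>auto simp: fun_eq_iff rd_def take_Suc_conv_app_nth\<close>)
  qed (use v T k40 in \<open>auto simp: rd_def\<close>)
  moreover have "?f 0 = s" using assms by (auto simp: fun_eq_iff)
  ultimately have 1: "runs 4 (WhileNE 40 (put 40 id 33 ;; right 40)) s (s(40 := (int (length v), T), 33 := stk (rev v)))"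
    by simp
  show ?thesis unfolding read_out_def
    by (rule runs_eq, (rule 1 sx runs_move[where xs = "rev v" and ys = "[]"] | (use v assms in \<open>simp; fail\<close>)
      | (use assms in \<open>auto simp: fun_eq_iff; fail\<close>))+)
qed

lemma popg_runs: "s r = stk xs \<Longrightarrow> 0 \<notin> set xs \<Longrightarrow> r < k \<Longrightarrow> runs 1 (popg r) s (s(r := stk (tl xs)))"
  unfolding popg_def
  by (cases xs) (intro runs_eq[OF runs_If_False[OF _ _ _ runs_Skip]]
     runs_eq[OF runs_If_True[OF _ _ _ runs_pop[where x = "hd xs" and xs = "tl xs"]]]; auto)+

text \<open>The height of tape 35 after \<open>i\<close> rows when row 0 has index \<open>a\<close>;
  truncated subtraction corresponds to the guarded pop.\<close>

definition cnt :: "nat \<Rightarrow> nat \<Rightarrow> nat" where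
  "cnt a i = (if i \<le> a then i else a - 2 * (i - a - 1))"

lemma decode_runs:
  assumes s: "s 34 = stk (concat (map (\<lambda>u. u @ [4]) us))" "s 35 = stk []" "s 36 = stk []"
    and us: "\<And>u. u \<in> set us \<Longrightarrow> u \<noteq> [] \<and> set u \<subseteq> {1, 2, 3}"
    and a: "a < length us" "\<And>i. i < length us \<Longrightarrow> hd (us ! i) = 2 \<longleftrightarrow> i = a"
    and B: "length (concat (map (\<lambda>u. u @ [4]) us)) \<le> B"
  shows "\<exists>s'. runs 30 decode s s' \<and>
     s' 0 = act (if a \<le> 2 * (length us - a - 1) then 2 else 1, 0) (s 0)"
proof -
  let ?c = "\<lambda>us. concat (map (\<lambda>u. u @ [4]) us)"
  let ?n = "length us"
  let ?f = "\<lambda>i. s(34 := stk (?c (drop i us)), 35 := stk (replicate (cnt a i) 1), 36 := stk (if i \<le> a then [] else [1]))"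
  have lus: "?n \<le> B" using B
  proof -
    have "length us \<le> length (?c us)" by (induction us) auto
    with B show ?thesis by simp
  qed
  have "runs (10 + 2) (WhileNE 34 decode_step) (?f 0) (?f ?n)"
  proof (rule runs_loop)
    fix i assume i: "i < ?n"
    have d: "drop i us = us ! i # drop (Suc i) us" using i by (simp add: Cons_nth_drop_Suc)
    have u: "us ! i \<noteq> []" "set (us ! i) \<subseteq> {1, 2, 3}" using us[OF nth_mem[OF i]] by auto
    obtain b bs where b: "us ! i = b # bs" using u(1) by (cases "us ! i") auto
    have bn: "b \<in> {1, 2, 3}" "set bs \<subseteq> {1, 2, 3}" using u(2) b by auto
    show "rd (?f i 34) \<noteq> 0" using bn by (auto simp: d b)
    have b2: "b = 2 \<longleftrightarrow> i = a" using a(2)[OF i] b by simp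
    let ?w = "?c (drop (Suc i) us)"
    let ?s1 = "s(34 := stk (us ! i @ 4 # ?w), 35 := stk (replicate (cnt a (Suc i)) 1), 36 := stk (if Suc i \<le> a then [] else [1]))"
    have tl2: "tl (tl (replicate n (1::nat))) = replicate (n - 2) 1" for n
      by (metis One_nat_def Suc_1 diff_Suc_eq_diff_pred diff_Suc_1' tl_replicate)
    have 1: "runs 6 (If 34 34 (\<lambda>x _. x = 2) (push 36 1) (If 36 36 (\<lambda>x _. x = 0) (push 35 1) (popg 35 ;; popg 35))) (?f i) ?s1"
    proof -
      consider "i < a" | "i = a" | "i > a" by linarith
      then show ?thesis
      proof cases
        case 1
        then show ?thesis using b2
          by (intro runs_eq[OF runs_If_False[OF _ _ _ runs_If_True[OF _ _ _ runs_push[where xs = "replicate (cnt a i) 1"]]]])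
            (auto simp: d b cnt_def fun_eq_iff)
      next
        case 2
        then have "b = 2" "cnt a i = i" "cnt a (Suc i) = i" "i \<le> a" "\<not> Suc i \<le> a" using b2 by (auto simp: cnt_def)
        then show ?thesis
          by (intro runs_eq[OF runs_If_True[OF _ _ _ runs_push[where xs = "[]"]]]) (auto simp: d b fun_eq_iff)
      next
        case 3
        then have c: "cnt a (Suc i) = cnt a i - 2" by (auto simp: cnt_def)
        have "runs (1 + 1 + 1) (popg 35 ;; popg 35) (?f i)
           ((?f i)(35 := stk (tl (replicate (cnt a i) 1)), 35 := stk (tl (tl (replicate (cnt a i) 1)))))"
          by (rule runs_Seq; rule popg_runs) auto
        with 3 show ?thesis using b2
          by (intro runs_eq[OF runs_If_False[OF _ _ _ runs_If_False[OF _ _ _ \<open>runs (1 + 1 + 1) _ _ _\<close>]]])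
            (auto simp: d b c tl2 fun_eq_iff numeral_2_eq_2)
      qed
    qed
    let ?g = "\<lambda>j. ?s1(34 := stk (drop j (us ! i) @ 4 # ?w))"
    have lu: "length (us ! i) \<le> B"
    proof -
      have le: "length u \<le> length (?c us)" if "u \<in> set us" for u using that by (induction us) auto
      show ?thesis by (rule le_trans[OF le[OF nth_mem[OF i]] B])
    qed
    have "runs (0 + 2) (While 34 34 (\<lambda>x _. x \<noteq> 4) (pop 34)) (?g 0) (?g (length (us ! i)))"
    proof (rule runs_loop[where f = ?g])
      fix j assume j: "j < length (us ! i)"
      have dj: "drop j (us ! i) = us ! i ! j # drop (Suc j) (us ! i)" using j by (simp add: Cons_nth_drop_Suc)
      have "us ! i ! j \<in> {1, 2, 3}" using u(2) nth_mem[OF j] by blast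
      then show "rd (?g j 34) \<noteq> 4" by (auto simp: dj)
      show "runs 0 (pop 34) (?g j) (?g (Suc j))"
        by (rule runs_eq[OF runs_pop[where x = "us ! i ! j"]]) (auto simp: dj fun_eq_iff)
    qed (use lu in auto)
    then have "runs 2 (While 34 34 (\<lambda>x _. x \<noteq> 4) (pop 34)) (?g 0) (?s1(34 := stk (4 # ?w)))"
      by (rule runs_eq) auto
    moreover have "?g 0 = ?s1" by (auto simp: fun_eq_iff)
    ultimately have 2: "runs 2 (While 34 34 (\<lambda>x _. x \<noteq> 4) (pop 34)) ?s1 (?s1(34 := stk (4 # ?w)))"
      by (simp only:)
    have 3: "runs 0 (pop 34) (?s1(34 := stk (4 # ?w))) (?f (Suc i))"
      by (rule runs_eq[OF runs_pop[where x = 4 and xs = ?w]]) (auto simp: fun_eq_iff)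
    show "runs 10 decode_step (?f i) (?f (Suc i))" unfolding decode_step_def
      by (rule runs_weaken[OF runs_Seq[OF 1 runs_Seq[OF 2 3]]]) simp
  qed (use lus in auto)
  moreover have "?f 0 = s" using s by (auto simp: fun_eq_iff cnt_def)
  ultimately have 1: "runs 12 (WhileNE 34 decode_step) s (?f ?n)" by simp
  let ?b = "if a \<le> 2 * (?n - a - 1) then 2 else 1 :: nat"
  have cn: "cnt a ?n = a - 2 * (?n - a - 1)" using a by (simp add: cnt_def)
  have 2: "runs 1 (If 35 35 (\<lambda>x _. x = 0) (Prim 0 0 (\<lambda>_ _. (2, 0))) (Prim 0 0 (\<lambda>_ _. (1, 0)))) (?f ?n)
      ((?f ?n)(0 := act (?b, 0) (s 0)))"
  proof (cases "a \<le> 2 * (?n - a - 1)")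
    case True
    then show ?thesis
      by (intro runs_eq[OF runs_If_True[OF _ _ _ runs_Prim[OF _ _ refl]]]) (auto simp: cn fun_eq_iff)
  next
    case False
    then obtain m where "cnt a ?n = Suc m" by (metis cn diff_is_0_eq not0_implies_Suc)
    with False show ?thesis
      by (intro runs_eq[OF runs_If_False[OF _ _ _ runs_Prim[OF _ _ refl]]]) (auto simp: fun_eq_iff)
  qed
  show ?thesis unfolding decode_def
    by (rule exI, rule conjI, rule runs_weaken[OF runs_Seq[OF 1 2]]) auto
qed

end

section \<open>Simulation of the approximation algorithm\<close>

definition coupled :: "tm \<Rightarrow> config \<Rightarrow> store \<Rightarrow> nat list \<Rightarrow> bool" where
  "coupled M c s cs \<longleftrightarrow>
     (\<forall>i<num_tapes M. s (40 + i) = (head c i, tape c i)) \<and>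
     s 20 = (int (length cs) + 1, snd (stk cs)) \<and>
     head c 0 = sum_list (map (\<lambda>c. int c - 2) cs) \<and> set cs \<subseteq> {1, 2, 3} \<and>
     state c < num_states M \<and> (\<forall>i<num_tapes M. \<forall>z. tape c i z < num_symbols M)"

text \<open>During the simulation the head of the log rests one cell beyond the top of the stack, so
  that a single action, write and move right, appends a code.\<close>

lemma act_history: "act (c, 1) (int (length cs) + 1, snd (stk cs)) = (int (length (c # cs)) + 1, snd (stk (c # cs)))"
proof -
  have "length cs + 1 - nat z = Suc (length cs - nat z)" if "1 \<le> z" "z \<le> int (length cs)" for z
    using that by linarith
  then show ?thesis by (auto simp: act_def stk_def fun_eq_iff)
qed

text \<open>The bounds on state and symbols in \<open>coupled\<close> guarantee that the symbol test
  in \<open>nxt\<close> succeeds; the clause on the head of tape 0 says that the logged movements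
  sum up to its position.\<close>

lemma coupled_step:
  assumes wf: "wf_tm M" and k: "k = 40 + num_tapes M" and c: "coupled M c s cs" and q: "state c \<noteq> 1"
  shows "\<exists>s' code. cstep k (Call M (state c) 40 20, s) = (Call M (state (step M False c)) 40 20, s') \<and>
     coupled M (step M False c) s' (code # cs) \<and> (\<forall>i<40. i \<noteq> 20 \<longrightarrow> s' i = s i)"
proof -
  let ?xs = "map (\<lambda>i. rd (s i)) [0..<k]"
  let ?ys = "map (\<lambda>i. tape c i (head c i)) [0..<num_tapes M]"
  have ys: "drop 40 ?xs = ?ys"
    using c k by (auto simp: list_eq_iff_nth_eq coupled_def rd_def)
  obtain q' as where t: "trans M False (state c) ?ys = (q', as)" by force
  have sub: "set ?ys \<subseteq> {..<num_symbols M}" using c by (auto simp: coupled_def)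
  have as: "q' < num_states M" "length as = num_tapes M" "set as \<subseteq> {..<num_symbols M} \<times> {-1, 0, 1}"
    using trans_wf[OF wf _ _ sub t] c by (simp_all add: coupled_def)
  have n1: "num_tapes M \<ge> 1" using wf by (simp add: wf_tm_def)
  then have "as ! 0 \<in> set as" using as(2) by (intro nth_mem) simp
  then have m: "snd (as ! 0) \<in> {-1, 0, 1}" using as(3) by auto
  have fs: "fst (as ! i) < num_symbols M" if "i < num_tapes M" for i
    using as(3) nth_mem[of i as] that as(2) by fastforce
  define code where "code = nat (2 + snd (as ! 0))"
  have code: "code \<in> {1, 2, 3}" "int code - 2 = snd (as ! 0)" using m by (auto simp: code_def)
  define s' where "s' i = (if i = 20 then act (code, 1) (s 20) else if i < 40 then s i
     else if i < k then act (as ! (i - 40)) (s i) else s i)" for i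
  have st: "step M False c = \<lparr>state = q', head = (\<lambda>i. if i < num_tapes M then head c i + snd (as ! i) else head c i),
         tape = (\<lambda>i. if i < num_tapes M then (tape c i)(head c i := fst (as ! i)) else tape c i)\<rparr>"
    using q t by (simp add: step_def)
  have "nxt (Call M (state c) 40 20) ?xs = (Call M q' 40 20, (take 40 (noop ?xs) @ as)[20 := (code, 1)])"
    using q sub t by (simp add: ys code_def)
  then have "cstep k (Call M (state c) 40 20, s) = (Call M q' 40 20, s')"
    using as(2) k by (auto simp: cstep_def s'_def fun_eq_iff nth_list_update nth_append noop_def act_noop)
  moreover have "coupled M (step M False c) s' (code # cs)"
    unfolding coupled_def
  proof (intro conjI allI impI)
    fix i assume "i < num_tapes M"
    then show "s' (40 + i) = (head (step M False c) i, tape (step M False c) i)"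
      using c k by (auto simp: s'_def st act_def coupled_def)
  next
    show "s' 20 = (int (length (code # cs)) + 1, snd (stk (code # cs)))"
      using c act_history[of code cs] by (simp add: s'_def coupled_def)
  next
    show "head (step M False c) 0 = sum_list (map (\<lambda>c. int c - 2) (code # cs))"
      using c code n1 by (auto simp: st coupled_def)
  qed (use c code as fs in \<open>auto simp: st coupled_def\<close>)
  ultimately show ?thesis by (intro exI[of _ s'] exI[of _ code]) (auto simp: st s'_def)
qed

text \<open>The extra step leaves \<open>Call\<close> once the simulated machine has halted. If it
  halts early, the simulation ends early too.\<close>

lemma coupled_run:
  assumes wf: "wf_tm M" and k: "k = 40 + num_tapes M"
  shows "coupled M c s cs \<Longrightarrow> state ((step M False ^^ t) c) = 1 \<Longrightarrow>
     \<exists>t' s' cs'. t' \<le> t + 1 \<and> (cstep k ^^ t') (Call M (state c) 40 20, s) = (Skip, s') \<and>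
     coupled M ((step M False ^^ t) c) s' cs' \<and> (\<forall>i<40. i \<noteq> 20 \<longrightarrow> s' i = s i) \<and> length cs' \<le> length cs + t"
proof (induction t arbitrary: c s cs)
  have halt: "(cstep k ^^ 1) (Call M 1 40 20, s) = (Skip, s)" for s
    by (simp add: cstep_noop)
  {
    case 0
    then show ?case using halt[of s] by (intro exI[of _ 1] exI[of _ s] exI[of _ cs]) simp
  next
    case (Suc t)
    show ?case
    proof (cases "state c = 1")
      case True
      then have "step M False c = c" by (simp add: step_def)
      then have "(step M False ^^ Suc t) c = c" by (induction t) simp_all
      with True Suc.prems halt[of s] show ?thesis by (intro exI[of _ 1] exI[of _ s] exI[of _ cs]) (simp del: funpow.simps)
    next
      case False
      from coupled_step[OF wf k Suc.prems(1) False] obtain s1 code where s1: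
        "cstep k (Call M (state c) 40 20, s) = (Call M (state (step M False c)) 40 20, s1)"
        "coupled M (step M False c) s1 (code # cs)" "\<forall>i<40. i \<noteq> 20 \<longrightarrow> s1 i = s i" by blast
      have sw: "(step M False ^^ Suc t) c = (step M False ^^ t) (step M False c)"
        by (simp add: funpow_Suc_right del: funpow.simps)
      from Suc.IH[OF s1(2)] Suc.prems(2) obtain t' s' cs' where t': "t' \<le> t + 1"
        "(cstep k ^^ t') (Call M (state (step M False c)) 40 20, s1) = (Skip, s')"
        "coupled M ((step M False ^^ t) (step M False c)) s' cs'" "\<forall>i<40. i \<noteq> 20 \<longrightarrow> s' i = s1 i"
        "length cs' \<le> length (code # cs) + t"
        unfolding sw by blast
      have "(cstep k ^^ Suc t') (Call M (state c) 40 20, s) = (Skip, s')"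
        using s1(1) t'(2) by (simp add: funpow_Suc_right del: funpow.simps)
      with t' s1(3) show ?thesis unfolding sw
        by (intro exI[of _ "Suc t'"] exI[of _ s'] exI[of _ cs']) auto
    qed
  }
qed

text \<open>The moves on tape 20 convert between the convention of the log, head beyond the top, and
  that of a stack, head on the top.\<close>

definition "call M = right 20 ;; Call M 0 40 20 ;; left 20"

context tapes
begin

lemma call_runs:
  assumes wf: "wf_tm M" and det: "deterministic M" and k': "k = 40 + num_tapes M"
    and comp: "computes_within M w t v" and w: "set w \<subseteq> {..<5}" and t: "t < B"
    and s: "s 20 = stk []" "s 40 = rtape w 0" "\<And>i. 40 < i \<Longrightarrow> i < k \<Longrightarrow> s i = rtape [] 0"
  shows "\<exists>s' cs T. runs 5 (call M) s s' \<and> (\<forall>i<40. i \<noteq> 20 \<longrightarrow> s' i = s i) \<and>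
    s' 20 = stk cs \<and> length cs \<le> t \<and> set cs \<subseteq> {1, 2, 3} \<and>
    s' 40 = (sum_list (map (\<lambda>c. int c - 2) cs), T) \<and>
    (\<forall>i<length v. T (int i) = v ! i) \<and> T (int (length v)) = 0"
proof -
  have n: "num_tapes M \<ge> 1" "num_states M \<ge> 2" "num_symbols M \<ge> 5" using wf by (simp_all add: wf_tm_def)
  \<comment> \<open>A deterministic machine behaves alike under both coins, so the
    all-\<open>False\<close> run represents every run.\<close>
  have st: "step M b = step M False" for b
    using det by (cases b) (auto simp: deterministic_def step_def fun_eq_iff)
  have fold: "fold (step M) (replicate t b) c = (step M False ^^ t) c" for b c t
    by (induction t arbitrary: c) (simp_all add: st[of b] funpow_swap1)
  have h: "halts_with ((step M False ^^ t) (init_config w)) v"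
    using comp fold[of t False "init_config w"] unfolding computes_within_def run_def
    by (metis length_replicate)
  let ?s1 = "s(20 := (1, snd (stk [])))"
  have c: "coupled M (init_config w) ?s1 []"
    unfolding coupled_def
  proof (intro conjI allI impI)
    fix i assume "i < num_tapes M"
    then show "?s1 (40 + i) = (head (init_config w) i, tape (init_config w) i)"
      using s(2) s(3)[of "40 + i"] k' by (cases "i = 0") (auto simp: init_config_def rtape_def fun_eq_iff)
  next
    fix i z
    have "w ! nat z < 5" if "0 \<le> z" "z < int (length w)"
    proof -
      have "nat z < length w" using that by simp
      from nth_mem[OF this] w show ?thesis by auto
    qed
    then show "tape (init_config w) i z < num_symbols M"
      using n by (auto simp: init_config_def intro: less_le_trans)
  qed (use n in \<open>simp_all add: init_config_def\<close>)
  have "state ((step M False ^^ t) (init_config w)) = 1" using h by (simp add: halts_with_def)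
  from coupled_run[OF wf k' c this] obtain t' s' cs where t': "t' \<le> t + 1"
    "(cstep k ^^ t') (Call M 0 40 20, ?s1) = (Skip, s')" "coupled M ((step M False ^^ t) (init_config w)) s' cs"
    "\<forall>i<40. i \<noteq> 20 \<longrightarrow> s' i = ?s1 i" "length cs \<le> t"
    by (auto simp: init_config_def)
  have 1: "runs 1 (Call M 0 40 20) ?s1 s'"
    unfolding runs_def using t'(1,2) t by (intro exI[of _ t']) simp
  let ?T = "snd (s' 40)"
  have s'0: "s' 40 = (head ((step M False ^^ t) (init_config w)) 0, tape ((step M False ^^ t) (init_config w)) 0)"
    using t'(3) n(1) unfolding coupled_def by (metis add_0_right less_eq_Suc_le One_nat_def)
  have 2: "runs 0 (right 20) s ?s1"
    by (rule runs_eq[OF runs_right]) (use s in \<open>auto simp: stk_def\<close>)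
  have 3: "runs 0 (left 20) s' (s'(20 := stk cs))"
    by (rule runs_eq[OF runs_left]) (use t'(3) in \<open>auto simp: coupled_def stk_def\<close>)
  have "runs 5 (call M) s (s'(20 := stk cs))" unfolding call_def
    by (rule runs_weaken[OF runs_Seq[OF 2 runs_Seq[OF 1 3]]]) simp
  then show ?thesis using t' s'0 h
    by (intro exI[of _ "s'(20 := stk cs)"] exI[of _ cs] exI[of _ ?T]) (auto simp: coupled_def halts_with_def)
qed

end

section \<open>The complete program and its run\<close>

definition prog :: "tm \<Rightarrow> nat \<Rightarrow> nat \<Rightarrow> com" where
  "prog M h c = read_in ;; copy_in ;; pushes 10 c ;; lit_rows ;; power_prog h ;; dummies ;; count_rows ;;
     emit_rows ;; load ;; call M ;; undo ;; read_out ;; decode"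

definition patterns :: "tok list \<Rightarrow> nat list list" where
  "patterns ts = concat (rev (map (rowsT ts) [0..<length ts]))"

text \<open>The first component is the symbol that terminates the row on the tape; 5 distinguishes row 0.\<close>

definition all_rows :: "tok list \<Rightarrow> nat \<Rightarrow> (nat \<times> nat list) list" where
  "all_rows ts N = (5, replicate (width ts) 1) # replicate N (4, replicate (width ts) 1) @ map (Pair 4) (patterns ts)"

definition out_text :: "tok list \<Rightarrow> nat \<Rightarrow> nat list" where
  "out_text ts N = concat (rev (map (\<lambda>j. rowtext N (length (all_rows ts N)) j (all_rows ts N ! j))
     [0..<length (all_rows ts N)]))"

lemma wfc_put: "wfc k m (put r f r') \<longleftrightarrow> r < k \<and> r' < k \<and> (0 < m \<longrightarrow> (\<forall>x<m. f x < m))"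
  by (auto simp: put_def)

lemma wfc_push: "wfc k m (push r a) \<longleftrightarrow> r < k \<and> (0 < m \<longrightarrow> a < m)"
  by (auto simp: push_def wfc_put)

lemma wfc_pop: "0 < m \<Longrightarrow> wfc k m (pop r) \<longleftrightarrow> r < k"
  by (auto simp: pop_def)

lemma wfc_move: "0 < m \<Longrightarrow> wfc k m (move r r') \<longleftrightarrow> r < k \<and> r' < k"
  by (auto simp: move_def wfc_put wfc_pop)

lemma wfc_foreach: "0 < m \<Longrightarrow> wfc k m (foreach r r' c) \<longleftrightarrow> r < k \<and> r' < k \<and> wfc k m c"
  by (auto simp: foreach_def wfc_put wfc_pop wfc_move)

lemma wfc_clear: "0 < m \<Longrightarrow> wfc k m (clear r) \<longleftrightarrow> r < k"
  by (auto simp: clear_def wfc_pop)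

lemma wfc_right: "0 < m \<Longrightarrow> wfc k m (right r) \<longleftrightarrow> r < k"
  by (auto simp: right_def)

lemma wfc_left: "0 < m \<Longrightarrow> wfc k m (left r) \<longleftrightarrow> r < k"
  by (auto simp: left_def)

lemma wfc_pushes: "10 < k \<Longrightarrow> 6 \<le> m \<Longrightarrow> wfc k m (pushes 10 n)"
  by (induction n) (auto simp: wfc_push)

lemma wfc_power: "40 < k \<Longrightarrow> 6 \<le> m \<Longrightarrow> wfc k m (power_prog h)"
  by (induction h) (auto simp: wfc_push mul_def wfc_foreach wfc_clear wfc_move)

text \<open>The program uses the symbols 0 to 5, the last as terminator of row 0, hence an alphabet
  of at least 6 symbols; the called machine is placed on the tapes from 40 on.\<close>

lemma wfc_prog:
  assumes M: "wf_tm M"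
  shows "wfc (40 + num_tapes M) (max 6 (num_symbols M)) (prog M h c)"
proof -
  define k m where km: "k = 40 + num_tapes M" "m = max 6 (num_symbols M)"
  have k: "40 < k" and m: "0 < m" "6 \<le> m" using M by (auto simp: km wf_tm_def)
  note defs = wfc_put wfc_push wfc_pop[OF m(1)] wfc_move[OF m(1)] wfc_foreach[OF m(1)] wfc_clear[OF m(1)]
    wfc_right[OF m(1)] wfc_left[OF m(1)]
  have "0 < num_states M" using M by (simp add: wf_tm_def)
  then have "wfc k m (Call M 0 40 20)" using M by (simp add: km)
  then have "wfc k m (call M)" using k by (simp add: call_def defs)
  moreover have "wfc k m read_in" "wfc k m copy_in" "wfc k m dummies" "wfc k m count_rows" "wfc k m load"
     "wfc k m undo" "wfc k m read_out" "wfc k m decode" "wfc k m emit_rows"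
    using k m
    by (simp_all add: read_in_def copy_in_def dummies_def count_rows_def load_def undo_def read_out_def
      decode_def decode_step_def popg_def emit_rows_def emit_row_def mk_cols_def tail_def base_bit_def emit_col_def defs)
  moreover have "wfc k m lit_rows"
    using k m by (simp add: lit_rows_def rowA_def rowBS_def cmp_lit_def cmp_step_def defs)
  ultimately have "wfc k m (prog M h c)"
    using k m wfc_pushes[of k m c] wfc_power[of k m h] by (simp add: prog_def)
  then show ?thesis by (simp add: km)
qed

lemma tb_etoks: "set (tb a (etoks ts)) \<subseteq> {1, a} \<and> length (tb a (etoks ts)) = width ts"
proof (induction ts arbitrary: a)
  case (Cons t ts)
  have l: "tb a (lstr l @ ys) = tb a ys" for l ys
  proof -
    have "tb a (xs @ ys) = tb a ys" if "set xs \<subseteq> {1, 2}" for xs using that by (induction xs) auto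
    then show ?thesis using lstr_bits by blast
  qed
  show ?case
  proof (cases t)
    case None
    then show ?thesis using Cons[of 1] by (auto simp: etok_def width_def)
  next
    case (Some x)
    then show ?thesis using Cons[of a] by (auto simp: etok_def width_def l)
  qed
qed (simp add: width_def)

lemma bitsA_pattern: "set (concat (map (bitsA l) ts)) \<subseteq> {1, 2} \<and> length (concat (map (bitsA l) ts)) = width ts"
  by (induction ts) (auto simp: bitsA_def width_def split: option.splits)

lemma patterns_wf:
  assumes "p \<in> set (patterns ts)"
  shows "set p \<subseteq> {1, 2} \<and> length p = width ts"
proof -
  from assms obtain i where i: "i < length ts" "p \<in> set (rowsT ts i)" by (auto simp: patterns_def)
  then obtain l where l: "ts ! i = Some l" by (cases "ts ! i") (auto simp: rowsT_def)
  have "width ts = width (take i ts @ ts ! i # drop (Suc i) ts)"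
    by (simp add: id_take_nth_drop[OF i(1), symmetric])
  then have "width ts = width (take i ts) + 2 + width (drop (Suc i) ts)" by (simp add: width_def l)
  moreover have "p = replicate (width (take i ts)) 1 @ [1, 2] @ tb 1 (etoks (drop (Suc i) ts)) \<or>
      p = replicate (width (take i ts)) 1 @ [1, 2] @ tb 2 (etoks (drop (Suc i) ts)) \<or>
      p = concat (map (bitsA l) ts)"
    using i(2) by (simp add: rowsT_def l)
  ultimately show ?thesis
    using tb_etoks[of 1 "drop (Suc i) ts"] tb_etoks[of 2 "drop (Suc i) ts"]
  proof (elim disjE)
    assume "p = concat (map (bitsA l) ts)"
    then show ?thesis using bitsA_pattern[of l ts] by (simp only:)
  qed auto
qed

lemma all_rows_wf:
  "(x, p) \<in> set (all_rows ts N) \<Longrightarrow> 4 \<le> x \<and> x \<le> 5 \<and> set p \<subseteq> {1, 2} \<and> length p = width ts"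
  using patterns_wf[of p ts] by (auto simp: all_rows_def)

lemma ftext_nz: "0 \<notin> set (ftext (all_rows ts N))"
proof
  assume "0 \<in> set (ftext (all_rows ts N))"
  then obtain x p where "(x, p) \<in> set (all_rows ts N)" "0 \<in> set (rev p @ [x])" by (auto simp: ftext_def)
  with all_rows_wf[OF this(1)] show False by auto
qed

lemma ftext_Cons: "ftext ((x, p) # rs) = rev p @ x # ftext rs"
  by (simp add: ftext_def)

lemma filter_ftext:
  assumes "\<And>x p. (x, p) \<in> set rs \<Longrightarrow> x = 4 \<and> set p \<subseteq> {1, 2}"
  shows "filter (\<lambda>x. x = 4) (ftext rs) = replicate (length rs) 4"
  using assms
proof (induction rs)
  case (Cons r rs)
  obtain x p where r: "r = (x, p)" by force
  have "x = 4" "set p \<subseteq> {1, 2}" using Cons.prems[of x p] r by auto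
  moreover from this(2) have "filter (\<lambda>x. x = 4) (rev p) = []" by (auto simp: filter_empty_conv)
  moreover have "filter (\<lambda>x. x = 4) (ftext rs) = replicate (length rs) 4"
    by (rule Cons.IH) (rule Cons.prems, simp)
  ultimately show ?case unfolding r ftext_Cons by (simp del: rev_filter)
qed (simp add: ftext_def)

lemma count_ftext: "length (filter (\<lambda>x. x = 4) (ftext (all_rows ts N))) = length (all_rows ts N) - 1"
proof -
  let ?rs = "replicate N (4 :: nat, replicate (width ts) 1) @ map (Pair 4) (patterns ts)"
  have "filter (\<lambda>x. x = 4) (ftext ?rs) = replicate (length ?rs) 4"
    by (rule filter_ftext) (use patterns_wf in auto)
  then show ?thesis unfolding all_rows_def ftext_Cons by simp
qed

lemma tailw_syms: "set (tailw j n) \<subseteq> {1, 2, 3}"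
  by (auto simp: tailw_def)

lemma rowtext_syms:
  assumes "set (snd xp) \<subseteq> {1, 2}"
  shows "set (rowtext N n j xp) \<subseteq> {1, 2, 3, 4}"
proof
  have t: "\<And>e. e \<in> set (tailw j n) \<Longrightarrow> e = 1 \<or> e = 2 \<or> e = 3" using tailw_syms[of j n] by auto
  have c: "set (cols N n j (snd xp)) \<subseteq> {1, 2}" using assms by (auto simp: cols_def)
  fix x assume "x \<in> set (rowtext N n j xp)"
  then consider e where "e \<in> set (cols N n j (snd xp))" "x \<in> set (colw (fst xp) j n e)"
    | "x = 1 \<or> x = 2 \<or> x = 4" | "x \<in> set (tailw j n)"
    unfolding rowtext_def by (auto split: if_splits)
  then show "x \<in> {1, 2, 3, 4}"
  proof cases
    case 1
    from subsetD[OF c 1(1)] 1(2) show ?thesis by (auto simp: colw_def dest: t split: if_splits)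
  qed (use t in auto)
qed

lemma out_text_syms: "set (out_text ts N) \<subseteq> {1, 2, 3, 4}"
proof
  fix x assume "x \<in> set (out_text ts N)"
  then obtain j where j: "j < length (all_rows ts N)"
    "x \<in> set (rowtext N (length (all_rows ts N)) j (all_rows ts N ! j))"
    by (auto simp: out_text_def)
  have "set (snd (all_rows ts N ! j)) \<subseteq> {1, 2}"
    using all_rows_wf[of "fst (all_rows ts N ! j)" "snd (all_rows ts N ! j)" ts N] nth_mem[OF j(1)] by simp
  from subsetD[OF rowtext_syms[OF this] j(2)] show "x \<in> {1, 2, 3, 4}" .
qed

lemma rtape_Nil: "rtape [] 0 = stk []"
  by (auto simp: rtape_def stk_def fun_eq_iff)

context tapes
begin

text \<open>The exponent of the time bound depends only on the constants \<open>c\<close> and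
  \<open>h\<close>. The formula enters through \<open>B\<close> alone, which has to dominate all
  intermediate lengths and the running time \<open>t\<close> of the called machine.\<close>

lemma prog_runs:
  fixes ts :: "tok list" and h c :: nat
  defines "w \<equiv> etoks ts" and "N \<equiv> (2 * length (etoks ts) + c) ^ h"
  assumes wf: "wf_tm M" "deterministic M" "k = 40 + num_tapes M" and c: "1 \<le> c"
    and comp: "computes_within M (out_text ts N) t (concat (map (\<lambda>u. u @ [4]) us))"
    and us: "\<And>u. u \<in> set us \<Longrightarrow> u \<noteq> [] \<and> set u \<subseteq> {1, 2, 3}"
    and a: "a < length us" "\<And>i. i < length us \<Longrightarrow> hd (us ! i) = 2 \<longleftrightarrow> i = a"
    and B: "2 * length w + c \<le> B" "N \<le> B" "length (ftext (all_rows ts N)) \<le> B"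
      "N * width ts + 2 * length (all_rows ts N) + 1 \<le> B" "length (out_text ts N) \<le> B" "t < B"
      "length (concat (map (\<lambda>u. u @ [4]) us)) \<le> B"
    and s: "s 0 = rtape w 0" "\<And>i. 0 < i \<Longrightarrow> s i = rtape [] 0"
  shows "\<exists>s'. runs (2 * c + 41 * h + 2000) (prog M h c) s s' \<and>
     s' 0 = act (if a \<le> 2 * (length us - a - 1) then 2 else 1, 0) (rtape [] 0)"
proof -
  let ?n = "length (all_rows ts N)" and ?v = "concat (map (\<lambda>u. u @ [4]) us)"
  have k40: "40 < k" using wf(1,3) by (simp add: wf_tm_def)
  have s0: "s i = stk []" if "0 < i" for i using s(2)[OF that] by (simp add: rtape_Nil)
  have lw: "length w \<le> B" "length (etoks ts) \<le> B" "width ts \<le> B" using B(1) width_le[of ts] by (simp_all add: w_def)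
  have wz: "0 \<notin> set w" using etoks_nz by (simp add: w_def)
  let ?K = "2 * length (etoks ts) + c"
  let ?s1 = "s(0 := rtape [] 0, 28 := stk (rev w))"
  have rw: "\<And>x p. (x, p) \<in> set (all_rows ts N) \<Longrightarrow> 4 \<le> x \<and> set p \<subseteq> {1, 2} \<and> length p = width ts"
    using all_rows_wf by blast
  have 1: "runs 20 read_in s ?s1" by (rule read_in_runs) (use s(1) s0 lw wz in auto)
  let ?s2 = "?s1(1 := stk (etoks ts), 3 := stk (etoks ts),
    10 := stk (replicate (2 * length (etoks ts)) 1), 24 := stk (replicate (width ts) 1))"
  have 2: "runs 40 copy_in ?s1 ?s2" by (rule copy_in_runs) (use s0 lw w_def in auto)
  let ?s3 = "?s2(10 := stk (replicate ?K 1))"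
  have 3: "runs (2 * c) (pushes 10 c) ?s2 ?s3"
    by (rule runs_eq[OF pushes_runs]) (auto simp: fun_eq_iff add.commute replicate_add)
  let ?s4 = "?s3(3 := stk [], 25 := stk (replicate (width ts) 1), 9 := stk (rtext (patterns ts)))"
  have 4: "runs 300 lit_rows ?s3 ?s4" unfolding patterns_def by (rule lit_rows_runs) (use s0 lw in auto)
  let ?s5 = "?s4(12 := stk (replicate N 1))"
  have 5: "runs (41 * h + 1) (power_prog h) ?s4 ?s5" unfolding N_def
    by (rule pow_runs) (use s0 B c in \<open>auto simp: w_def N_def\<close>)
  let ?s6 = "?s5(9 := stk (ftext (all_rows ts N)))"
  have 6: "runs 60 dummies ?s5 ?s6" unfolding all_rows_def
    by (rule dummies_runs) (use s0 B lw in auto)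
  let ?s7 = "?s6(17 := stk (replicate (?n - 1) 1))"
  have 7: "runs 20 count_rows ?s6 ?s7"
    by (rule runs_eq[OF count_rows_runs]) (use s0 B ftext_nz[of ts N] count_ftext[of ts N] in auto)
  let ?s8 = "?s7(9 := stk [], 15 := stk (replicate ?n 1), 17 := stk [], 23 := stk (out_text ts N))"
  have 8: "runs 402 emit_rows ?s7 ?s8" unfolding out_text_def
    by (rule emit_rows_runs[where z = "width ts"], (rule rw; assumption | (use s0 B lw in \<open>simp; fail\<close>))+)
  let ?s9 = "?s8(23 := stk [], 40 := rtape (out_text ts N) 0)"
  have 9: "runs 20 load ?s8 ?s9"
    by (rule load_runs) (use s0 s(2)[of 40] B k40 out_text_syms[of ts N] in auto)
  have "\<exists>s' cs T. runs 5 (call M) ?s9 s' \<and> (\<forall>i<40. i \<noteq> 20 \<longrightarrow> s' i = ?s9 i) \<and>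
    s' 20 = stk cs \<and> length cs \<le> t \<and> set cs \<subseteq> {1, 2, 3} \<and>
    s' 40 = (sum_list (map (\<lambda>c. int c - 2) cs), T) \<and>
    (\<forall>i<length ?v. T (int i) = ?v ! i) \<and> T (int (length ?v)) = 0"
    by (rule call_runs[OF wf comp]) (use s0 B out_text_syms[of ts N] in \<open>auto simp: rtape_Nil\<close>)
  then obtain s' cs T where s': "runs 5 (call M) ?s9 s'" "\<And>i. i < 40 \<Longrightarrow> i \<noteq> 20 \<Longrightarrow> s' i = ?s9 i"
    "s' 20 = stk cs" "length cs \<le> t" "set cs \<subseteq> {1, 2, 3}"
    "s' 40 = (sum_list (map (\<lambda>c. int c - 2) cs), T)"
    "\<And>i. i < length ?v \<Longrightarrow> T (int i) = ?v ! i" "T (int (length ?v)) = 0" by blast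
  let ?s10 = "s'(20 := stk [], 40 := (0, T))"
  have 10: "runs 10 undo s' ?s10" by (rule undo_runs[OF s'(3,6,5) _ k40]) (use s'(4) B(6) in simp)
  let ?s11 = "?s10(34 := stk ?v, 40 := (int (length ?v), T))"
  have vz: "0 \<notin> set ?v"
  proof
    assume "0 \<in> set ?v"
    then obtain u where "u \<in> set us" "0 \<in> set u" by (auto split: if_splits)
    with us[OF this(1)] show False by auto
  qed
  have 11: "runs 10 read_out ?s10 ?s11"
    by (rule read_out_runs[OF _ _ _ vz B(7) s'(7,8) k40]) (use s'(2) s0 in auto)
  have "\<exists>s12. runs 30 decode ?s11 s12 \<and>
     s12 0 = act (if a \<le> 2 * (length us - a - 1) then 2 else 1, 0) (?s11 0)"
    by (rule decode_runs[OF _ _ _ us a B(7)]) (use s'(2) s0 in auto)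
  then obtain s12 where
    12: "runs 30 decode ?s11 s12" "s12 0 = act (if a \<le> 2 * (length us - a - 1) then 2 else 1, 0) (?s11 0)"
    by blast
  have "?s11 0 = rtape [] 0" using s'(2)[of 0] by simp
  moreover have "runs (2 * c + 41 * h + 2000) (prog M h c) s s12" unfolding prog_def
    by (rule runs_weaken[OF runs_Seq[OF 1 runs_Seq[OF 2 runs_Seq[OF 3 runs_Seq[OF 4 runs_Seq[OF 5 runs_Seq[OF 6
      runs_Seq[OF 7 runs_Seq[OF 8 runs_Seq[OF 9 runs_Seq[OF s'(1) runs_Seq[OF 10 runs_Seq[OF 11 12(1)]]]]]]]]]]]]]) simp
  ultimately show ?thesis using 12(2) by (intro exI[of _ s12]) simp
qed

end

section \<open>Exact covers\<close>

definition toks :: "cnf \<Rightarrow> tok list" where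
  "toks \<phi> = concat (map (\<lambda>C. map Some C @ [None]) \<phi>)"

lemma enc_cnf_toks: "enc_cnf \<phi> = etoks (toks \<phi>)"
proof -
  have "(\<lambda>(s, x). enc_bool s # enc_nat x @ [3]) = (\<lambda>l. etok (Some l))"
    by (auto simp: etok_def lstr_def)
  then have "concat (map (\<lambda>(s, x). enc_bool s # enc_nat x @ [3]) C) @ [4] = etoks (map Some C @ [None])" for C
    by (simp add: o_def etok_def)
  then show ?thesis by (induction \<phi>) (auto simp: enc_cnf_def toks_def)
qed

text \<open>Token \<open>k\<close> is the end of the clause in which token \<open>i\<close> lies.
  Positions replace clauses, since the rows of the exact cover refer to single occurrences of
  literals.\<close>

definition closes :: "tok list \<Rightarrow> nat \<Rightarrow> nat \<Rightarrow> bool" where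
  "closes ts i k \<longleftrightarrow> i < k \<and> ts ! k = None \<and> (\<forall>m. i < m \<and> m < k \<longrightarrow> ts ! m \<noteq> None)"

definition models :: "(nat \<Rightarrow> bool) \<Rightarrow> tok list \<Rightarrow> bool" where
  "models \<alpha> ts \<longleftrightarrow> (\<forall>k<length ts. ts ! k = None \<longrightarrow> (\<exists>i s x. closes ts i k \<and> ts ! i = Some (s, x) \<and> \<alpha> x = s))"

lemma models_Cons:
  "models \<alpha> (map Some C @ None # ts) \<longleftrightarrow> (\<exists>(s, x)\<in>set C. \<alpha> x = s) \<and> models \<alpha> ts"
proof -
  let ?us = "map Some C @ None # ts" and ?c = "length C"
  have nth: "?us ! k = (if k < ?c then Some (C ! k) else if k = ?c then None else ts ! (k - ?c - 1))" for k
    by (auto simp: nth_append nth_Cons')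
  have c: "closes ?us i ?c \<longleftrightarrow> i < ?c" for i
    unfolding closes_def nth by auto
  have sh: "closes ?us (?c + 1 + i) (?c + 1 + k) \<longleftrightarrow> closes ts i k" for i k
  proof -
    have "(\<forall>m. ?c + 1 + i < m \<and> m < ?c + 1 + k \<longrightarrow> ?us ! m \<noteq> None) \<longleftrightarrow> (\<forall>m. i < m \<and> m < k \<longrightarrow> ts ! m \<noteq> None)"
    proof (intro iffI allI impI)
      fix m assume "\<forall>m. ?c + 1 + i < m \<and> m < ?c + 1 + k \<longrightarrow> ?us ! m \<noteq> None" "i < m \<and> m < k"
      then have "?us ! (?c + 1 + m) \<noteq> None" by auto
      then show "ts ! m \<noteq> None" by (simp add: nth)
    next
      fix m assume a: "\<forall>m. i < m \<and> m < k \<longrightarrow> ts ! m \<noteq> None" "?c + 1 + i < m \<and> m < ?c + 1 + k"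
      then have "i < m - ?c - 1 \<and> m - ?c - 1 < k" by auto
      with a(1) have "ts ! (m - ?c - 1) \<noteq> None" by blast
      then show "?us ! m \<noteq> None" using a(2) by (simp add: nth)
    qed
    then show ?thesis by (auto simp: closes_def nth)
  qed
  \<comment> \<open>A literal whose clause ends behind the separator cannot stand before it, because
    the separator at position \<open>?c\<close> would lie in between.\<close>
  have big: "\<exists>i'. i = ?c + 1 + i'" if "closes ?us i (?c + 1 + k)" "?us ! i = Some l" for i k l
  proof -
    have "i \<noteq> ?c" using that(2) by (auto simp: nth)
    moreover have "?us ! ?c = None" by (simp add: nth)
    moreover have "?us ! m \<noteq> None" if "i < m" "m < ?c + 1 + k" for m
      using \<open>closes ?us i (?c + 1 + k)\<close> that unfolding closes_def by blast
    ultimately have "\<not> i < ?c + 1" by (metis add_lessD1 less_add_one less_antisym Suc_eq_plus1 trans_less_add1)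
    then have "i = ?c + 1 + (i - ?c - 1)" by simp
    then show ?thesis by blast
  qed
  define Q where "Q us k \<longleftrightarrow> (\<exists>i s x. closes us i k \<and> us ! i = Some (s, x) \<and> \<alpha> x = s)" for us k
  have Q1: "Q ?us ?c \<longleftrightarrow> (\<exists>(s, x)\<in>set C. \<alpha> x = s)"
  proof
    assume "Q ?us ?c"
    then obtain i s x where "i < ?c" "?us ! i = Some (s, x)" "\<alpha> x = s" unfolding Q_def c by blast
    moreover from this(1,2) have "C ! i = (s, x)" by (simp add: nth)
    ultimately show "\<exists>(s, x)\<in>set C. \<alpha> x = s" using nth_mem[of i C] by auto
  next
    assume "\<exists>(s, x)\<in>set C. \<alpha> x = s"
    then obtain i s x where "i < ?c" "C ! i = (s, x)" "\<alpha> x = s" by (auto simp: in_set_conv_nth)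
    moreover from this(1,2) have "?us ! i = Some (s, x)" by (simp add: nth)
    ultimately show "Q ?us ?c" unfolding Q_def c by blast
  qed
  have Q2: "Q ?us (?c + 1 + k) \<longleftrightarrow> Q ts k" for k
  proof
    assume "Q ?us (?c + 1 + k)"
    then obtain i s x where i: "closes ?us i (?c + 1 + k)" "?us ! i = Some (s, x)" "\<alpha> x = s" by (auto simp: Q_def)
    from big[OF i(1,2)] obtain i' where i': "i = ?c + 1 + i'" by blast
    have "closes ts i' k" using i(1) unfolding i' sh .
    moreover have "ts ! i' = Some (s, x)" using i(2) by (simp add: i' nth)
    ultimately show "Q ts k" using i(3) by (auto simp: Q_def)
  next
    assume "Q ts k"
    then obtain i s x where i: "closes ts i k" "ts ! i = Some (s, x)" "\<alpha> x = s" by (auto simp: Q_def)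
    have "closes ?us (?c + 1 + i) (?c + 1 + k)" using i(1) unfolding sh .
    moreover have "?us ! (?c + 1 + i) = Some (s, x)" using i(2) by (simp add: nth)
    ultimately show "Q ?us (?c + 1 + k)" using i(3) unfolding Q_def by blast
  qed
  have m: "models \<alpha> us \<longleftrightarrow> (\<forall>k<length us. us ! k = None \<longrightarrow> Q us k)" for us by (simp add: models_def Q_def)
  show ?thesis
  proof
    assume l: "models \<alpha> ?us"
    have "Q ?us ?c" using l unfolding m by (simp add: nth)
    moreover have "Q ts k" if "k < length ts" "ts ! k = None" for k
      using l that unfolding m Q2[symmetric, of k] by (auto simp: nth)
    ultimately show "(\<exists>(s, x)\<in>set C. \<alpha> x = s) \<and> models \<alpha> ts" unfolding Q1 m by blast
  next
    assume r: "(\<exists>(s, x)\<in>set C. \<alpha> x = s) \<and> models \<alpha> ts"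
    show "models \<alpha> ?us" unfolding m
    proof (intro allI impI)
      fix k assume k: "k < length ?us" "?us ! k = None"
      then have "\<not> k < ?c" by (auto simp: nth)
      then have "k = ?c \<or> k = ?c + 1 + (k - ?c - 1)" by auto
      then consider "k = ?c" | k' where "k = ?c + 1 + k'" by blast
      then show "Q ?us k"
      proof cases
        case 1
        then show ?thesis using r Q1 by simp
      next
        case (2 k')
        then have "k' < length ts" "ts ! k' = None" using k by (auto simp: nth)
        then have "Q ts k'" using r unfolding m by blast
        then show ?thesis unfolding 2 Q2 .
      qed
    qed
  qed
qed

lemma satisfiable_models: "satisfiable \<phi> \<longleftrightarrow> (\<exists>\<alpha>. models \<alpha> (toks \<phi>))"
proof -
  have "models \<alpha> (toks \<phi>) \<longleftrightarrow> (\<forall>C\<in>set \<phi>. \<exists>(s, x)\<in>set C. \<alpha> x = s)" for \<alpha>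
  proof (induction \<phi>)
    case (Cons C \<phi>)
    have "toks (C # \<phi>) = map Some C @ None # toks \<phi>" by (simp add: toks_def)
    with Cons show ?case by (simp add: models_Cons)
  qed (simp add: toks_def models_def)
  then show ?thesis by (simp add: satisfiable_def)
qed

text \<open>Rows of the exact cover instance: \<open>(i, 2)\<close> makes literal \<open>i\<close> true, \<open>(i, 1)\<close> uses literal \<open>i\<close>
  as the witness of its clause, and \<open>(i, 0)\<close> is the slack of literal \<open>i\<close>.\<close>

definition row_ids :: "tok list \<Rightarrow> (nat \<times> nat) set" where
  "row_ids ts = {(i, r). i < length ts \<and> ts ! i \<noteq> None \<and> r < 3}"

text \<open>Column \<open>(k, 0)\<close> of an occurrence forces exactly one truth row for its
  variable. Column \<open>(k, 1)\<close> is taken by that row if the occurrence is false; otherwise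
  its slack or witness row must take it. The column of a clause end forces exactly one witness,
  which is thus a true literal.\<close>

fun covers :: "tok list \<Rightarrow> nat \<times> nat \<Rightarrow> nat \<Rightarrow> nat \<Rightarrow> bool" where
  "covers ts (i, r) k b = (if r = 2 then
       (\<exists>s x s' x'. ts ! i = Some (s, x) \<and> ts ! k = Some (s', x') \<and> x = x' \<and> (b = 0 \<or> s \<noteq> s'))
     else (ts ! k \<noteq> None \<and> k = i \<and> b = 1) \<or> (r = 1 \<and> closes ts i k))"

definition exact_cover :: "tok list \<Rightarrow> (nat \<times> nat) set \<Rightarrow> bool" where
  "exact_cover ts T \<longleftrightarrow> T \<subseteq> row_ids ts \<and>
     (\<forall>k<length ts. \<forall>b<tw (ts ! k). \<exists>!x. x \<in> T \<and> covers ts x k b)"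

text \<open>The row covering the column of a clause end is a witness row \<open>(i, 1)\<close>, and
  the truth row covering \<open>(i, 0)\<close> decides its variable. The truth value is read off
  from the chosen truth rows.\<close>

lemma cover_imp_models:
  assumes T: "exact_cover ts T"
  shows "models (\<lambda>x. \<exists>i. (i, 2) \<in> T \<and> ts ! i = Some (True, x)) ts"
  unfolding models_def
proof (intro allI impI)
  fix k assume k: "k < length ts" "ts ! k = None"
  have ex: "\<exists>!x. x \<in> T \<and> covers ts x k b" if "k < length ts" "b < tw (ts ! k)" for k b
    using T that by (simp add: exact_cover_def)
  have uniq: "y = y'" if "k < length ts" "b < tw (ts ! k)" "y \<in> T" "covers ts y k b" "y' \<in> T" "covers ts y' k b"
    for k b y y'
    using ex[OF that(1,2)] that(3-) by blast
  from ex[OF k(1), of 0] k obtain y where y: "y \<in> T" "covers ts y k 0" by auto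
  obtain i r where ir: "y = (i, r)" by force
  have r: "r = 1" "closes ts i k" using y(2) k(2) by (auto simp: ir split: if_splits)
  have i: "i < length ts" "(i, 1) \<in> T" "ts ! i \<noteq> None" using y(1) T by (auto simp: ir r exact_cover_def row_ids_def)
  then obtain s x where sx: "ts ! i = Some (s, x)" by auto
  have tw: "tw (ts ! i) = 2" by (simp add: sx)
  from ex[OF i(1), of 0] tw obtain z where z: "z \<in> T" "covers ts z i 0" by auto
  obtain j r' where jr: "z = (j, r')" by force
  have j: "r' = 2" "\<exists>s'. ts ! j = Some (s', x)" using z(2) by (auto simp: jr sx closes_def split: if_splits)
  then obtain s' where s': "ts ! j = Some (s', x)" by blast
  \<comment> \<open>With the opposite sign the truth row would also cover column
    \<open>(i, 1)\<close>, which the witness row covers already.\<close>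
  have "s' = s"
  proof (rule ccontr)
    assume "s' \<noteq> s"
    then have c1: "covers ts (j, 2) i 1" using s' sx by auto
    have c2: "covers ts (i, 1) i 1" using sx by simp
    have zT: "(j, 2) \<in> T" using z(1) by (simp add: jr j)
    have "(j, 2) = (i, 1 :: nat)" by (rule uniq[OF i(1) _ zT c1 i(2) c2]) (simp add: tw)
    then show False by simp
  qed
  have "(\<exists>i. (i, 2) \<in> T \<and> ts ! i = Some (True, x)) = s"
  proof (cases s)
    case True
    then show ?thesis using s' z(1) \<open>s' = s\<close> by (auto simp: jr j)
  next
    case False
    have "j' = j" if "(j', 2) \<in> T" "ts ! j' = Some (True, x)" for j'
    proof -
      have c: "covers ts (j', 2) i 0" using that sx by auto
      have "(j', 2) = z" by (rule uniq[OF i(1) _ that(1) c z]) (simp add: tw)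
      then show ?thesis by (simp add: jr)
    qed
    then show ?thesis using False s' \<open>s' = s\<close> by auto
  qed
  then show "\<exists>i s x. closes ts i k \<and> ts ! i = Some (s, x) \<and> (\<exists>i. (i, 2) \<in> T \<and> ts ! i = Some (True, x)) = s"
    using r(2) sx by blast
qed

lemma closes_unique: "closes ts i k \<Longrightarrow> closes ts i k' \<Longrightarrow> k = k'"
  unfolding closes_def by (metis linorder_neqE_nat)

text \<open>The cover takes one truth row per variable, one witness row per clause, and slack rows
  for the true occurrences that are not witnesses.\<close>

lemma models_imp_cover:
  assumes m: "models \<alpha> ts"
  shows "\<exists>T. exact_cover ts T"
proof -
  \<comment> \<open>A truth row exists only for a literal that occurs. Where the literal true under
    \<open>\<alpha>\<close> does not occur, the value is flipped; no true literal is lost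
    thereby.\<close>
  define \<beta> where "\<beta> x = (if \<exists>i<length ts. ts ! i = Some (\<alpha> x, x) then \<alpha> x else \<not> \<alpha> x)" for x
  define rep where "rep x = (SOME i. i < length ts \<and> ts ! i = Some (\<beta> x, x))" for x
  have rep: "rep x < length ts \<and> ts ! rep x = Some (\<beta> x, x)" if "i < length ts" "ts ! i = Some (s, x)" for i s x
    unfolding rep_def
  proof (rule someI_ex)
    show "\<exists>i. i < length ts \<and> ts ! i = Some (\<beta> x, x)"
    proof (cases "\<exists>i<length ts. ts ! i = Some (\<alpha> x, x)")
      case True
      then show ?thesis by (auto simp: \<beta>_def)
    next
      case False
      then have "s = (\<not> \<alpha> x)" using that by (cases s; cases "\<alpha> x") auto
      then show ?thesis using that False by (auto simp: \<beta>_def)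
    qed
  qed
  have ex: "\<exists>i. closes ts i k \<and> (\<exists>x. ts ! i = Some (\<beta> x, x))" if k: "k < length ts" "ts ! k = None" for k
  proof -
    from m k obtain i s x where i: "closes ts i k" "ts ! i = Some (s, x)" "\<alpha> x = s" by (auto simp: models_def)
    then have "i < length ts" using k by (simp add: closes_def)
    then have "\<beta> x = \<alpha> x" using i by (auto simp: \<beta>_def)
    with i show ?thesis by auto
  qed
  define w where "w k = (SOME i. closes ts i k \<and> (\<exists>x. ts ! i = Some (\<beta> x, x)))" for k
  have w: "closes ts (w k) k \<and> (\<exists>x. ts ! w k = Some (\<beta> x, x))" if "k < length ts" "ts ! k = None" for k
    unfolding w_def by (rule someI_ex) (rule ex[OF that])
  define Ws where "Ws = w ` {k. k < length ts \<and> ts ! k = None}"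
  define T :: "(nat \<times> nat) set" where "T = {(i, 2) |i. i < length ts \<and> (\<exists>x. ts ! i = Some (\<beta> x, x) \<and> i = rep x)} \<union> {(i, 1) |i. i \<in> Ws}
     \<union> {(i, 0) |i. i < length ts \<and> i \<notin> Ws \<and> (\<exists>x. ts ! i = Some (\<beta> x, x))}"
  have Ws: "i < length ts \<and> (\<exists>x. ts ! i = Some (\<beta> x, x))" if "i \<in> Ws" for i
  proof -
    from that obtain k where "k < length ts" "ts ! k = None" "i = w k" by (auto simp: Ws_def)
    with w[of k] show ?thesis by (auto simp: closes_def)
  qed
  have "exact_cover ts T"
    unfolding exact_cover_def
  proof (intro conjI allI impI)
    show "T \<subseteq> row_ids ts" by (auto simp: T_def row_ids_def dest: Ws)
    fix k b assume k: "k < length ts" and b: "b < tw (ts ! k)"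
    show "\<exists>!y. y \<in> T \<and> covers ts y k b"
    proof (cases "ts ! k")
      case None
      then have b0: "b = 0" using b by simp
      show ?thesis
      proof (rule ex1I[of _ "(w k, 1)"])
        show "(w k, 1) \<in> T \<and> covers ts (w k, 1) k b" using w[OF k None] k None by (auto simp: T_def Ws_def)
        fix y assume y: "y \<in> T \<and> covers ts y k b"
        obtain i r where ir: "y = (i, r)" by force
        have r: "r = 1" "closes ts i k" using y None by (auto simp: ir split: if_splits)
        then have "i \<in> Ws" using y by (auto simp: ir T_def)
        then obtain k' where k': "i = w k'" "k' < length ts" "ts ! k' = None" by (auto simp: Ws_def)
        then have "closes ts i k'" using w by blast
        then show "y = (w k, 1)" using closes_unique[OF r(2)] k' r by (simp add: ir)
      qed
    next
      case (Some l)
      obtain s x where sx: "ts ! k = Some (s, x)" using Some by (cases l) auto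
      note rx = rep[OF k sx]
      have nc: "\<not> closes ts i k" for i by (simp add: closes_def sx)
      have rT: "(rep x, 2) \<in> T" using rx by (auto simp: T_def)
      have cov: "(r = 2 \<and> i = rep x \<and> (b = 0 \<or> s \<noteq> \<beta> x)) \<or> (r \<noteq> 2 \<and> i = k \<and> b = 1)"
        if T: "(i, r) \<in> T" and c: "covers ts (i, r) k b" for i r
      proof (cases "r = 2")
        case True
        with T obtain y where y: "ts ! i = Some (\<beta> y, y)" "i = rep y" by (auto simp: T_def)
        with c True sx have "y = x" "b = 0 \<or> s \<noteq> \<beta> x" by auto
        with y True show ?thesis by simp
      next
        case False
        with c nc show ?thesis by auto
      qed
      consider "b = 0" | "b = 1" "s \<noteq> \<beta> x" | "b = 1" "s = \<beta> x" "k \<in> Ws" | "b = 1" "s = \<beta> x" "k \<notin> Ws"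
      proof -
        have "b = 0 \<or> b = 1" using b by (auto simp: sx)
        then show ?thesis using that by blast
      qed
      then show ?thesis
      proof cases
        case 1
        show ?thesis
        proof (rule ex1I[of _ "(rep x, 2)"])
          show "(rep x, 2) \<in> T \<and> covers ts (rep x, 2) k b" using rT rx sx 1 by auto
          fix y assume y: "y \<in> T \<and> covers ts y k b"
          obtain i r where ir: "y = (i, r)" by force
          have yT: "(i, r) \<in> T" "covers ts (i, r) k b" using y by (simp_all only: ir)
          show "y = (rep x, 2)" using cov[OF yT] 1 by (simp add: ir)
        qed
      next
        case 2
        have no: "(k, r) \<notin> T" if "r \<noteq> 2" for r using that 2 sx Ws[of k] by (auto simp: T_def)
        show ?thesis
        proof (rule ex1I[of _ "(rep x, 2)"])
          show "(rep x, 2) \<in> T \<and> covers ts (rep x, 2) k b" using rT rx sx 2 by auto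
          fix y assume y: "y \<in> T \<and> covers ts y k b"
          obtain i r where ir: "y = (i, r)" by force
          have yT: "(i, r) \<in> T" "covers ts (i, r) k b" using y by (simp_all only: ir)
          show "y = (rep x, 2)" using cov[OF yT] yT(1) no[of r] by (auto simp: ir)
        qed
      next
        case 3
        have no: "(k, 0) \<notin> T" "(k, 1) \<in> T" using 3 by (auto simp: T_def)
        show ?thesis
        proof (rule ex1I[of _ "(k, 1)"])
          show "(k, 1) \<in> T \<and> covers ts (k, 1) k b" using no sx 3 by auto
          fix y assume y: "y \<in> T \<and> covers ts y k b"
          obtain i r where ir: "y = (i, r)" by force
          have "r = 0 \<or> r = 1 \<or> r = 2" using y by (auto simp: ir T_def)
          moreover have yT: "(i, r) \<in> T" "covers ts (i, r) k b" using y by (simp_all only: ir)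
          ultimately show "y = (k, 1)" using cov[OF yT] no 3 by (auto simp: ir)
        qed
      next
        case 4
        have no: "(k, 1) \<notin> T" "(k, 0) \<in> T" using 4 k sx by (auto simp: T_def)
        show ?thesis
        proof (rule ex1I[of _ "(k, 0)"])
          show "(k, 0) \<in> T \<and> covers ts (k, 0) k b" using no sx 4 by auto
          fix y assume y: "y \<in> T \<and> covers ts y k b"
          obtain i r where ir: "y = (i, r)" by force
          have "r = 0 \<or> r = 1 \<or> r = 2" using y by (auto simp: ir T_def)
          moreover have yT: "(i, r) \<in> T" "covers ts (i, r) k b" using y by (simp_all only: ir)
          ultimately show "y = (k, 0)" using cov[OF yT] no 4 by (auto simp: ir)
        qed
      qed
    qed
  qed
  then show ?thesis by blast
qed

section \<open>Rows as bit patterns\<close>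

definition block :: "tok list \<Rightarrow> nat \<times> nat \<Rightarrow> nat \<Rightarrow> nat list" where
  "block ts x k = map (\<lambda>b. if covers ts x k b then 2 else 1) [0..<tw (ts ! k)]"

lemma block_two: "ts ! k = Some l \<Longrightarrow>
   block ts x k = [if covers ts x k 0 then 2 else 1, if covers ts x k 1 then 2 else 1]"
  by (simp add: block_def upt_rec)

lemma width_take: "k \<le> length ts \<Longrightarrow> length (concat (map f [0..<k])) = width (take k ts)"
  if "\<And>m. m < length ts \<Longrightarrow> length (f m) = tw (ts ! m)"
proof (induction k)
  case (Suc k)
  then show ?case using that[of k] by (simp add: take_Suc_conv_app_nth width_def)
qed (simp add: width_def)

lemma upt_split: "k < n \<Longrightarrow> [0..<n] = [0..<k] @ k # [Suc k..<n]"
  using upt_add_eq_append[of 0 k "n - k"] by (simp add: upt_conv_Cons)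

lemma concat_nth:
  assumes f: "\<And>m. m < length ts \<Longrightarrow> length (f m) = tw (ts ! m)" and k: "k < length ts" "b < tw (ts ! k)"
  shows "concat (map f [0..<length ts]) ! (width (take k ts) + b) = f k ! b"
proof -
  have "[0..<length ts] = [0..<k] @ k # [Suc k..<length ts]"
    by (rule upt_split[OF k(1)])
  moreover have "length (concat (map f [0..<k])) = width (take k ts)"
    by (rule width_take[OF f]) (use k in auto)
  ultimately show ?thesis using f[OF k(1)] k(2) by (simp add: nth_append)
qed

lemma column_cases: "e < width ts \<Longrightarrow> \<exists>k b. k < length ts \<and> b < tw (ts ! k) \<and> e = width (take k ts) + b"
proof (induction ts arbitrary: e)
  case (Cons t ts)
  show ?case
  proof (cases "e < tw t")
    case True
    then show ?thesis by (intro exI[of _ 0] exI[of _ e]) (simp add: width_def)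
  next
    case False
    then have "e - tw t < width ts" using Cons.prems by (simp add: width_def)
    from Cons.IH[OF this] obtain k b where "k < length ts" "b < tw (ts ! k)" "e - tw t = width (take k ts) + b" by blast
    with False show ?thesis by (intro exI[of _ "Suc k"] exI[of _ b]) (simp add: width_def)
  qed
qed (simp add: width_def)

lemma column_less: "k < length ts \<Longrightarrow> b < tw (ts ! k) \<Longrightarrow> width (take k ts) + b < width ts"
proof -
  assume k: "k < length ts" "b < tw (ts ! k)"
  have "width ts = width (take k ts @ ts ! k # drop (Suc k) ts)" by (simp add: id_take_nth_drop[OF k(1), symmetric])
  with k(2) show ?thesis by (simp add: width_def)
qed

lemma upt_0_Suc: "[0..<Suc n] = 0 # map Suc [0..<n]"
  by (simp add: map_Suc_upt upt_conv_Cons del: upt_Suc)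

text \<open>The symbols that \<open>tb\<close> writes for token \<open>k\<close>; the condition
  expresses that \<open>k\<close> is the first clause end.\<close>

definition tail_block :: "nat \<Rightarrow> tok list \<Rightarrow> nat \<Rightarrow> nat list" where
  "tail_block a us k = (case us ! k of Some _ \<Rightarrow> [1, 1] | None \<Rightarrow> [if \<forall>m<k. us ! m \<noteq> None then a else 1])"

lemma tb_blocks: "tb a (etoks us) = concat (map (tail_block a us) [0..<length us])"
proof (induction us arbitrary: a)
  case (Cons t us)
  have l: "tb a (lstr l @ ys) = tb a ys" for l ys
  proof -
    have "tb a (xs @ ys) = tb a ys" if "set xs \<subseteq> {1, 2}" for xs using that by (induction xs) auto
    then show ?thesis using lstr_bits by blast
  qed
  have q: "(\<forall>m<Suc k. (t # us) ! m \<noteq> None) \<longleftrightarrow> t \<noteq> None \<and> (\<forall>m<k. us ! m \<noteq> None)" for k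
    by (auto simp: less_Suc_eq_0_disj)
  show ?case
  proof (cases t)
    case None
    have "tail_block a (t # us) (Suc k) = tail_block 1 us k" for k
      using q[of k] unfolding None by (auto simp: tail_block_def split: option.splits)
    then have "concat (map (tail_block a (t # us)) [0..<length (t # us)]) = a # concat (map (tail_block 1 us) [0..<length us])"
      by (simp add: upt_0_Suc o_def None tail_block_def[of a "None # us" 0] del: upt_Suc)
    then show ?thesis using Cons[of 1] None by (simp add: etok_def)
  next
    case (Some y)
    have "tail_block a (t # us) (Suc k) = tail_block a us k" for k
      using q[of k] unfolding Some by (auto simp: tail_block_def split: option.splits)
    then have "concat (map (tail_block a (t # us)) [0..<length (t # us)]) = 1 # 1 # concat (map (tail_block a us) [0..<length us])"
      by (simp add: upt_0_Suc o_def Some tail_block_def[of a "Some y # us" 0] del: upt_Suc)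
    then show ?thesis using Cons[of a] Some by (simp add: etok_def l)
  qed
qed simp

lemma less_3: "(r :: nat) < 3 \<longleftrightarrow> r = 0 \<or> r = 1 \<or> r = 2"
  by auto

text \<open>The link between the words written by the program and the relation
  \<open>covers\<close>.\<close>

lemma rowsT_blocks:
  assumes i: "i < length ts" "ts ! i = Some l" and r: "r < 3"
  shows "rowsT ts i ! r = concat (map (block ts (i, r)) [0..<length ts])"
proof (cases "r = 2")
  case True
  have "bitsA l (ts ! k) = block ts (i, 2) k" for k
  proof (cases "ts ! k")
    case None
    then show ?thesis by (simp add: bitsA_def block_def)
  next
    case (Some l')
    then show ?thesis by (cases l; cases l') (auto simp: bitsA_def block_two i)
  qed
  then have "map (bitsA l) ts = map (block ts (i, 2)) [0..<length ts]"
    by (intro nth_equalityI) auto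
  then show ?thesis using True by (simp add: rowsT_def i)
next
  case False
  let ?a = "if r = 1 then 2 else 1 :: nat" and ?us = "drop (Suc i) ts"
  have upt: "[0..<length ts] = [0..<i] @ i # map (\<lambda>k. Suc i + k) [0..<length ?us]"
  proof -
    have "[0..<length ts] = [0..<i] @ i # [Suc i..<length ts]" by (rule upt_split[OF i(1)])
    also have "[Suc i..<length ts] = map (\<lambda>k. Suc i + k) [0..<length ?us]"
      using i(1) by (intro nth_equalityI) auto
    finally show ?thesis .
  qed
  have 1: "concat (map (block ts (i, r)) [0..<i]) = replicate (width (take i ts)) 1"
  proof -
    have "block ts (i, r) k = replicate (tw (ts ! k)) 1" if "k < i" for k
      using that False by (auto simp: block_def closes_def map_replicate_const)
    then have "set (concat (map (block ts (i, r)) [0..<i])) \<subseteq> {1}" by auto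
    moreover have "length (concat (map (block ts (i, r)) [0..<i])) = width (take i ts)"
      by (rule width_take) (use i in \<open>auto simp: block_def\<close>)
    ultimately show ?thesis by (metis replicate_eqI singletonD subsetD)
  qed
  have 2: "block ts (i, r) i = [1, 2]"
    using False i by (simp add: block_two closes_def)
  have 3: "block ts (i, r) (Suc i + k) = tail_block ?a ?us k" if k: "k < length ?us" for k
  proof -
    have "closes ts i (Suc i + k) \<longleftrightarrow> ts ! (Suc i + k) = None \<and> (\<forall>m<k. ?us ! m \<noteq> None)"
    proof -
      have "(\<forall>m. i < m \<and> m < Suc i + k \<longrightarrow> ts ! m \<noteq> None) \<longleftrightarrow> (\<forall>m<k. ts ! (Suc i + m) \<noteq> None)"
      proof (intro iffI allI impI)
        fix m assume a: "\<forall>m<k. ts ! (Suc i + m) \<noteq> None" "i < m \<and> m < Suc i + k"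
        then have "ts ! (Suc i + (m - Suc i)) \<noteq> None" by (intro a(1)[rule_format]) auto
        then show "ts ! m \<noteq> None" using a(2) by simp
      qed auto
      then show ?thesis using k by (simp add: closes_def)
    qed
    moreover have "?us ! k = ts ! (Suc i + k)" using k by simp
    ultimately show ?thesis using False
    proof (cases "ts ! (Suc i + k)")
      case None
      with False \<open>closes ts i (Suc i + k) \<longleftrightarrow> _\<close> \<open>?us ! k = _\<close> show ?thesis
        by (simp add: block_def tail_block_def del: not_None_eq)
    next
      case (Some l')
      with False \<open>closes ts i (Suc i + k) \<longleftrightarrow> _\<close> \<open>?us ! k = _\<close> show ?thesis
        by (simp add: block_two tail_block_def)
    qed
  qed
  have m: "map (\<lambda>k. block ts (i, r) (Suc i + k)) [0..<length ?us] = map (tail_block ?a ?us) [0..<length ?us]"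
  proof (rule map_cong[OF refl])
    fix k assume "k \<in> set [0..<length ?us]"
    then have "k < length ?us" by simp
    then show "block ts (i, r) (Suc i + k) = tail_block ?a ?us k" by (rule 3)
  qed
  have c: "map (block ts (i, r)) [0..<length ts] = map (block ts (i, r)) [0..<i] @ block ts (i, r) i #
      map (tail_block ?a ?us) [0..<length ?us]"
    using arg_cong[OF upt, of "map (block ts (i, r))"] unfolding m[symmetric]
    by (simp only: map_append list.map map_map comp_def)
  have "concat (map (block ts (i, r)) [0..<length ts]) = replicate (width (take i ts)) 1 @ [1, 2] @
      concat (map (tail_block ?a ?us) [0..<length ?us])"
    unfolding c concat_append concat.simps 1 2 by (rule refl)
  also have "\<dots> = replicate (width (take i ts)) 1 @ [1, 2] @ tb ?a (etoks ?us)" by (simp only: tb_blocks)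
  finally show ?thesis using False r unfolding less_3 by (elim disjE) (simp_all add: rowsT_def i)
qed

definition row_list :: "tok list \<Rightarrow> nat \<Rightarrow> (nat \<times> nat) list" where
  "row_list ts n = concat (rev (map (\<lambda>i. if ts ! i = None then [] else [(i, 0), (i, 1), (i, 2)]) [0..<n]))"

lemma row_list_set: "distinct (row_list ts n) \<and> set (row_list ts n) = {(i, r). i < n \<and> ts ! i \<noteq> None \<and> r < 3}"
proof (induction n)
  case (Suc n)
  have eq: "row_list ts (Suc n) = (if ts ! n = None then [] else [(n, 0), (n, 1), (n, 2)]) @ row_list ts n"
    by (simp add: row_list_def)
  show ?case
  proof (cases "ts ! n")
    case None
    then have "{(i, r). i < Suc n \<and> ts ! i \<noteq> None \<and> r < 3} = {(i, r). i < n \<and> ts ! i \<noteq> None \<and> r < (3 :: nat)}"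
      by (auto simp: less_Suc_eq)
    with Suc None eq show ?thesis by simp
  next
    case (Some l)
    then have "{(i, r). i < Suc n \<and> ts ! i \<noteq> None \<and> r < 3} =
        {(n, 0), (n, 1), (n, 2)} \<union> {(i, r). i < n \<and> ts ! i \<noteq> None \<and> r < (3 :: nat)}"
      by (auto simp: less_Suc_eq less_3)
    moreover have "set (row_list ts n) = {(i, r). i < n \<and> ts ! i \<noteq> None \<and> r < 3}" "distinct (row_list ts n)"
      using Suc by simp_all
    ultimately show ?thesis using Some eq by auto
  qed
qed (simp add: row_list_def)

lemma patterns_row_list:
  "patterns ts = map (\<lambda>x. concat (map (block ts x) [0..<length ts])) (row_list ts (length ts))"
proof -
  have "concat (rev (map (rowsT ts) [0..<n])) = map (\<lambda>x. concat (map (block ts x) [0..<length ts])) (row_list ts n)"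
    if "n \<le> length ts" for n
    using that
  proof (induction n)
    case (Suc n)
    have "rowsT ts n = map (\<lambda>x. concat (map (block ts x) [0..<length ts]))
        (if ts ! n = None then [] else [(n, 0), (n, 1), (n, 2)])"
    proof (cases "ts ! n")
      case (Some l)
      then have "length (rowsT ts n) = 3" by (simp add: rowsT_def)
      then have "rowsT ts n = [rowsT ts n ! 0, rowsT ts n ! 1, rowsT ts n ! 2]"
        by (intro nth_equalityI) (auto simp: less_3)
      then show ?thesis using rowsT_blocks[of n ts l] Some Suc.prems by simp
    qed (simp add: rowsT_def)
    with Suc show ?case by (simp add: row_list_def)
  qed (simp add: row_list_def)
  then show ?thesis by (simp add: patterns_def)
qed

lemma card_1_iff: "card {x \<in> T. P x} = 1 \<longleftrightarrow> (\<exists>!x. x \<in> T \<and> P x)"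
proof
  assume "card {x \<in> T. P x} = 1"
  then obtain y where "{x \<in> T. P x} = {y}" by (rule card_1_singletonE)
  then have "x \<in> T \<and> P x \<longleftrightarrow> x = y" for x by blast
  then show "\<exists>!x. x \<in> T \<and> P x" by simp
next
  assume "\<exists>!x. x \<in> T \<and> P x"
  then obtain y where "\<And>x. x \<in> T \<and> P x \<longleftrightarrow> x = y" by blast
  then have "{x \<in> T. P x} = {y}" by simp
  then show "card {x \<in> T. P x} = 1" by simp
qed

text \<open>Subtracting 1 turns the symbols 1 and 2 into entries 0 and 1. Index sets are used
  because different rows may have equal patterns, for instance the truth rows of two occurrences of
  the same literal.\<close>

lemma patterns_cover:
  "(\<exists>S\<subseteq>{..<length (patterns ts)}. \<forall>e<width ts. (\<Sum>j\<in>S. patterns ts ! j ! e - 1) = 1) \<longleftrightarrow> (\<exists>T. exact_cover ts T)"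
proof -
  let ?L = "row_list ts (length ts)" and ?ps = "patterns ts"
  have L: "distinct ?L" "set ?L = row_ids ts" using row_list_set[of ts "length ts"] by (auto simp: row_ids_def)
  have len: "length ?ps = length ?L" by (simp add: patterns_row_list)
  have ent: "?ps ! j ! (width (take k ts) + b) - 1 = (if covers ts (?L ! j) k b then 1 else 0)"
    if "j < length ?L" "k < length ts" "b < tw (ts ! k)" for j k b
  proof -
    have "?ps ! j ! (width (take k ts) + b) = block ts (?L ! j) k ! b"
      using that by (simp add: patterns_row_list concat_nth block_def)
    then show ?thesis using that by (simp add: block_def)
  qed
  \<comment> \<open>The list \<open>?L\<close> is distinct, so index sets and sets of rows
    correspond and a column sum counts the chosen rows covering that column.\<close>
  have main: "(\<forall>e<width ts. (\<Sum>j\<in>S. ?ps ! j ! e - 1) = 1) \<longleftrightarrow> exact_cover ts ((!) ?L ` S)"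
    if S: "S \<subseteq> {..<length ?L}" for S
  proof -
    have inj: "inj_on ((!) ?L) S" using inj_on_nth[OF L(1), of S] S by auto
    have fin: "finite S" using S finite_subset by blast
    have sum: "(\<Sum>j\<in>S. ?ps ! j ! (width (take k ts) + b) - 1) = card {x \<in> (!) ?L ` S. covers ts x k b}"
      if "k < length ts" "b < tw (ts ! k)" for k b
    proof -
      have "(\<Sum>j\<in>S. ?ps ! j ! (width (take k ts) + b) - 1) = (\<Sum>j\<in>S. if covers ts (?L ! j) k b then 1 else 0)"
      proof (rule sum.cong)
        fix j assume "j \<in> S"
        then have "j < length ?L" using S by auto
        then show "?ps ! j ! (width (take k ts) + b) - 1 = (if covers ts (?L ! j) k b then 1 else 0)"
          using that by (rule ent)
      qed simp
      also have "\<dots> = (\<Sum>x\<in>(!) ?L ` S. if covers ts x k b then 1 else 0)"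
        by (simp add: sum.reindex[OF inj])
      also have "\<dots> = card {x \<in> (!) ?L ` S. covers ts x k b}"
        using fin by (subst sum.If_cases) (simp_all add: Int_def)
      finally show ?thesis .
    qed
    have "(\<forall>e<width ts. (\<Sum>j\<in>S. ?ps ! j ! e - 1) = 1) \<longleftrightarrow>
       (\<forall>k<length ts. \<forall>b<tw (ts ! k). (\<Sum>j\<in>S. ?ps ! j ! (width (take k ts) + b) - 1) = 1)"
    proof
      assume a: "\<forall>k<length ts. \<forall>b<tw (ts ! k). (\<Sum>j\<in>S. ?ps ! j ! (width (take k ts) + b) - 1) = 1"
      show "\<forall>e<width ts. (\<Sum>j\<in>S. ?ps ! j ! e - 1) = 1"
      proof (intro allI impI)
        fix e assume "e < width ts"
        from column_cases[OF this] a show "(\<Sum>j\<in>S. ?ps ! j ! e - 1) = 1" by blast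
      qed
    qed (simp add: column_less)
    also have "\<dots> \<longleftrightarrow> (\<forall>k<length ts. \<forall>b<tw (ts ! k). \<exists>!x. x \<in> (!) ?L ` S \<and> covers ts x k b)"
      by (simp only: sum card_1_iff cong: imp_cong all_cong)
    also have "\<dots> \<longleftrightarrow> exact_cover ts ((!) ?L ` S)"
    proof -
      have "(!) ?L ` S \<subseteq> row_ids ts"
      proof
        fix x assume "x \<in> (!) ?L ` S"
        then obtain j where "j \<in> S" "x = ?L ! j" by blast
        moreover from this(1) have "j < length ?L" using S by auto
        ultimately show "x \<in> row_ids ts" using nth_mem[of j ?L] L(2) by simp
      qed
      then show ?thesis by (simp only: exact_cover_def simp_thms)
    qed
    finally show ?thesis .
  qed
  show ?thesis
  proof
    assume "\<exists>S\<subseteq>{..<length ?ps}. \<forall>e<width ts. (\<Sum>j\<in>S. ?ps ! j ! e - 1) = 1"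
    then show "\<exists>T. exact_cover ts T" using main len by auto
  next
    assume "\<exists>T. exact_cover ts T"
    then obtain T where T: "exact_cover ts T" by blast
    then have sub: "T \<subseteq> set ?L" by (simp add: exact_cover_def L)
    define S where "S = {j. j < length ?L \<and> ?L ! j \<in> T}"
    have "(!) ?L ` S = T"
    proof
      show "(!) ?L ` S \<subseteq> T" by (auto simp: S_def)
      show "T \<subseteq> (!) ?L ` S"
      proof
        fix x assume x: "x \<in> T"
        then obtain j where "j < length ?L" "x = ?L ! j" using sub by (auto simp: in_set_conv_nth dest!: subsetD)
        with x show "x \<in> (!) ?L ` S" by (auto simp: S_def)
      qed
    qed
    with main[of S] T show "\<exists>S\<subseteq>{..<length ?ps}. \<forall>e<width ts. (\<Sum>j\<in>S. ?ps ! j ! e - 1) = 1"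
      by (intro exI[of _ S]) (auto simp: S_def len)
  qed
qed

section \<open>Cost of orderings\<close>

text \<open>The sum over the rows in \<open>P\<close> in private column \<open>i\<close>. Column 0
  exists as well; it receives only the -1 of row 0.\<close>

definition starS :: "nat set \<Rightarrow> nat \<Rightarrow> int" where
  "starS P i = (\<Sum>j\<in>P. if j = 0 then -1 else if j = i then 1 else 0)"

definition coverS :: "(nat \<Rightarrow> nat \<Rightarrow> nat) \<Rightarrow> nat set \<Rightarrow> nat \<Rightarrow> int" where
  "coverS a P e = (\<Sum>j\<in>P. if j = 0 then -1 else int (a j e))"

text \<open>The cost of a prefix with row set \<open>P\<close> when each coordinate of the
  difference vectors is counted once; in the actual series every coordinate occurs twice.\<close>

definition level :: "nat \<Rightarrow> nat \<Rightarrow> nat \<Rightarrow> (nat \<Rightarrow> nat \<Rightarrow> nat) \<Rightarrow> nat \<Rightarrow> nat set \<Rightarrow> real" where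
  "level p N z a n P = (\<Sum>i<n. \<bar>real_of_int (starS P i)\<bar> ^ p) + real N * (\<Sum>e<z. \<bar>real_of_int (coverS a P e)\<bar> ^ p)"

lemma starS_eq: "finite P \<Longrightarrow> starS P i = (if i \<in> P \<and> i \<noteq> 0 then 1 else 0) - (if 0 \<in> P then 1 else 0)"
proof -
  assume f: "finite P"
  have "starS P i = (\<Sum>j\<in>P. (if j = i then (if i = 0 then 0 else 1) else 0) - (if j = 0 then 1 else 0))"
    unfolding starS_def by (rule sum.cong) auto
  then show ?thesis using f by (simp add: sum_subtractf)
qed

lemma coverS_eq: "finite P \<Longrightarrow> coverS a P e = int (\<Sum>j\<in>P - {0}. a j e) - (if 0 \<in> P then 1 else 0)"
proof -
  assume f: "finite P"
  have "coverS a P e = (\<Sum>j\<in>P. (if j = 0 then 0 else int (a j e)) - (if j = 0 then 1 else 0))"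
    unfolding coverS_def by (rule sum.cong) auto
  moreover have "(\<Sum>j\<in>P. if j = 0 then 0 else int (a j e)) = (\<Sum>j\<in>P - {0}. int (a j e))"
    using f by (intro sum.mono_neutral_cong_right) auto
  ultimately show ?thesis using f by (simp add: sum_subtractf)
qed

text \<open>All values are -1, 0 or 1, so the sum counts the nonzero ones. With row 0 present these
  are the columns of the missing rows and, giving the \<open>+ 1\<close>, column 0, in which nothing
  cancels the -1.\<close>

lemma star_sum:
  assumes P: "P \<subseteq> {..<n}" and p: "1 \<le> p"
  shows "(\<Sum>i<n. \<bar>real_of_int (starS P i)\<bar> ^ p) = (if 0 \<in> P then real n - real (card P) + 1 else real (card P))"
proof -
  have f: "finite P" using P finite_subset by blast
  show ?thesis
  proof (cases "0 \<in> P")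
    case False
    then have "(\<Sum>i<n. \<bar>real_of_int (starS P i)\<bar> ^ p) = (\<Sum>i<n. if i \<in> P then 1 else 0)"
      using p f by (intro sum.cong) (auto simp: starS_eq power_0_left)
    also have "\<dots> = real (card ({..<n} \<inter> P))" by (simp add: sum.If_cases)
    also have "{..<n} \<inter> P = P" using P by blast
    finally show ?thesis using False by simp
  next
    case True
    define Q where "Q = P - {0}"
    have "(\<Sum>i<n. \<bar>real_of_int (starS P i)\<bar> ^ p) = (\<Sum>i<n. if i \<in> Q then 0 else 1)"
      using p f True by (intro sum.cong) (auto simp: starS_eq power_0_left Q_def)
    also have "\<dots> = real (card ({..<n} - Q))" by (simp add: sum.If_cases Diff_eq)
    also have "{..<n} - Q = {..<n} - (P - {0})" by (simp add: Q_def)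
    also have "card \<dots> = n - card (P - {0})" using P f by (subst card_Diff_subset) auto
    also have "card (P - {0}) = card P - 1" using f True by simp
    also have "real (n - (card P - 1)) = real n - real (card P) + 1"
    proof -
      have "card P \<le> n" using card_mono[OF _ P] by simp
      moreover have "card P \<ge> 1" using True f by (simp add: Suc_le_eq card_gt_0_iff) blast
      ultimately show ?thesis by (simp add: of_nat_diff)
    qed
    finally show ?thesis using True by simp
  qed
qed

lemma sum_upto: "(\<Sum>t=1..A. real t) = real A * (real A + 1) / 2"
  by (induction A) (auto simp: field_simps)

text \<open>Two triangular sums: prefix lengths up to \<open>A\<close> contribute directly, and the
  longer ones after the reflection of \<open>t\<close> to \<open>n + 1 - t\<close>.\<close>

lemma sum_star_levels:
  "A < n \<Longrightarrow> (\<Sum>t=1..n. if A < t then real n - real t + 1 else real t) =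
     real A * (real A + 1) / 2 + (real n - real A) * (real n - real A + 1) / 2"
proof -
  assume A: "A < n"
  have "{1..n} = {1..A} \<union> {A+1..n}" using A by auto
  then have "(\<Sum>t=1..n. if A < t then real n - real t + 1 else real t) =
      (\<Sum>t=1..A. if A < t then real n - real t + 1 else real t) + (\<Sum>t=A+1..n. if A < t then real n - real t + 1 else real t)"
    by (simp add: sum.union_disjoint)
  also have "(\<Sum>t=1..A. if A < t then real n - real t + 1 else real t) = (\<Sum>t=1..A. real t)"
    by (intro sum.cong) auto
  also have "(\<Sum>t=A+1..n. if A < t then real n - real t + 1 else real t) = (\<Sum>t=1..n-A. real t)"
    by (rule sum.reindex_bij_witness[of _ "\<lambda>t. n + 1 - t" "\<lambda>t. n + 1 - t"]) (auto simp: of_nat_diff)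
  finally show ?thesis using A by (simp only: sum_upto) (simp add: of_nat_diff)
qed

lemma take_facts:
  assumes js: "distinct js" "set js = {..<n}" "js = xs @ 0 # ys" and t: "t \<le> n"
  shows "set (take t js) \<subseteq> {..<n}" "card (set (take t js)) = t" "0 \<in> set (take t js) \<longleftrightarrow> length xs < t"
proof -
  have l: "length js = n" using js distinct_card[of js] by simp
  show "set (take t js) \<subseteq> {..<n}" using js(2) set_take_subset[of t js] by auto
  show "card (set (take t js)) = t" using js(1) l t by (simp add: distinct_card)
  have "0 \<notin> set xs" using js(1,3) by auto
  then have "0 \<notin> set (take t xs)" by (meson in_set_takeD)
  moreover have "0 \<in> set (take (t - length xs) (0 # ys)) \<longleftrightarrow> length xs < t"
    by (cases "t - length xs") auto
  ultimately show "0 \<in> set (take t js) \<longleftrightarrow> length xs < t" by (simp add: js(3))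
qed

lemma power_ge_1: "x \<noteq> 0 \<Longrightarrow> 1 \<le> \<bar>real_of_int x\<bar> ^ p"
  by (intro one_le_power) linarith

lemma level_nonneg: "0 \<le> level p N z a n P"
  unfolding level_def by (intro add_nonneg_nonneg sum_nonneg mult_nonneg_nonneg) auto

text \<open>The private columns alone give the quadratic terms. The sum stops at
  \<open>n - 1\<close> because the last prefix has a much smaller weight in the weighted
  problem.\<close>

lemma core_lower:
  assumes js: "distinct js" "set js = {..<n}" "js = xs @ 0 # ys" and p: "1 \<le> p"
  shows "(real (length xs))\<^sup>2 / 2 + (real (length ys))\<^sup>2 / 2 \<le> (\<Sum>t=1..n-1. level p N z a n (set (take t js)))"
    and "(\<And>S. S \<subseteq> {1..<n} \<Longrightarrow> \<exists>e<z. (\<Sum>j\<in>S. a j e) \<noteq> 1) \<Longrightarrow>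
       (real (length xs))\<^sup>2 / 2 + (real (length ys))\<^sup>2 / 2 + real N * real (length ys) \<le>
         (\<Sum>t=1..n-1. level p N z a n (set (take t js)))"
proof -
  let ?A = "length xs" and ?b = "length ys"
  have l: "length js = n" using js distinct_card[of js] by simp
  have n: "n = ?A + ?b + 1" using l js(3) by simp
  have st: "(\<Sum>i<n. \<bar>real_of_int (starS (set (take t js)) i)\<bar> ^ p) = (if ?A < t then real n - real t + 1 else real t)"
    if "t \<le> n" for t
    using star_sum[OF take_facts(1)[OF js that] p] take_facts(2,3)[OF js that] by simp
  have split: "(\<Sum>t=1..n. f t) = (\<Sum>t=1..n-1. f t) + f n" for f :: "nat \<Rightarrow> real"
  proof -
    have "{1..n} = insert n {1..n-1}" using n by auto
    then show ?thesis using n by simp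
  qed
  have "(\<Sum>t=1..n. if ?A < t then real n - real t + 1 else real t) =
     real ?A * (real ?A + 1) / 2 + (real n - real ?A) * (real n - real ?A + 1) / 2"
    by (rule sum_star_levels) (use n in simp)
  \<comment> \<open>The full prefix, removed here, contributes exactly 1 to the private
    columns.\<close>
  then have s: "(\<Sum>t=1..n-1. if ?A < t then real n - real t + 1 else real t) =
     real ?A * (real ?A + 1) / 2 + (real ?b + 1) * (real ?b + 2) / 2 - 1"
    unfolding split by (simp add: n algebra_simps)
  have q: "(real ?A)\<^sup>2 / 2 + (real ?b)\<^sup>2 / 2 \<le> (\<Sum>t=1..n-1. if ?A < t then real n - real t + 1 else real t)"
    unfolding s by (simp add: power2_eq_square field_simps)
  have lev: "level p N z a n (set (take t js)) = (if ?A < t then real n - real t + 1 else real t) +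
      real N * (\<Sum>e<z. \<bar>real_of_int (coverS a (set (take t js)) e)\<bar> ^ p)" if "t \<in> {1..n-1}" for t
  proof -
    have "t \<le> n" using that by auto
    from st[OF this] show ?thesis unfolding level_def by simp
  qed
  have tot: "(\<Sum>t=1..n-1. level p N z a n (set (take t js))) =
      (\<Sum>t=1..n-1. if ?A < t then real n - real t + 1 else real t) +
      (\<Sum>t=1..n-1. real N * (\<Sum>e<z. \<bar>real_of_int (coverS a (set (take t js)) e)\<bar> ^ p))"
    by (subst sum.cong[OF refl lev]) (simp_all add: sum.distrib)
  have nn: "0 \<le> real N * (\<Sum>e<z. \<bar>real_of_int (coverS a (set (take t js)) e)\<bar> ^ p)" for t
    by (intro mult_nonneg_nonneg sum_nonneg) auto
  have tt: "0 \<le> (\<Sum>t=1..n-1. real N * (\<Sum>e<z. \<bar>real_of_int (coverS a (set (take t js)) e)\<bar> ^ p))"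
    by (rule sum_nonneg) (rule nn)
  show "(real ?A)\<^sup>2 / 2 + (real ?b)\<^sup>2 / 2 \<le> (\<Sum>t=1..n-1. level p N z a n (set (take t js)))"
    using q tt unfolding tot by linarith
  assume no: "\<And>S. S \<subseteq> {1..<n} \<Longrightarrow> \<exists>e<z. (\<Sum>j\<in>S. a j e) \<noteq> 1"
  \<comment> \<open>Exactly \<open>?b\<close> proper prefixes contain row 0. In each of them some
    element is not covered exactly once, and its \<open>N\<close> copies contribute at least 1
    each.\<close>
  have "real N * real ?b = (\<Sum>t=?A+1..n-1. real N)" by (simp add: n)
  also have "\<dots> \<le> (\<Sum>t=?A+1..n-1. real N * (\<Sum>e<z. \<bar>real_of_int (coverS a (set (take t js)) e)\<bar> ^ p))"
  proof (rule sum_mono)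
    fix t assume t: "t \<in> {?A+1..n-1}"
    let ?P = "set (take t js)"
    have tn: "t \<le> n" using t by auto
    have P: "?P \<subseteq> {..<n}" "0 \<in> ?P" using take_facts(1,3)[OF js tn] t by simp_all
    then have "?P - {0} \<subseteq> {1..<n}" by auto
    from no[OF this] obtain e where e: "e < z" "(\<Sum>j\<in>?P - {0}. a j e) \<noteq> 1" by blast
    then have "coverS a ?P e \<noteq> 0" using P(2) by (simp add: coverS_eq del: of_nat_sum)
    then have "1 \<le> \<bar>real_of_int (coverS a ?P e)\<bar> ^ p" by (rule power_ge_1)
    also have "\<dots> \<le> (\<Sum>e<z. \<bar>real_of_int (coverS a ?P e)\<bar> ^ p)"
      by (rule member_le_sum) (use e in auto)
    finally have "real N * 1 \<le> real N * (\<Sum>e<z. \<bar>real_of_int (coverS a ?P e)\<bar> ^ p)"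
      by (rule mult_left_mono) simp
    then show "real N \<le> real N * (\<Sum>e<z. \<bar>real_of_int (coverS a ?P e)\<bar> ^ p)" by simp
  qed
  also have "\<dots> \<le> (\<Sum>t=1..n-1. real N * (\<Sum>e<z. \<bar>real_of_int (coverS a (set (take t js)) e)\<bar> ^ p))"
    by (rule sum_mono2) (use nn in auto)
  finally show "(real ?A)\<^sup>2 / 2 + (real ?b)\<^sup>2 / 2 + real N * real ?b \<le>
      (\<Sum>t=1..n-1. level p N z a n (set (take t js)))"
    using q unfolding tot by linarith
qed

text \<open>One ordering scheme for both cases: with a cover, \<open>cs\<close> is the cover between
  two halves of the zero rows; without one, \<open>cs\<close> and \<open>ds'\<close> are empty and
  the condition \<open>ok\<close> is void.\<close>

lemma core_upper:
  assumes js: "distinct js" "set js = {..<n}" "js = ds @ 0 # cs @ ds' @ rs"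
    and a: "\<And>j e. a j e \<le> 1" "\<And>j e. j \<in> set ds \<union> set ds' \<Longrightarrow> a j e = 0"
    and R: "length cs + length rs = R"
    and ok: "\<And>e. ds' \<noteq> [] \<Longrightarrow> e < z \<Longrightarrow> (\<Sum>j\<in>set cs. a j e) = 1" and p: "1 \<le> p"
  shows "(\<Sum>t=1..n. level p N z a n (set (take t js))) \<le>
     real (length ds) * (real (length ds) + 1) / 2 +
     (real n - real (length ds)) * (real n - real (length ds) + 1) / 2 +
     real N * real z * (real R + 1) ^ (p + 1)"
proof -
  let ?A = "length ds" and ?c = "length cs" and ?d = "length ds'"
  let ?P = "\<lambda>t. set (take t js)" and ?M = "real N * (real z * (real R + 1) ^ p)"
  \<comment> \<open>The prefix lengths at which the repeated columns need not cancel: from row 0 to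
    the end of \<open>cs\<close>, and within \<open>rs\<close>. They number \<open>R + 1\<close>.
    The end of \<open>cs\<close> is included since \<open>cs\<close> is assumed to be a cover only
    if \<open>ds'\<close> is nonempty.\<close>
  let ?bad = "{?A+1..?A+1+?c} \<union> {?A+2+?c+?d..n}"
  let ?con = "\<lambda>t. real N * (\<Sum>e<z. \<bar>real_of_int (coverS a (?P t) e)\<bar> ^ p)"
  let ?st = "\<lambda>t. if ?A < t then real n - real t + 1 else real t"
  have l: "length js = n" using js distinct_card[of js] by simp
  have n: "n = ?A + 1 + ?c + ?d + length rs" using l js(3) by simp
  have dis: "0 \<notin> set ds" "0 \<notin> set cs" "0 \<notin> set ds'" "0 \<notin> set rs" "distinct cs"
    "set ds \<inter> set cs = {}" "set ds' \<inter> set cs = {}"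
    using js(1) unfolding js(3) by auto
  have lev: "level p N z a n (?P t) = ?st t + ?con t" if "t \<in> {1..n}" for t
    unfolding level_def using star_sum[OF take_facts(1)[OF js, of t] p] take_facts(2,3)[OF js, of t] that by simp
  have good: "?con t = 0" if t: "t \<in> {1..n}" "t \<notin> ?bad" for t
  proof -
    have "coverS a (?P t) e = 0" if e: "e < z" for e
    proof (cases "t \<le> ?A")
      case True
      then have "?P t \<subseteq> set ds" by (simp add: js(3) set_take_subset)
      then have "0 \<notin> ?P t" "\<And>j. j \<in> ?P t \<Longrightarrow> a j e = 0" using dis a(2) by auto
      then show ?thesis by (simp add: coverS_eq)
    next
      case False
      then have t': "?A + 1 + ?c < t" "t \<le> ?A + 1 + ?c + ?d" using t by auto
      then have ds': "ds' \<noteq> []" by auto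
      obtain u where u: "t = ?A + (1 + (?c + u))" "u \<le> ?d"
        using t' by (metis add.assoc add_le_cancel_left less_imp_add_positive)
      then have "?P t = set ds \<union> {0} \<union> set cs \<union> set (take u ds')"
        by (simp add: js(3) Un_assoc)
      then have P: "?P t - {0} = set cs \<union> (set ds \<union> set (take u ds'))" "0 \<in> ?P t"
        using dis set_take_subset[of u ds'] by auto
      have "(\<Sum>j\<in>?P t - {0}. a j e) = (\<Sum>j\<in>set cs. a j e) + (\<Sum>j\<in>set ds \<union> set (take u ds'). a j e)"
        unfolding P by (rule sum.union_disjoint) (use dis set_take_subset[of u ds'] in auto)
      also have "(\<Sum>j\<in>set ds \<union> set (take u ds'). a j e) = 0"
        using a(2) set_take_subset[of u ds'] by (intro sum.neutral) blast
      finally show ?thesis using ok[OF ds' e] P(2) by (simp add: coverS_eq)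
    qed
    then show ?thesis using p by (simp add: power_0_left)
  qed
  have bad: "?con t \<le> ?M" for t
  proof -
    \<comment> \<open>At most \<open>R\<close> rows have nonzero entries, each entry at most 1, and
      row 0 contributes -1.\<close>
    have "\<bar>real_of_int (coverS a (?P t) e)\<bar> ^ p \<le> (real R + 1) ^ p" for e
    proof (rule power_mono)
      have "(\<Sum>j\<in>?P t - {0}. a j e) \<le> (\<Sum>j\<in>(set cs \<union> set rs) \<union> (set ds \<union> set ds'). a j e)"
        by (rule sum_mono2) (auto simp: js(3) dest!: in_set_takeD)
      also have "\<dots> \<le> (\<Sum>j\<in>set cs \<union> set rs. a j e) + (\<Sum>j\<in>set ds \<union> set ds'. a j e)"
        by (rule sum_Un_nat[THEN eq_refl, THEN le_trans]) auto
      also have "(\<Sum>j\<in>set ds \<union> set ds'. a j e) = 0" using a(2) by simp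
      also have "(\<Sum>j\<in>set cs \<union> set rs. a j e) \<le> (\<Sum>j\<in>set cs \<union> set rs. 1)"
        using a(1) by (intro sum_mono) auto
      also have "\<dots> \<le> length cs + length rs"
        using card_Un_le[of "set cs" "set rs"] card_length[of cs] card_length[of rs] by simp
      finally have "(\<Sum>j\<in>?P t - {0}. a j e) \<le> R" using R by simp
      then have "\<bar>coverS a (?P t) e\<bar> \<le> int R + 1"
        unfolding coverS_eq[OF finite_set] by (auto simp: abs_le_iff simp del: of_nat_sum)
      then have "real_of_int \<bar>coverS a (?P t) e\<bar> \<le> real_of_int (int R + 1)" by (simp only: of_int_le_iff)
      then show "\<bar>real_of_int (coverS a (?P t) e)\<bar> \<le> real R + 1" by simp
    qed simp
    then have "(\<Sum>e<z. \<bar>real_of_int (coverS a (?P t) e)\<bar> ^ p) \<le> (\<Sum>e<z. (real R + 1) ^ p)" by (rule sum_mono)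
    then show ?thesis by (intro mult_left_mono) simp_all
  qed
  have "(\<Sum>t=1..n. ?con t) \<le> (\<Sum>t=1..n. if t \<in> ?bad then ?M else 0)"
  proof (rule sum_mono)
    fix t assume "t \<in> {1..n}"
    with good[of t] bad[of t] show "?con t \<le> (if t \<in> ?bad then ?M else 0)" by (cases "t \<in> ?bad") auto
  qed
  also have "\<dots> = real (card ({1..n} \<inter> ?bad)) * ?M"
    by (subst sum.If_cases) (simp_all del: Un_iff)
  also have "\<dots> \<le> real (R + 1) * ?M"
  proof (rule mult_right_mono)
    have "card ({1..n} \<inter> ?bad) \<le> card ?bad" by (rule card_mono) auto
    also have "\<dots> \<le> card {?A+1..?A+1+?c} + card {?A+2+?c+?d..n}" by (rule card_Un_le)
    also have "\<dots> = R + 1" using n R by simp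
    finally show "real (card ({1..n} \<inter> ?bad)) \<le> real (R + 1)" by simp
  qed simp
  finally have con: "(\<Sum>t=1..n. ?con t) \<le> real N * real z * (real R + 1) ^ (p + 1)"
    by (simp add: algebra_simps)
  have "(\<Sum>t=1..n. level p N z a n (?P t)) = (\<Sum>t=1..n. ?st t) + (\<Sum>t=1..n. ?con t)"
    by (subst sum.cong[OF refl lev]) (simp_all add: sum.distrib)
  also have "(\<Sum>t=1..n. ?st t) = real ?A * (real ?A + 1) / 2 + (real n - real ?A) * (real n - real ?A + 1) / 2"
    by (rule sum_star_levels) (use n in simp)
  finally show ?thesis using con by simp
qed

text \<open>A cover exists, yet row 0 comes after more than about two thirds of the rows: the
  quadratic cost is then at least about 5/18 N^2 against the upper bound of about 1/4 N^2.\<close>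

lemma yes_gap:
  fixes A b N R :: real
  assumes N: "0 < N" and R: "0 \<le> R" "500 * (R + 2) \<le> N" and AB: "A + b = N + R" "0 \<le> b" "2 * b < A"
    and X: "0 \<le> X" "1000 * X \<le> N\<^sup>2" and rho: "0 \<le> \<rho>" "\<rho> \<le> 1042 / 1000"
    and le: "A\<^sup>2 / 2 + b\<^sup>2 / 2 \<le> \<rho> * ((N/2) * (N/2 + 1) / 2 + (N/2 + R + 1) * (N/2 + R + 2) / 2 + X)"
  shows False
proof -
  \<comment> \<open>All lower order terms are measured in units of \<open>r\<close>, which exceeds
    \<open>R + 2\<close>, so that only coefficients of \<open>r * r\<close> are compared in the
    end.\<close>
  define r where "r = N / 500"
  have r: "1 \<le> N / 1000" "R + 2 \<le> r" "N = 500 * r" "0 < r" using N R by (auto simp: r_def)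
  have sq: "x * y \<le> u * v" if "0 \<le> x" "0 \<le> y" "x \<le> u" "y \<le> v" for x y u v :: real
    using that by (intro mult_mono) auto
  have "(N/2) * (N/2 + 1) \<le> (250 * r) * (250.5 * r)" by (rule sq) (use r N in auto)
  then have 1: "(N/2) * (N/2 + 1) \<le> 62625 * (r * r)" by simp
  have "(N/2 + R + 1) * (N/2 + R + 2) \<le> (251 * r) * (251 * r)" by (rule sq) (use r N R in auto)
  then have 2: "(N/2 + R + 1) * (N/2 + R + 2) \<le> 63001 * (r * r)" by simp
  have 3: "X \<le> 250 * (r * r)" using X r(3) by (simp add: power2_eq_square)
  have "(N/2) * (N/2 + 1) / 2 + (N/2 + R + 1) * (N/2 + R + 2) / 2 + X \<le> 63100 * (r * r)"
    using 1 2 3 zero_le_square[of r] by linarith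
  then have "\<rho> * ((N/2) * (N/2 + 1) / 2 + (N/2 + R + 1) * (N/2 + R + 2) / 2 + X) \<le> (1042 / 1000) * (63100 * (r * r))"
    using rho N R X by (intro mult_mono) auto
  from order_trans[OF le this] have u: "A\<^sup>2 + b\<^sup>2 \<le> 131501 * (r * r)"
    using zero_le_square[of r] by linarith
  have "2 / 3 * N \<le> A" using AB R by linarith
  then have A: "333 * r \<le> A" using r by simp
  have "0 \<le> (A - 2 * b) * (A - 2 * b)" by simp
  define S where "S = A + b"
  have S: "500 * r \<le> S" using AB R r by (simp add: S_def)
  \<comment> \<open>For 2 b \<le> A the quotient of A^2 + b^2 by (A + b)^2 is least at A = 2 b,
    where it is 5/9.\<close>
  have "5 * S\<^sup>2 \<le> 9 * (A\<^sup>2 + b\<^sup>2)"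
  proof -
    have "9 * (A\<^sup>2 + b\<^sup>2) - 5 * S\<^sup>2 = 2 * ((A - 2 * b) * (2 * A - b))"
      by (simp add: S_def power2_eq_square algebra_simps)
    moreover have "0 \<le> (A - 2 * b) * (2 * A - b)" using AB by (intro mult_nonneg_nonneg) auto
    ultimately show ?thesis by simp
  qed
  moreover have "(500 * r)\<^sup>2 \<le> S\<^sup>2" by (rule power_mono) (use S r in auto)
  ultimately have "5 * (250000 * (r * r)) \<le> 9 * (131501 * (r * r))"
    using u by (simp add: power2_eq_square)
  moreover have "0 < r * r" using r by simp
  ultimately show False by simp
qed

text \<open>No cover exists, yet at least about a third of the rows follow row 0: the cost is at
  least about 11/18 N^2 against the upper bound of about 1/2 N^2.\<close>

lemma no_gap:
  fixes A b N R :: real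
  assumes N: "0 < N" and R: "0 \<le> R" "500 * (R + 2) \<le> N" and AB: "A + b = N + R" "0 \<le> A" "A \<le> 2 * b"
    and X: "0 \<le> X" "1000 * X \<le> N\<^sup>2" and rho: "0 \<le> \<rho>" "\<rho> \<le> 1042 / 1000"
    and le: "A\<^sup>2 / 2 + b\<^sup>2 / 2 + N * b \<le> \<rho> * (N * (N + 1) / 2 + (R + 1) * (R + 2) / 2 + X)"
  shows False
proof -
  define r where "r = N / 500"
  have r: "1 \<le> N / 1000" "R + 2 \<le> r" "N = 500 * r" "0 < r" using N R by (auto simp: r_def)
  have sq: "x * y \<le> u * v" if "0 \<le> x" "0 \<le> y" "x \<le> u" "y \<le> v" for x y u v :: real
    using that by (intro mult_mono) auto
  have "N * (N + 1) \<le> (500 * r) * (500.5 * r)" by (rule sq) (use r N in auto)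
  then have 1: "N * (N + 1) \<le> 250250 * (r * r)" by simp
  have 2: "(R + 1) * (R + 2) \<le> r * r" by (rule sq) (use r N R in auto)
  have 3: "X \<le> 250 * (r * r)" using X r(3) by (simp add: power2_eq_square)
  have "N * (N + 1) / 2 + (R + 1) * (R + 2) / 2 + X \<le> 125376 * (r * r)"
    using 1 2 3 zero_le_square[of r] by linarith
  then have "\<rho> * (N * (N + 1) / 2 + (R + 1) * (R + 2) / 2 + X) \<le> (1042 / 1000) * (125376 * (r * r))"
    using rho N R X by (intro mult_mono) auto
  from order_trans[OF le this] have u: "A\<^sup>2 / 2 + b\<^sup>2 / 2 + N * b \<le> 130642 * (r * r)"
    using zero_le_square[of r] by linarith
  have A: "A = N + R - b" using AB by simp
  have b: "166 * r \<le> b" "R \<le> r" using AB R r by auto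
  \<comment> \<open>For fixed A + b the penalty \<open>N * b\<close> cancels the linear term, which
    leaves (N + R)^2/2 + b (b - R), and \<open>b\<close> is about N/3 or more.\<close>
  have "A\<^sup>2 / 2 + b\<^sup>2 / 2 + N * b = N * N / 2 + N * R + R * R / 2 + b * (b - R)"
    by (simp add: A power2_eq_square field_simps)
  moreover have "(166 * r) * (165 * r) \<le> b * (b - R)" by (rule sq) (use b r in auto)
  moreover have "N * N / 2 = 125000 * (r * r)" unfolding r(3) by simp
  moreover have "0 \<le> N * R" "0 \<le> R * R" using N R by auto
  ultimately have "152390 * (r * r) \<le> 130642 * (r * r)" using u by linarith
  moreover have "0 < r * r" using r by simp
  ultimately show False by simp
qed

section \<open>The wiggle instance\<close>

lemma enc_nat_double: "b \<le> 1 \<Longrightarrow> 0 < 2 * u + b \<Longrightarrow> enc_nat (2 * u + b) = (1 + b) # enc_nat u"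
  by (subst enc_nat.simps) auto

lemma enc_nat_power: "0 < m \<Longrightarrow> enc_nat (2 ^ j * m) = replicate j 1 @ enc_nat m"
proof (induction j)
  case (Suc j)
  have e: "2 ^ Suc j * m = 2 * (2 ^ j * m) + 0" by simp
  have "enc_nat (2 * (2 ^ j * m) + 0) = (1 + 0) # enc_nat (2 ^ j * m)"
    by (rule enc_nat_double) (use Suc.prems in simp_all)
  then show ?case unfolding e using Suc by simp
qed simp

text \<open>The power 2^j tells the rows apart, and 2^(n + 7) dominates it by a factor of more than
  2^7, which makes all weights agree up to 129/128. All identifiers of an instance have codes of
  equal length with a simple shape.\<close>

definition ident :: "nat \<Rightarrow> nat \<Rightarrow> nat" where
  "ident n j = 2 ^ j + 2 ^ (n + 7)"

lemma enc_ident: "j < n \<Longrightarrow> enc_nat (ident n j) @ [3, 2, 3] = tailw j n"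
proof -
  assume j: "j < n"
  have one: "enc_nat 1 = [2]" by (subst enc_nat.simps, subst enc_nat.simps) simp
  have p: "enc_nat (2 ^ m) = replicate m 1 @ [2]" for m
    using enc_nat_power[of 1 m] one by simp
  have e: "n + 7 = j + Suc (n + 6 - j)" using j by simp
  have "ident n j = 2 ^ j * (2 * 2 ^ (n + 6 - j) + 1)"
    unfolding ident_def by (subst e) (simp only: power_add power_Suc, simp add: algebra_simps)
  moreover have "enc_nat (2 ^ j * (2 * 2 ^ (n + 6 - j) + 1)) = replicate j 1 @ enc_nat (2 * 2 ^ (n + 6 - j) + 1)"
    by (rule enc_nat_power) simp
  moreover have "enc_nat (2 * 2 ^ (n + 6 - j) + 1) = (1 + 1) # enc_nat (2 ^ (n + 6 - j))"
    by (rule enc_nat_double) simp_all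
  ultimately have "enc_nat (ident n j) = replicate j 1 @ [2] @ replicate (n + 6 - j) 1 @ [2]"
    by (simp only: p) simp
  moreover have "n + 6 - j = (n - 1 - j) + 7" using j by simp
  then have "replicate (n + 6 - j) (1::nat) = replicate (n - 1 - j) 1 @ replicate 7 1"
    by (simp only: replicate_add)
  ultimately show ?thesis by (simp only: tailw_def append_assoc append.simps)
qed

lemma enc_rat_nat: "enc_rat (rat_of_nat v) = enc_nat v @ [3, 2, 3]"
proof -
  have one: "enc_nat 1 = [2]" by (subst enc_nat.simps, subst enc_nat.simps) simp
  have "quotient_of (rat_of_nat v) = (int v, 1)" using quotient_of_int[of "int v"] by simp
  then show ?thesis by (simp add: enc_rat_def one[simplified])
qed

text \<open>The offset is constant along a series and cancels in all differences, while
  \<open>b\<close> remains visible as the lowest bit of the code.\<close>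

definition sval :: "nat \<Rightarrow> nat \<Rightarrow> nat \<Rightarrow> nat" where
  "sval n j b = 2 * ident n j + b"

lemma enc_value: "j < n \<Longrightarrow> b \<le> 1 \<Longrightarrow> enc_rat (rat_of_nat (sval n j b)) = (1 + b) # tailw j n"
proof -
  assume "j < n" "b \<le> 1"
  moreover from this(2) have "enc_nat (2 * ident n j + b) = (1 + b) # enc_nat (ident n j)"
    by (rule enc_nat_double) (simp add: ident_def)
  ultimately show ?thesis by (simp only: enc_rat_nat sval_def append_Cons enc_ident)
qed

definition alternate :: "'b \<Rightarrow> ('a \<Rightarrow> 'b) \<Rightarrow> 'a list \<Rightarrow> 'b list" where
  "alternate x y es = concat (map (\<lambda>e. [x, y e]) es) @ [x]"

lemma length_alternate: "length (alternate x y es) = 2 * length es + 1"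
  by (induction es) (auto simp: alternate_def)

lemma alternate_nth:
  "c \<le> length es \<Longrightarrow> alternate x y es ! (2 * c) = x"
  "c < length es \<Longrightarrow> alternate x y es ! (2 * c + 1) = y (es ! c)"
proof -
  have "(c \<le> length es \<longrightarrow> alternate x y es ! (2 * c) = x) \<and> (c < length es \<longrightarrow> alternate x y es ! (2 * c + 1) = y (es ! c))"
  proof (induction es arbitrary: c)
    case (Cons e es)
    have "alternate x y (e # es) = x # y e # alternate x y es" by (simp add: alternate_def)
    then show ?case using Cons[of "c - 1"] by (cases c) auto
  qed (simp add: alternate_def)
  then show "c \<le> length es \<Longrightarrow> alternate x y es ! (2 * c) = x"
    "c < length es \<Longrightarrow> alternate x y es ! (2 * c + 1) = y (es ! c)" by blast+
qed

text \<open>The difference vector \<open>jump\<close> of row \<open>j\<close> is realised by going up or down by \<open>jump\<close> and back,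
  so each of its coordinates occurs twice, with opposite signs. Row 0 sits at level 1 instead of 0 so
  that it can go down.\<close>

definition bits :: "tok list \<Rightarrow> nat \<Rightarrow> nat \<Rightarrow> nat list" where
  "bits ts N j = alternate (if j = 0 then 1 else 0) (\<lambda>e. if j = 0 then 0 else e - 1)
     (cols N (length (all_rows ts N)) j (snd (all_rows ts N ! j)))"

definition ser :: "tok list \<Rightarrow> nat \<Rightarrow> nat \<Rightarrow> rat list" where
  "ser ts N j = map (\<lambda>b. rat_of_nat (sval (length (all_rows ts N)) j b)) (bits ts N j)"

definition instance_of :: "tok list \<Rightarrow> nat \<Rightarrow> rat list list" where
  "instance_of ts N = rev (map (ser ts N) [0..<length (all_rows ts N)])"

text \<open>Needed for the infimum in \<open>has_ptas\<close>: comparing it with the cost of a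
  particular ordering requires a lower bound.\<close>

lemma weighted_nonneg:
  assumes I: "series_instance l I" and \<pi>: "\<pi> \<in> orderings (series_of ` set I)"
  shows "0 \<le> weighted_wiggle p l (length I) \<pi>"
proof -
  have b: "bij_betw \<pi> {1..length I} (series_of ` set I)"
    using \<pi> card_series_of[OF I] by (simp add: orderings_def)
  have f: "0 \<le> \<pi> i t" if "i \<in> {1..length I}" "t \<in> {1..l}" for i t
  proof -
    have "\<pi> i \<in> series_of ` set I" using b that(1) by (auto simp: bij_betw_def)
    then obtain xs where xs: "xs \<in> set I" "\<pi> i = series_of xs" by blast
    have "series_of xs \<in> {1..l} \<rightarrow>\<^sub>E {0..}" by (rule series_of_PiE[OF I xs(1)])
    then show ?thesis using that(2) xs(2) by (auto simp: PiE_def Pi_def)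
  qed
  have g: "0 \<le> (\<pi>(length I + 1 := (\<lambda>_. 0))) i t" if "i \<in> {1..length I + 1}" "t \<in> {1..l}" for i t
    using f[of i t] that by (cases "i = length I + 1") auto
  show ?thesis
    unfolding weighted_wiggle_def Let_def
  proof (intro sum_nonneg mult_nonneg_nonneg)
    fix i t assume "i \<in> {1..length I}" "t \<in> {1..l - 1}"
    then have "i \<in> {1..length I + 1}" "i + 1 \<in> {1..length I + 1}" "t \<in> {1..l}" "t + 1 \<in> {1..l}" by auto
    then show "0 \<le> ((\<pi>(length I + 1 := (\<lambda>_. 0))) i t + (\<pi>(length I + 1 := (\<lambda>_. 0))) i (t + 1) +
        (\<pi>(length I + 1 := (\<lambda>_. 0))) (i + 1) t + (\<pi>(length I + 1 := (\<lambda>_. 0))) (i + 1) (t + 1)) / 4"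
      by (intro divide_nonneg_pos add_nonneg_nonneg g) simp_all
  qed simp
qed

lemma wiggle_nonneg: "0 \<le> wiggle p l m \<pi>"
  unfolding wiggle_def by (intro sum_nonneg) simp

section \<open>The series and their prefix sums\<close>

context
  fixes ts :: "tok list" and N :: nat
begin

abbreviation "n \<equiv> length (all_rows ts N)"
abbreviation "C \<equiv> N * width ts + n"
abbreviation "pat j \<equiv> snd (all_rows ts N ! j)"

lemma n_eq: "n = N + length (patterns ts) + 1"
  by (simp add: all_rows_def)

lemma pat: "j < n \<Longrightarrow> set (pat j) \<subseteq> {1, 2} \<and> length (pat j) = width ts"
  using all_rows_wf[of "fst (all_rows ts N ! j)" "pat j" ts N] nth_mem[of j "all_rows ts N"] by simp

lemma flag: "j < n \<Longrightarrow> fst (all_rows ts N ! j) = 5 \<longleftrightarrow> j = 0"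
  by (cases j) (auto simp: all_rows_def nth_append)

lemma cols_wf: "j < n \<Longrightarrow> set (cols N n j (pat j)) \<subseteq> {1, 2} \<and> length (cols N n j (pat j)) = C"
  using pat[of j] by (auto simp: cols_def length_concat sum_list_replicate)

lemma length_bits: "j < n \<Longrightarrow> length (bits ts N j) = 2 * C + 1"
  using cols_wf[of j] by (simp add: bits_def length_alternate)

lemma bits_le: "j < n \<Longrightarrow> b \<in> set (bits ts N j) \<Longrightarrow> b \<le> 1"
proof -
  assume j: "j < n" and b: "b \<in> set (bits ts N j)"
  have e: "e = 1 \<or> e = 2" if "e \<in> set (cols N n j (pat j))" for e using cols_wf[OF j] that by auto
  from b show ?thesis by (auto simp: bits_def alternate_def dest!: e split: if_splits)
qed

lemma hd_bits: "bits ts N j \<noteq> []" "hd (bits ts N j) = (if j = 0 then 1 else 0)"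
  by (cases "cols N n j (pat j)"; simp add: bits_def alternate_def)+

lemma enc_ser: "j < n \<Longrightarrow> concat (map enc_rat (ser ts N j)) = concat (map (\<lambda>b. (1 + b) # tailw j n) (bits ts N j))"
  unfolding ser_def map_map comp_def using bits_le[of j] enc_value[of j n]
  by (intro arg_cong[of _ _ concat] map_cong refl) auto

lemma rowtext_ser: "j < n \<Longrightarrow> rowtext N n j (all_rows ts N ! j) = concat (map enc_rat (ser ts N j)) @ [4]"
proof -
  assume j: "j < n"
  have "concat (map enc_rat (ser ts N j)) = concat (map (\<lambda>b. (1 + b) # tailw j n) (bits ts N j))"
    by (rule enc_ser[OF j])
  also have "\<dots> = concat (map (colw (fst (all_rows ts N ! j)) j n) (cols N n j (pat j))) @
     (if fst (all_rows ts N ! j) = 5 then 2 else 1) # tailw j n"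
  proof -
    have "concat (map (\<lambda>b. (1 + b) # tailw j n) (alternate (if j = 0 then 1 else 0) (\<lambda>e. if j = 0 then 0 else e - 1) es)) =
      concat (map (colw (fst (all_rows ts N ! j)) j n) es) @ (if fst (all_rows ts N ! j) = 5 then 2 else 1) # tailw j n"
      if "set es \<subseteq> {1, 2}" for es
      using that flag[OF j] by (induction es) (auto simp: alternate_def colw_def)
    then show ?thesis using cols_wf[OF j] by (simp add: bits_def)
  qed
  finally show ?thesis by (simp add: rowtext_def)
qed

text \<open>The list is reversed because the program builds its output on a stack, beginning with
  row 0.\<close>

lemma out_text_series: "out_text ts N = enc_series_list (rev (map (ser ts N) [0..<n]))"
proof -
  have "map (\<lambda>j. rowtext N n j (all_rows ts N ! j)) [0..<n] =
      map (\<lambda>j. concat (map enc_rat (ser ts N j)) @ [4]) [0..<n]"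
    by (rule map_cong) (auto simp: rowtext_ser)
  then have "out_text ts N = concat (rev (map (\<lambda>j. concat (map enc_rat (ser ts N j)) @ [4]) [0..<n]))"
    unfolding out_text_def by (simp only:)
  then show ?thesis by (simp only: enc_series_list_def rev_map map_map comp_def)
qed

text \<open>The first value of a series determines its identifier. Distinctness is required of an
  instance, and it fails for the bare patterns of the zero rows.\<close>

lemma inj_ser: "inj_on (ser ts N) {..<n}"
proof (rule inj_onI)
  fix i j assume ij: "i \<in> {..<n}" "j \<in> {..<n}" and eq: "ser ts N i = ser ts N j"
  have "hd (ser ts N i) = hd (ser ts N j)" using eq by simp
  then have v: "sval n i (hd (bits ts N i)) = sval n j (hd (bits ts N j))"
    using hd_bits by (simp add: ser_def hd_map)
  have "hd (bits ts N i) \<le> 1" "hd (bits ts N j) \<le> 1" by (simp_all add: hd_bits)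
  with v have "ident n i = ident n j" unfolding sval_def by linarith
  then show "i = j" by (simp add: ident_def)
qed

lemma series_ser: "series_instance (2 * C + 1) (rev (map (ser ts N) [0..<n]))"
  unfolding series_instance_def
proof (intro conjI ballI)
  show "distinct (rev (map (ser ts N) [0..<n]))"
    using inj_ser by (simp add: distinct_map atLeast0LessThan)
qed (use length_bits in \<open>auto simp: ser_def\<close>)

definition jump :: "nat \<Rightarrow> nat \<Rightarrow> int" where
  "jump j c = (if j = 0 then -1 else int (cols N n j (pat j) ! c) - 1)"

lemma series_at:
  assumes "j < n" "t < 2 * C + 1"
  shows "series_of (ser ts N j) (t + 1) = real (sval n j (bits ts N j ! t))"
  using assms length_bits[OF assms(1)] by (simp add: series_of_def ser_def of_rat_of_nat_eq)

lemma diff_even: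
  assumes "j < n" "c < C"
  shows "series_of (ser ts N j) (2 * c + 1 + 1) - series_of (ser ts N j) (2 * c + 1) = real_of_int (jump j c)"
    and "series_of (ser ts N j) (2 * c + 2 + 1) - series_of (ser ts N j) (2 * c + 2) = - real_of_int (jump j c)"
proof -
  let ?es = "cols N n j (pat j)"
  have l: "length ?es = C" "set ?es \<subseteq> {1, 2}" using cols_wf[OF assms(1)] by auto
  have "?es ! c \<in> set ?es" using l assms by simp
  then have e: "?es ! c = 1 \<or> ?es ! c = 2" using l by auto
  have b: "bits ts N j ! (2 * c) = (if j = 0 then 1 else 0)" "bits ts N j ! (2 * c + 2) = (if j = 0 then 1 else 0)"
    "bits ts N j ! (2 * c + 1) = (if j = 0 then 0 else ?es ! c - 1)"
    using alternate_nth(1)[of c ?es] alternate_nth(1)[of "c + 1" ?es] alternate_nth(2)[of c ?es] l assms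
    by (auto simp: bits_def)
  show "series_of (ser ts N j) (2 * c + 1 + 1) - series_of (ser ts N j) (2 * c + 1) = real_of_int (jump j c)"
    using series_at[OF assms(1), of "2 * c"] series_at[OF assms(1), of "2 * c + 1"] assms(2) b e
    by (auto simp: sval_def jump_def)
  show "series_of (ser ts N j) (2 * c + 2 + 1) - series_of (ser ts N j) (2 * c + 2) = - real_of_int (jump j c)"
    using series_at[OF assms(1), of "2 * c + 1"] series_at[OF assms(1), of "2 * c + 2"] assms(2) b e
    by (auto simp: sval_def jump_def)
qed

abbreviation "entry j e \<equiv> (if j < n \<and> e < width ts then pat j ! e - 1 else 0)"
abbreviation "lev p P \<equiv> level p N (width ts) (\<lambda>j e. entry j e) n P"

lemma concat_replicate_nth: "c < m * length xs \<Longrightarrow> concat (replicate m xs) ! c = xs ! (c mod length xs)"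
proof (induction m arbitrary: c)
  case (Suc m)
  show ?case
  proof (cases "c < length xs")
    case False
    then have "c - length xs < m * length xs" using Suc.prems by simp
    from Suc.IH[OF this] False show ?thesis by (simp add: nth_append le_mod_geq)
  qed (simp add: nth_append)
qed simp

lemma sum_mod: "(\<Sum>c<m * z. g (c mod z)) = real m * (\<Sum>e<z. g e)" for g :: "nat \<Rightarrow> real" and z :: nat
proof (induction m)
  case (Suc m)
  have "{..<Suc m * z} = {..<m * z} \<union> {m * z..<m * z + z}" by auto
  then have "(\<Sum>c<Suc m * z. g (c mod z)) = (\<Sum>c<m * z. g (c mod z)) + (\<Sum>c=m * z..<m * z + z. g (c mod z))"
    by (simp add: sum.union_disjoint ivl_disj_int)
  also have "(\<Sum>c=m * z..<m * z + z. g (c mod z)) = (\<Sum>e<z. g e)"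
    using sum.shift_bounds_nat_ivl[of "\<lambda>c. g (c mod z)" 0 "m * z" z]
    by (simp add: atLeast0LessThan add.commute)
  finally show ?case using Suc by (simp add: algebra_simps)
qed simp

text \<open>The coordinates fall into \<open>N\<close> copies of the pattern, indexed modulo the
  width, followed by the private columns.\<close>

lemma level_columns:
  assumes P: "P \<subseteq> {..<n}"
  shows "(\<Sum>c<C. \<bar>real_of_int (\<Sum>j\<in>P. jump j c)\<bar> ^ p) = lev p P"
proof -
  have "{..<C} = {..<N * width ts} \<union> {N * width ts..<N * width ts + n}" by auto
  then have "(\<Sum>c<C. \<bar>real_of_int (\<Sum>j\<in>P. jump j c)\<bar> ^ p) = (\<Sum>c<N * width ts. \<bar>real_of_int (\<Sum>j\<in>P. jump j c)\<bar> ^ p) +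
      (\<Sum>c=N * width ts..<N * width ts + n. \<bar>real_of_int (\<Sum>j\<in>P. jump j c)\<bar> ^ p)"
    by (simp add: sum.union_disjoint ivl_disj_int)
  also have "(\<Sum>c<N * width ts. \<bar>real_of_int (\<Sum>j\<in>P. jump j c)\<bar> ^ p) =
      (\<Sum>c<N * width ts. \<bar>real_of_int (coverS (\<lambda>j e. entry j e) P (c mod width ts))\<bar> ^ p)"
  proof (rule sum.cong[OF refl])
    fix c assume "c \<in> {..<N * width ts}"
    then have c: "c < N * width ts" by simp
    then have z: "c mod width ts < width ts" by (cases "width ts = 0") auto
    have "jump j c = (if j = 0 then -1 else int (entry j (c mod width ts)))" if "j \<in> P" for j
    proof -
      have j: "j < n" using that P by auto
      have "cols N n j (pat j) ! c = pat j ! (c mod width ts)"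
        using c pat[OF j] concat_replicate_nth[of c N "pat j"]
        by (simp add: cols_def nth_append length_concat sum_list_replicate)
      moreover have "pat j ! (c mod width ts) \<in> set (pat j)" using z pat[OF j] by simp
      then have "pat j ! (c mod width ts) \<ge> 1" using pat[OF j] by auto
      ultimately show ?thesis using j z by (simp add: jump_def of_nat_diff)
    qed
    then have "(\<Sum>j\<in>P. jump j c) = coverS (\<lambda>j e. entry j e) P (c mod width ts)"
      unfolding coverS_def by (rule sum.cong[OF refl])
    then show "\<bar>real_of_int (\<Sum>j\<in>P. jump j c)\<bar> ^ p = \<bar>real_of_int (coverS (\<lambda>j e. entry j e) P (c mod width ts))\<bar> ^ p"
      by (simp only:)
  qed
  also have "\<dots> = real N * (\<Sum>e<width ts. \<bar>real_of_int (coverS (\<lambda>j e. entry j e) P e)\<bar> ^ p)"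
    by (rule sum_mod)
  also have "(\<Sum>c=N * width ts..<N * width ts + n. \<bar>real_of_int (\<Sum>j\<in>P. jump j c)\<bar> ^ p) =
      (\<Sum>i<n. \<bar>real_of_int (starS P i)\<bar> ^ p)"
  proof (rule sum.reindex_bij_witness[of _ "\<lambda>i. N * width ts + i" "\<lambda>c. c - N * width ts"])
    fix c assume c: "c \<in> {N * width ts..<N * width ts + n}"
    let ?i = "c - N * width ts"
    have "jump j c = (if j = 0 then -1 else if j = ?i then 1 else 0)" if "j \<in> P" for j
    proof -
      have j: "j < n" using that P by auto
      have "cols N n j (pat j) ! c = (replicate j 1 @ [2] @ replicate (n - 1 - j) 1) ! ?i"
        using c pat[OF j] by (simp add: cols_def nth_append length_concat sum_list_replicate)
      also have "\<dots> = (if j = ?i then 2 else 1)"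
        using c j by (auto simp: nth_append nth_Cons')
      finally show ?thesis by (simp add: jump_def)
    qed
    then have "(\<Sum>j\<in>P. jump j c) = starS P ?i" unfolding starS_def by (rule sum.cong[OF refl])
    then show "\<bar>real_of_int (starS P ?i)\<bar> ^ p = \<bar>real_of_int (\<Sum>j\<in>P. jump j c)\<bar> ^ p" by (simp only:)
  qed auto
  finally show ?thesis by (simp add: level_def)
qed


abbreviation "arrange js \<equiv> ordering_of (map (ser ts N) js)"

lemma ordering_at:
  assumes "length js = n" "i \<in> {1..n}"
  shows "arrange js i = series_of (ser ts N (js ! (i - 1)))"
  using assms by (auto simp: ordering_of_def)

lemma W_even:
  assumes js: "distinct js" "set js = {..<n}" and i: "i \<le> n" and c: "c < C"
  shows "W (arrange js) i (2 * c + 1) = real_of_int (\<Sum>j\<in>set (take i js). jump j c)"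
    and "W (arrange js) i (2 * c + 2) = - real_of_int (\<Sum>j\<in>set (take i js). jump j c)"
proof -
  have l: "length js = n" using js distinct_card[of js] by simp
  have conv: "(\<Sum>k=1..i. f (js ! (k - 1))) = (\<Sum>j\<in>set (take i js). f j)" for f :: "nat \<Rightarrow> real"
  proof -
    have "(\<Sum>k=1..i. f (js ! (k - 1))) = (\<Sum>k<i. f (js ! k))"
      by (rule sum.reindex_bij_witness[of _ Suc "\<lambda>k. k - 1"]) auto
    also have "\<dots> = (\<Sum>k<i. f (take i js ! k))" by (intro sum.cong) auto
    also have "\<dots> = sum_list (map f (take i js))" using l i by (simp add: sum_list_sum_nth atLeast0LessThan)
    also have "\<dots> = (\<Sum>j\<in>set (take i js). f j)" using js by (simp add: sum_list_distinct_conv_sum_set)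
    finally show ?thesis .
  qed
  have mem: "js ! (k - 1) < n" if "k \<in> {1..i}" for k
  proof -
    have "k - 1 < length js" using that i l by auto
    from nth_mem[OF this] js(2) show ?thesis by simp
  qed
  have at: "arrange js k = series_of (ser ts N (js ! (k - 1)))" if "k \<in> {1..i}" for k
    by (rule ordering_at[OF l]) (use that i in auto)
  have "W (arrange js) i (2 * c + 1) = (\<Sum>k=1..i. real_of_int (jump (js ! (k - 1)) c))"
    unfolding W_def
  proof (rule sum.cong[OF refl])
    fix k assume k: "k \<in> {1..i}"
    show "arrange js k (2 * c + 1 + 1) - arrange js k (2 * c + 1) = real_of_int (jump (js ! (k - 1)) c)"
      unfolding at[OF k] by (rule diff_even(1)[OF mem[OF k] c])
  qed
  then show "W (arrange js) i (2 * c + 1) = real_of_int (\<Sum>j\<in>set (take i js). jump j c)"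
    unfolding conv[of "\<lambda>j. real_of_int (jump j c)"] of_int_sum .
  have "W (arrange js) i (2 * c + 2) = (\<Sum>k=1..i. - real_of_int (jump (js ! (k - 1)) c))"
    unfolding W_def
  proof (rule sum.cong[OF refl])
    fix k assume k: "k \<in> {1..i}"
    show "arrange js k (2 * c + 2 + 1) - arrange js k (2 * c + 2) = - real_of_int (jump (js ! (k - 1)) c)"
      unfolding at[OF k] by (rule diff_even(2)[OF mem[OF k] c])
  qed
  then show "W (arrange js) i (2 * c + 2) = - real_of_int (\<Sum>j\<in>set (take i js). jump j c)"
    unfolding sum_negf conv[of "\<lambda>j. real_of_int (jump j c)"] of_int_sum .
qed

lemma sum_pairs: "(\<Sum>t=1..2 * m. g t) = (\<Sum>c<m. g (2 * c + 1) + g (2 * c + 2))" for g :: "nat \<Rightarrow> real"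
  by (induction m) (auto simp: algebra_simps)

text \<open>The factor 2 comes from the two occurrences of every coordinate with opposite
  signs.\<close>

lemma row_cost:
  assumes js: "distinct js" "set js = {..<n}" and i: "i \<le> n"
  shows "(\<Sum>t=1..2 * C + 1 - 1. \<bar>W (arrange js) i t\<bar> ^ p) = 2 * lev p (set (take i js))"
proof -
  have "(\<Sum>t=1..2 * C + 1 - 1. \<bar>W (arrange js) i t\<bar> ^ p) =
      (\<Sum>c<C. \<bar>W (arrange js) i (2 * c + 1)\<bar> ^ p + \<bar>W (arrange js) i (2 * c + 2)\<bar> ^ p)"
    using sum_pairs[of "\<lambda>t. \<bar>W (arrange js) i t\<bar> ^ p" C] by simp
  also have "\<dots> = (\<Sum>c<C. 2 * \<bar>real_of_int (\<Sum>j\<in>set (take i js). jump j c)\<bar> ^ p)"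
  proof (rule sum.cong[OF refl])
    fix c assume "c \<in> {..<C}"
    then have c: "c < C" by simp
    show "\<bar>W (arrange js) i (2 * c + 1)\<bar> ^ p + \<bar>W (arrange js) i (2 * c + 2)\<bar> ^ p =
        2 * \<bar>real_of_int (\<Sum>j\<in>set (take i js). jump j c)\<bar> ^ p"
      unfolding W_even[OF js i c] by simp
  qed
  also have "\<dots> = 2 * (\<Sum>c<C. \<bar>real_of_int (\<Sum>j\<in>set (take i js). jump j c)\<bar> ^ p)"
    by (simp only: sum_distrib_left)
  also have "(\<Sum>c<C. \<bar>real_of_int (\<Sum>j\<in>set (take i js). jump j c)\<bar> ^ p) = lev p (set (take i js))"
    by (rule level_columns) (use js set_take_subset[of i js] in auto)
  finally show ?thesis .
qed

section \<open>Cost bounds shared by both problems\<close>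

lemma sum_butlast: "(\<Sum>i=1..n. f i) = (\<Sum>i=1..n-1. f i) + f n" for f :: "nat \<Rightarrow> real"
proof -
  have "{1..n} = insert n {1..n-1}" using n_eq by auto
  then show ?thesis using n_eq by simp
qed

text \<open>All that the gap argument uses of a cost function. The scale \<open>L\<close> cancels
  later. The lower bound omits the last prefix, whose weight involves the identically zero series
  and may fall below the common level.\<close>

definition bounded_cost :: "nat \<Rightarrow> (nat \<Rightarrow> nat \<Rightarrow> (nat \<Rightarrow> nat \<Rightarrow> real) \<Rightarrow> real) \<Rightarrow> bool" where
  "bounded_cost p cost \<longleftrightarrow> (\<exists>L>0. \<forall>js. distinct js \<longrightarrow> set js = {..<n} \<longrightarrow>
     L * (\<Sum>i=1..n-1. lev p (set (take i js))) \<le> cost (2 * C + 1) n (arrange js) \<and>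
     cost (2 * C + 1) n (arrange js) \<le> 129 / 128 * L * (\<Sum>i=1..n. lev p (set (take i js))))"

lemma wiggle_bounded: "bounded_cost p (wiggle p)"
  unfolding bounded_cost_def
proof (intro exI[of _ 2] conjI allI impI)
  fix js assume js: "distinct js" "set js = {..<n}"
  have "wiggle p (2 * C + 1) n (arrange js) = (\<Sum>i=1..n. 2 * lev p (set (take i js)))"
    unfolding wiggle_def by (intro sum.cong refl row_cost[OF js]) simp
  then have w: "wiggle p (2 * C + 1) n (arrange js) = 2 * (\<Sum>i=1..n. lev p (set (take i js)))"
    by (simp only: sum_distrib_left)
  have nn: "0 \<le> lev p P" for P by (rule level_nonneg)
  have s: "0 \<le> (\<Sum>i=1..n. lev p (set (take i js)))" by (rule sum_nonneg) (rule nn)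
  show "2 * (\<Sum>i=1..n-1. lev p (set (take i js))) \<le> wiggle p (2 * C + 1) n (arrange js)"
    unfolding w sum_butlast using nn[of "set (take n js)"] by simp
  show "wiggle p (2 * C + 1) n (arrange js) \<le> 129 / 128 * 2 * (\<Sum>i=1..n. lev p (set (take i js)))"
    unfolding w using s by simp
qed simp

lemma average_bounds:
  fixes a b c d L U :: real
  assumes "0 \<le> a" "0 \<le> b" "0 \<le> c" "0 \<le> d" "a \<le> U" "b \<le> U" "c \<le> U" "d \<le> U"
  shows "(a + b + c + d) / 4 \<le> U \<and> 0 \<le> (a + b + c + d) / 4"
  using assms by simp

lemma average_lower:
  fixes a b c d L :: real
  shows "L \<le> a \<Longrightarrow> L \<le> b \<Longrightarrow> L \<le> c \<Longrightarrow> L \<le> d \<Longrightarrow> L \<le> (a + b + c + d) / 4"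
  by simp

text \<open>Every value lies between \<open>L\<close> and \<open>129 / 128 * L\<close>, so the
  averages do too, except in the last row, where only nonnegativity and the upper bound
  hold.\<close>

lemma weighted_bounded: "bounded_cost p (weighted_wiggle p)"
proof -
  define L :: real where "L = 2 ^ (n + 8)"
  have L: "0 < L" by (simp add: L_def)
  show ?thesis
    unfolding bounded_cost_def
  proof (intro exI[of _ "2 * L"] conjI allI impI)
    fix js assume js: "distinct js" "set js = {..<n}"
    have l: "length js = n" using js distinct_card[of js] by simp
    let ?o = "(arrange js)(n + 1 := (\<lambda>_. 0))"
    define wt where "wt i t = (?o i t + ?o i (t + 1) + ?o (i + 1) t + ?o (i + 1) (t + 1)) / 4" for i t
    let ?a = "\<lambda>i t. \<bar>W (arrange js) i t\<bar> ^ p"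
    have cost: "weighted_wiggle p (2 * C + 1) n (arrange js) = (\<Sum>i=1..n. \<Sum>t=1..2 * C + 1 - 1. wt i t * ?a i t)"
      unfolding weighted_wiggle_def wt_def Let_def by (rule refl)
    have v: "L \<le> ?o i t \<and> ?o i t \<le> 129 / 128 * L" if i: "i \<in> {1..n}" and t: "t \<in> {1..2 * C + 1}" for i t
    proof -
      let ?j = "js ! (i - 1)"
      have j: "?j < n"
      proof -
        have "i - 1 < length js" using i l by auto
        from nth_mem[OF this] js(2) show ?thesis by simp
      qed
      have eq: "?o i t = real (sval n ?j (bits ts N ?j ! (t - 1)))"
        using ordering_at[OF l i] series_at[OF j, of "t - 1"] i t by auto
      have b: "bits ts N ?j ! (t - 1) \<le> 1"
        by (rule bits_le[OF j]) (use t length_bits[OF j] in auto)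
      define X where "X = (2::nat) ^ n"
      \<comment> \<open>With X = 2^n every value is between 256 X and 256 X + X + 1, hence at most
        258 X, which is 129/128 of 256 X.\<close>
      have "(2::nat) * 2 ^ ?j = 2 ^ Suc ?j" by simp
      also have "\<dots> \<le> X" unfolding X_def using j by (intro power_increasing) auto
      finally have "2 * (2::nat) ^ ?j \<le> X" .
      moreover have "1 \<le> X" "sval n ?j (bits ts N ?j ! (t - 1)) = 2 * 2 ^ ?j + 256 * X + bits ts N ?j ! (t - 1)"
        by (simp_all add: X_def sval_def ident_def power_add)
      ultimately have "128 * sval n ?j (bits ts N ?j ! (t - 1)) \<le> 129 * (256 * X)" "256 * X \<le> sval n ?j (bits ts N ?j ! (t - 1))"
        using b by linarith+
      then have "real (128 * sval n ?j (bits ts N ?j ! (t - 1))) \<le> real (129 * (256 * X))"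
        "real (256 * X) \<le> real (sval n ?j (bits ts N ?j ! (t - 1)))"
        by (simp_all only: of_nat_le_iff)
      moreover have "L = real (256 * X)" by (simp add: L_def X_def power_add)
      ultimately have u: "128 * ?o i t \<le> 129 * L" "L \<le> ?o i t" unfolding eq by simp_all
      then show ?thesis by simp
    qed
    have z: "?o (n + 1) t = 0" for t by simp
    have up: "wt i t \<le> 129 / 128 * L" "0 \<le> wt i t" if "i \<in> {1..n}" "t \<in> {1..2 * C}" for i t
    proof -
      have a: "L \<le> ?o i t \<and> ?o i t \<le> 129 / 128 * L" "L \<le> ?o i (t + 1) \<and> ?o i (t + 1) \<le> 129 / 128 * L"
        by (rule v; use that in auto)+
      have b: "0 \<le> ?o (i + 1) t' \<and> ?o (i + 1) t' \<le> 129 / 128 * L" if "t' \<in> {t, t + 1}" for t'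
      proof (cases "i = n")
        case True
        then show ?thesis using L by simp
      next
        case False
        have "L \<le> ?o (i + 1) t' \<and> ?o (i + 1) t' \<le> 129 / 128 * L"
          by (rule v) (use False that \<open>i \<in> _\<close> \<open>t \<in> _\<close> in auto)
        then show ?thesis using L by linarith
      qed
      have "0 \<le> ?o (i + 1) t \<and> ?o (i + 1) t \<le> 129 / 128 * L"
        "0 \<le> ?o (i + 1) (t + 1) \<and> ?o (i + 1) (t + 1) \<le> 129 / 128 * L" by (rule b, simp)+
      with a L have "wt i t \<le> 129 / 128 * L \<and> 0 \<le> wt i t"
        unfolding wt_def by (intro average_bounds) auto
      then show "wt i t \<le> 129 / 128 * L" "0 \<le> wt i t" by blast+
    qed
    have lo: "L \<le> wt i t" if "i \<in> {1..n-1}" "t \<in> {1..2 * C}" for i t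
    proof -
      have "L \<le> ?o i t" "L \<le> ?o i (t + 1)" "L \<le> ?o (i + 1) t" "L \<le> ?o (i + 1) (t + 1)"
        by (rule v[THEN conjunct1]; use that in auto)+
      then show ?thesis unfolding wt_def by (rule average_lower)
    qed
    have rc: "(\<Sum>t=1..2 * C. ?a i t) = 2 * lev p (set (take i js))" if "i \<le> n" for i
      using row_cost[OF js that] by (simp only: add_diff_cancel_right')
    have S: "(\<Sum>i=1..m. \<Sum>t=1..2 * C. K * ?a i t) = 2 * K * (\<Sum>i=1..m. lev p (set (take i js)))" if "m \<le> n" for m K
    proof -
      have "(\<Sum>i=1..m. \<Sum>t=1..2 * C. K * ?a i t) = (\<Sum>i=1..m. 2 * K * lev p (set (take i js)))"
      proof (rule sum.cong[OF refl])
        fix i assume "i \<in> {1..m}"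
        then have "i \<le> n" using that by simp
        have "(\<Sum>t=1..2 * C. K * ?a i t) = K * (\<Sum>t=1..2 * C. ?a i t)" by (rule sum_distrib_left[symmetric])
        then show "(\<Sum>t=1..2 * C. K * ?a i t) = 2 * K * lev p (set (take i js))"
          unfolding rc[OF \<open>i \<le> n\<close>] by (simp only: ac_simps)
      qed
      then show ?thesis by (simp only: sum_distrib_left)
    qed
    have "(\<Sum>i=1..n-1. \<Sum>t=1..2 * C. L * ?a i t) \<le> (\<Sum>i=1..n-1. \<Sum>t=1..2 * C. wt i t * ?a i t)"
      by (intro sum_mono mult_right_mono lo) auto
    moreover have "0 \<le> (\<Sum>t=1..2 * C. wt n t * ?a n t)"
    proof (rule sum_nonneg)
      fix t assume "t \<in> {1..2 * C}"
      then have "0 \<le> wt n t" using up(2)[of n t] n_eq by simp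
      then show "0 \<le> wt n t * ?a n t" by (rule mult_nonneg_nonneg) simp
    qed
    ultimately have "2 * L * (\<Sum>i=1..n-1. lev p (set (take i js))) \<le> (\<Sum>i=1..n. \<Sum>t=1..2 * C. wt i t * ?a i t)"
      unfolding sum_butlast using S[of "n - 1" L] by linarith
    then show "2 * L * (\<Sum>i=1..n-1. lev p (set (take i js))) \<le> weighted_wiggle p (2 * C + 1) n (arrange js)"
      unfolding cost by (simp only: add_diff_cancel_right')
    have "(\<Sum>i=1..n. \<Sum>t=1..2 * C. wt i t * ?a i t) \<le> (\<Sum>i=1..n. \<Sum>t=1..2 * C. 129 / 128 * L * ?a i t)"
      by (intro sum_mono mult_right_mono up(1)) auto
    also have "\<dots> = 2 * (129 / 128 * L) * (\<Sum>i=1..n. lev p (set (take i js)))" by (rule S) simp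
    also have "2 * (129 / 128 * L) = 129 / 128 * (2 * L)" by simp
    finally show "weighted_wiggle p (2 * C + 1) n (arrange js) \<le> 129 / 128 * (2 * L) * (\<Sum>i=1..n. lev p (set (take i js)))"
      unfolding cost by (simp only: add_diff_cancel_right')
  qed (use L in simp)
qed

abbreviation "R \<equiv> length (patterns ts)"

lemma entry_dummy: "1 \<le> j \<Longrightarrow> j \<le> N \<Longrightarrow> entry j e = 0"
  by (cases j) (auto simp: all_rows_def nth_append)

lemma entry_pattern: "s < R \<Longrightarrow> e < width ts \<Longrightarrow> entry (N + 1 + s) e = patterns ts ! s ! e - 1"
  by (simp add: all_rows_def nth_append)

lemma entry_le: "entry j e \<le> 1"
proof (cases "j < n \<and> e < width ts")
  case True
  then have w: "set (pat j) \<subseteq> {1, 2}" "e < length (pat j)" using pat[of j] by simp_all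
  have "pat j ! e \<in> {1, 2}" by (rule subsetD[OF w(1) nth_mem[OF w(2)]])
  then have "pat j ! e - 1 \<le> 1" by (elim insertE emptyE) simp_all
  then show ?thesis using True by (simp only: if_True simp_thms)
next
  case False
  then show ?thesis by (simp only: if_False zero_le)
qed

text \<open>Zero rows do not matter; the pattern rows start at number \<open>N + 1\<close>, behind
  row 0 and the zero rows.\<close>

lemma entry_sum:
  assumes S: "S \<subseteq> {1..<n}" and e: "e < width ts"
  shows "(\<Sum>j\<in>S. entry j e) = (\<Sum>s\<in>{s. s < R \<and> N + 1 + s \<in> S}. patterns ts ! s ! e - 1)"
proof -
  have f: "finite S" using S finite_subset by blast
  have "(\<Sum>j\<in>S. entry j e) = (\<Sum>j\<in>{j \<in> S. N < j}. entry j e)"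
  proof (rule sum.mono_neutral_right[OF f])
    show "\<forall>j\<in>S - {j \<in> S. N < j}. entry j e = 0"
    proof
      fix j assume "j \<in> S - {j \<in> S. N < j}"
      then have "1 \<le> j" "j \<le> N" using S by auto
      then show "entry j e = 0" by (rule entry_dummy)
    qed
  qed auto
  also have "\<dots> = (\<Sum>s\<in>{s. s < R \<and> N + 1 + s \<in> S}. entry (N + 1 + s) e)"
    by (rule sum.reindex_bij_witness[of _ "\<lambda>s. N + 1 + s" "\<lambda>j. j - N - 1"]) (use S n_eq in auto)
  also have "\<dots> = (\<Sum>s\<in>{s. s < R \<and> N + 1 + s \<in> S}. patterns ts ! s ! e - 1)"
    by (rule sum.cong[OF refl]) (use entry_pattern[OF _ e] in blast)
  finally show ?thesis .
qed

lemma mset_instance: "distinct js \<Longrightarrow> set js = {..<n} \<Longrightarrow> mset (map (ser ts N) js) = mset (instance_of ts N)"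
proof -
  assume js: "distinct js" "set js = {..<n}"
  have "set js = set [0..<n]" unfolding js(2) set_upt by (rule lessThan_atLeast0)
  then have "mset js = mset [0..<n]" by (simp only: set_eq_iff_mset_eq_distinct[OF js(1) distinct_upt])
  then show "mset (map (ser ts N) js) = mset (instance_of ts N)"
    unfolding instance_of_def mset_rev mset_map by (rule arg_cong)
qed

lemma mset_instance_D:
  assumes "mset J = mset (instance_of ts N)"
  shows "\<exists>js. J = map (ser ts N) js \<and> distinct js \<and> set js = {..<n}"
proof -
  let ?g = "inv_into {..<n} (ser ts N)"
  have sJ: "set J = ser ts N ` {..<n}"
    using mset_eq_setD[OF assms] unfolding instance_of_def set_rev set_map set_upt lessThan_atLeast0 .
  have "distinct (instance_of ts N)"
    using series_ser by (simp only: instance_of_def series_instance_def)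
  then have dJ: "distinct J" using mset_eq_imp_distinct_iff[OF assms] by (simp only:)
  have "map (ser ts N) (map ?g J) = J"
    unfolding map_map by (rule map_idI) (simp only: comp_def f_inv_into_f sJ)
  moreover have "distinct (map ?g J)"
    unfolding distinct_map using dJ inj_on_inv_into[of "set J" "ser ts N" "{..<n}"] by (simp only: sJ)
  moreover have "set (map ?g J) = {..<n}"
    unfolding set_map sJ by (rule inv_into_image_cancel[OF inj_ser order_refl])
  ultimately show ?thesis by (intro exI[of _ "map ?g J"] conjI) (simp_all only:)
qed

text \<open>The product of 41/40 and 129/128 is about 1.033; 1.042 is a convenient bound above
  it.\<close>

lemma scale_cancel:
  fixes L s s' c c' i :: real
  assumes "L * s \<le> c" "c \<le> (1 + 1 / 40) * i" "i \<le> c'" "c' \<le> 129 / 128 * L * s'" "0 < L" "0 \<le> s'"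
  shows "s \<le> 1042 / 1000 * s'"
proof -
  have "c' \<le> 129 / 128 * (L * s')" using assms(4) by (simp only: mult.assoc)
  then have "L * s \<le> 41 / 40 * (129 / 128 * (L * s'))" using assms(1-3) by simp
  then have "L * s \<le> L * (41 / 40 * 129 / 128 * s')" by (simp add: algebra_simps)
  then have "s \<le> 41 / 40 * 129 / 128 * s'" using assms(5) by simp
  then show ?thesis using assms(6) by linarith
qed

text \<open>The approximation guarantee transferred to level sums. The comparison ordering
  \<open>js'\<close> is arbitrary and so can be chosen according to whether a cover exists.\<close>

lemma near_optimal:
  assumes cost: "bounded_cost p cost"
    and nn: "\<And>\<pi>. \<pi> \<in> orderings (series_of ` set (instance_of ts N)) \<Longrightarrow> 0 \<le> cost (2 * C + 1) n \<pi>"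
    and js: "distinct js" "set js = {..<n}"
    and opt: "cost (2 * C + 1) n (arrange js) \<le>
       (1 + 1 / 40) * (INF \<pi>\<in>orderings (series_of ` set (instance_of ts N)). cost (2 * C + 1) n \<pi>)"
    and js': "distinct js'" "set js' = {..<n}"
  shows "(\<Sum>i=1..n-1. lev p (set (take i js))) \<le> 1042 / 1000 * (\<Sum>i=1..n. lev p (set (take i js')))"
proof -
  let ?S = "\<Sum>i=1..n-1. lev p (set (take i js))" and ?S' = "\<Sum>i=1..n. lev p (set (take i js'))"
  from cost obtain L where L: "0 < L"
    "\<And>js. distinct js \<Longrightarrow> set js = {..<n} \<Longrightarrow> L * (\<Sum>i=1..n-1. lev p (set (take i js))) \<le> cost (2 * C + 1) n (arrange js) \<and>
     cost (2 * C + 1) n (arrange js) \<le> 129 / 128 * L * (\<Sum>i=1..n. lev p (set (take i js)))"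
    unfolding bounded_cost_def by (elim exE conjE) simp
  have mem: "arrange js' \<in> orderings (series_of ` set (instance_of ts N))"
    by (rule ordering_of_in_orderings[OF _ mset_instance[OF js']])
      (use series_ser in \<open>simp add: instance_of_def\<close>)
  have "(INF \<pi>\<in>orderings (series_of ` set (instance_of ts N)). cost (2 * C + 1) n \<pi>) \<le> cost (2 * C + 1) n (arrange js')"
    by (rule cINF_lower[OF bdd_belowI2[of _ 0] mem]) (rule nn)
  note le = this
  have "0 \<le> ?S'" by (rule sum_nonneg) (rule level_nonneg)
  then show ?thesis
    by (rule scale_cancel[OF conjunct1[OF L(2)[OF js]] opt le conjunct2[OF L(2)[OF js']] L(1)])
qed

text \<open>Both directions compare the given ordering with an explicit good one; a wrong position
  of row 0 would contradict \<open>yes_gap\<close> or \<open>no_gap\<close>.\<close>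

lemma decision:
  assumes cost: "bounded_cost p cost" and p: "1 \<le> p"
    and nn: "\<And>\<pi>. \<pi> \<in> orderings (series_of ` set (instance_of ts N)) \<Longrightarrow> 0 \<le> cost (2 * C + 1) n \<pi>"
    and js: "distinct js" "set js = {..<n}" "js = xs @ 0 # ys"
    and opt: "cost (2 * C + 1) n (arrange js) \<le>
       (1 + 1 / 40) * (INF \<pi>\<in>orderings (series_of ` set (instance_of ts N)). cost (2 * C + 1) n \<pi>)"
    and N: "0 < N" "even N" "500 * (R + 2) \<le> N" "1000 * width ts * (R + 1) ^ (p + 1) \<le> N"
  shows "length xs \<le> 2 * length ys \<longleftrightarrow> (\<exists>T. exact_cover ts T)"
proof -
  define Y where "Y = (real R + 1) ^ (p + 1)"
  let ?X = "real N * real (width ts) * Y"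
  have len: "length xs + length ys = N + R" using js distinct_card[of js] n_eq by simp
  then have rlen: "real (length xs) + real (length ys) = real N + real R" by (metis of_nat_add)
  have rN: "0 < real N" "500 * (real R + 2) \<le> real N" using N(1) of_nat_mono[OF N(3), where 'a = real] by simp_all
  have rR: "0 \<le> real R" by simp
  have X0: "0 \<le> ?X" by (simp add: Y_def)
  have "real (1000 * width ts * (R + 1) ^ (p + 1)) \<le> real N" using N(4) by (simp only: of_nat_le_iff)
  then have "1000 * real (width ts) * Y \<le> real N"
    unfolding Y_def by (simp only: of_nat_mult of_nat_power of_nat_add of_nat_1 of_nat_numeral)
  then have "real N * (1000 * real (width ts) * Y) \<le> real N * real N"
    by (rule mult_left_mono) simp
  then have X: "1000 * ?X \<le> (real N)\<^sup>2" by (simp only: power2_eq_square ac_simps)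
  have nA: "real n = real N + real R + 1" by (simp add: n_eq)
  have near: "(\<Sum>i=1..n-1. lev p (set (take i js))) \<le> 1042 / 1000 * (\<Sum>i=1..n. lev p (set (take i js')))"
    if "distinct js'" "set js' = {..<n}" for js'
    by (rule near_optimal[OF cost _ js(1,2) opt that]) (rule nn)
  show ?thesis
  proof (cases "\<exists>T. exact_cover ts T")
    case True
    then obtain S where S: "S \<subseteq> {..<R}" "\<And>e. e < width ts \<Longrightarrow> (\<Sum>j\<in>S. patterns ts ! j ! e - 1) = 1"
      using patterns_cover[of ts] by blast
    define ds where "ds = [1..<N div 2 + 1]"
    define ds' where "ds' = [N div 2 + 1..<N + 1]"
    define cs where "cs = map (\<lambda>s. N + 1 + s) (filter (\<lambda>s. s \<in> S) [0..<R])"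
    define rs where "rs = map (\<lambda>s. N + 1 + s) (filter (\<lambda>s. s \<notin> S) [0..<R])"
    define js' where "js' = ds @ 0 # cs @ ds' @ rs"
    have sets: "set ds = {1..N div 2}" "set ds' = {N div 2 + 1..N}" "set cs = (\<lambda>s. N + 1 + s) ` S"
      "set rs = (\<lambda>s. N + 1 + s) ` ({..<R} - S)"
      using S(1) by (auto simp: ds_def ds'_def cs_def rs_def)
    have d: "distinct js'"
      unfolding js'_def distinct_append distinct.simps set_append sets
      by (auto simp: ds_def ds'_def cs_def rs_def distinct_map inj_on_def sets)
    have "set js' = {1..N div 2} \<union> {0} \<union> {N div 2 + 1..N} \<union> (\<lambda>s. N + 1 + s) ` {..<R}"
      unfolding js'_def using sets S(1) by auto
    also have "\<dots> = {..<n}"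
    proof -
      have "(\<lambda>s. N + 1 + s) ` {..<R} = {N + 1..<N + 1 + R}"
        using image_add_atLeastLessThan[of "N + 1" 0 R] by (simp add: atLeast0LessThan) (simp add: add.commute)
      then show ?thesis by (auto simp: n_eq)
    qed
    finally have st: "set js' = {..<n}" .
    have lR: "length cs + length rs = R"
      unfolding cs_def rs_def using sum_length_filter_compl[of "\<lambda>s. s \<in> S" "[0..<R]"] by simp
    have zero: "entry j e = 0" if "j \<in> set ds \<union> set ds'" for j e
      by (rule entry_dummy) (use that sets in auto)
    have one: "(\<Sum>j\<in>set cs. entry j e) = 1" if e: "e < width ts" for e
    proof -
      have sub: "set cs \<subseteq> {1..<n}" using sets S(1) by (auto simp: n_eq)
      have "{s. s < R \<and> N + 1 + s \<in> set cs} = S" using sets S(1) by auto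
      then show ?thesis using entry_sum[OF sub e] S(2)[OF e] by simp
    qed
    have up: "(\<Sum>t=1..n. lev p (set (take t js'))) \<le> real (length ds) * (real (length ds) + 1) / 2 +
       (real n - real (length ds)) * (real n - real (length ds) + 1) / 2 + ?X"
      unfolding Y_def by (rule core_upper[OF d st js'_def entry_le zero lR one p])
    have half: "real (length ds) = real N / 2" using N(2) by (auto simp: ds_def elim!: evenE)
    have up': "(\<Sum>t=1..n. lev p (set (take t js'))) \<le> (real N/2) * (real N/2 + 1) / 2 +
       (real N/2 + real R + 1) * (real N/2 + real R + 2) / 2 + ?X"
    proof -
      have e: "real n - real N / 2 = real N / 2 + real R + 1" "real N / 2 + real R + 1 + 1 = real N / 2 + real R + 2"
        using nA by simp_all
      show ?thesis using up unfolding half e .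
    qed
    have "length xs \<le> 2 * length ys"
    proof (rule ccontr)
      assume "\<not> length xs \<le> 2 * length ys"
      then have lt: "2 * real (length ys) < real (length xs)" by linarith
      have "(real (length xs))\<^sup>2 / 2 + (real (length ys))\<^sup>2 / 2 \<le> 1042 / 1000 * (\<Sum>t=1..n. lev p (set (take t js')))"
        using order_trans[OF core_lower(1)[OF js p] near[OF d st]] .
      also have "\<dots> \<le> 1042 / 1000 * ((real N/2) * (real N/2 + 1) / 2 +
       (real N/2 + real R + 1) * (real N/2 + real R + 2) / 2 + ?X)"
        by (rule mult_left_mono[OF up']) simp
      finally have le: "(real (length xs))\<^sup>2 / 2 + (real (length ys))\<^sup>2 / 2 \<le> 1042 / 1000 *
        ((real N/2) * (real N/2 + 1) / 2 + (real N/2 + real R + 1) * (real N/2 + real R + 2) / 2 + ?X)" .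
      show False
        by (rule yes_gap[OF rN(1) rR rN(2) rlen _ lt X0 X _ _ le]) simp_all
    qed
    with True show ?thesis by simp
  next
    case False
    have no: "\<exists>e<width ts. (\<Sum>j\<in>S. entry j e) \<noteq> 1" if S: "S \<subseteq> {1..<n}" for S
    proof (rule ccontr)
      let ?S = "{s. s < R \<and> N + 1 + s \<in> S}"
      assume "\<not> ?thesis"
      then have "\<forall>e<width ts. (\<Sum>j\<in>?S. patterns ts ! j ! e - 1) = 1" using entry_sum[OF S] by simp
      moreover have "?S \<subseteq> {..<R}" by auto
      ultimately show False using False patterns_cover[of ts] by blast
    qed
    \<comment> \<open>The comparison ordering without a cover: row 0 directly after all zero rows,
      so that only \<open>R\<close> rows follow it.\<close>
    define js' where "js' = [1..<N + 1] @ 0 # [] @ [] @ [N + 1..<n]"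
    have d: "distinct js'" by (auto simp: js'_def)
    have st: "set js' = {..<n}" by (auto simp: js'_def n_eq)
    have lR: "length [] + length [N + 1..<n] = R" by (simp only: length_upt list.size) (simp add: n_eq)
    have zero: "entry j e = 0" if "j \<in> set [1..<N + 1] \<union> set []" for j e
      by (rule entry_dummy) (use that in auto)
    have "(\<Sum>t=1..n. lev p (set (take t js'))) \<le> real (length [1..<N + 1]) * (real (length [1..<N + 1]) + 1) / 2 +
       (real n - real (length [1..<N + 1])) * (real n - real (length [1..<N + 1]) + 1) / 2 + ?X"
      unfolding Y_def by (rule core_upper[OF d st js'_def entry_le zero lR _ p], assumption, erule notE, rule refl)
    moreover have "real (length [1..<N + 1]) = real N" "real n - real N = real R + 1" "real n - real N + 1 = real R + 2"
      using nA by simp_all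
    ultimately have up: "(\<Sum>t=1..n. lev p (set (take t js'))) \<le> real N * (real N + 1) / 2 +
        (real R + 1) * (real R + 2) / 2 + ?X" by (simp only:)
    have "\<not> length xs \<le> 2 * length ys"
    proof
      assume "length xs \<le> 2 * length ys"
      then have le: "real (length xs) \<le> 2 * real (length ys)" by linarith
      have "(real (length xs))\<^sup>2 / 2 + (real (length ys))\<^sup>2 / 2 + real N * real (length ys) \<le>
          1042 / 1000 * (\<Sum>t=1..n. lev p (set (take t js')))"
        using order_trans[OF core_lower(2)[OF js p no] near[OF d st]] .
      also have "\<dots> \<le> 1042 / 1000 * (real N * (real N + 1) / 2 + (real R + 1) * (real R + 2) / 2 + ?X)"
        by (rule mult_left_mono[OF up]) simp
      finally have le': "(real (length xs))\<^sup>2 / 2 + (real (length ys))\<^sup>2 / 2 + real N * real (length ys) \<le>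
          1042 / 1000 * (real N * (real N + 1) / 2 + (real R + 1) * (real R + 2) / 2 + ?X)" .
      show False
        by (rule no_gap[OF rN(1) rR rN(2) rlen _ le X0 X _ _ le']) simp_all
    qed
    with False show ?thesis by simp
  qed
qed

end

section \<open>Polynomial time\<close>

text \<open>A bound valid for every argument and without a leading constant: the basis is at least
  2, so constants can be moved into the exponent.\<close>

definition poly_growth :: "(nat \<Rightarrow> nat) \<Rightarrow> bool" where
  "poly_growth f \<longleftrightarrow> (\<exists>Q. \<forall>m. f m \<le> (m + 2) ^ Q)"

lemma const_le_power: "c \<le> (m + 2) ^ (c::nat)" for m :: nat
proof -
  have "c \<le> 2 ^ c" by (rule less_imp_le) (rule less_exp)
  also have "\<dots> \<le> (m + 2) ^ c" by (rule power_mono) simp_all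
  finally show ?thesis .
qed

lemma poly_growth_const: "poly_growth (\<lambda>m. c)"
  unfolding poly_growth_def using const_le_power by blast

lemma poly_growth_id: "poly_growth (\<lambda>m. m)"
  unfolding poly_growth_def by (rule exI[of _ 1]) simp

lemma poly_growth_add: "poly_growth f \<Longrightarrow> poly_growth g \<Longrightarrow> poly_growth (\<lambda>m. f m + g m)"
proof -
  assume "poly_growth f" "poly_growth g"
  then obtain P Q where PQ: "\<And>m. f m \<le> (m + 2) ^ P" "\<And>m. g m \<le> (m + 2) ^ Q"
    unfolding poly_growth_def by blast
  have "f m + g m \<le> (m + 2) ^ Suc (max P Q)" for m
  proof -
    have "(m + 2) ^ P \<le> (m + 2) ^ max P Q" "(m + 2) ^ Q \<le> (m + 2) ^ max P Q"
      by (rule power_increasing; simp)+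
    then have "f m + g m \<le> 2 * (m + 2) ^ max P Q" using PQ[of m] by linarith
    also have "\<dots> \<le> (m + 2) * (m + 2) ^ max P Q" by (rule mult_right_mono) simp_all
    finally show ?thesis by (simp only: power_Suc)
  qed
  then show ?thesis unfolding poly_growth_def by blast
qed

lemma poly_growth_mult: "poly_growth f \<Longrightarrow> poly_growth g \<Longrightarrow> poly_growth (\<lambda>m. f m * g m)"
proof -
  assume "poly_growth f" "poly_growth g"
  then obtain P Q where PQ: "\<And>m. f m \<le> (m + 2) ^ P" "\<And>m. g m \<le> (m + 2) ^ Q"
    unfolding poly_growth_def by blast
  have "f m * g m \<le> (m + 2) ^ (P + Q)" for m
    unfolding power_add by (rule mult_mono[OF PQ]) simp_all
  then show ?thesis unfolding poly_growth_def by blast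
qed

lemma poly_growth_power: "poly_growth f \<Longrightarrow> poly_growth (\<lambda>m. f m ^ e)"
proof -
  assume "poly_growth f"
  then obtain P where P: "\<And>m. f m \<le> (m + 2) ^ P"
    unfolding poly_growth_def by blast
  have "f m ^ e \<le> (m + 2) ^ (P * e)" for m
    unfolding power_mult by (rule power_mono[OF P]) simp
  then show ?thesis unfolding poly_growth_def by blast
qed

text \<open>The finitely many arguments not controlled by the asymptotic bound are absorbed by the
  sum of their values, which becomes part of the exponent.\<close>

lemma polynomially_bounded_growth: "polynomially_bounded T \<Longrightarrow> poly_growth T"
proof -
  assume "polynomially_bounded T"
  then obtain k where "(\<lambda>n. real (T n)) \<in> O(\<lambda>n. real n ^ k)"
    unfolding polynomially_bounded_def by blast
  then obtain c where "0 < c" "\<forall>\<^sub>F n in sequentially. norm (real (T n)) \<le> c * norm (real n ^ k)"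
    by (rule landau_o.bigE)
  then obtain m where m: "\<And>n. m \<le> n \<Longrightarrow> real (T n) \<le> c * real n ^ k"
    unfolding eventually_sequentially by auto
  define A where "A = nat \<lceil>c\<rceil> + sum T {..<m}"
  have "T n \<le> (n + 2) ^ (A + k)" for n
  proof -
    have "T n \<le> A * (n + 2) ^ k"
    proof (cases "m \<le> n")
      case True
      have "c \<le> real A" 
        unfolding A_def of_nat_add using real_nat_ceiling_ge[of c] of_nat_0_le_iff[of "sum T {..<m}"] by linarith
      moreover have "real n ^ k \<le> real (n + 2) ^ k" by (rule power_mono) simp_all
      ultimately have "c * real n ^ k \<le> real A * real (n + 2) ^ k" by (intro mult_mono) simp_all
      with m[OF True] have "real (T n) \<le> real (A * (n + 2) ^ k)" by simp
      then show ?thesis by (simp only: of_nat_le_iff)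
    next
      case False
      then have "T n \<le> sum T {..<m}" by (intro member_le_sum) simp_all
      also have "\<dots> \<le> A * 1" by (simp add: A_def)
      also have "\<dots> \<le> A * (n + 2) ^ k" by (rule mult_left_mono) simp_all
      finally show ?thesis .
    qed
    also have "\<dots> \<le> (n + 2) ^ A * (n + 2) ^ k" by (rule mult_right_mono[OF const_le_power]) simp
    finally show ?thesis by (simp only: power_add)
  qed
  then show ?thesis unfolding poly_growth_def by blast
qed

text \<open>After taking logarithms this is the fact that \<open>ln m\<close> grows more slowly than
  any positive power of \<open>m\<close>.\<close>

lemma polynomial_below_exponential:
  assumes "0 < \<epsilon>"
  shows "\<forall>\<^sub>F m in sequentially. real ((m + 2) ^ Q) \<le> 2 powr (real m powr \<epsilon>)"
proof -
  have "(\<lambda>m. ln (real m) / real m powr \<epsilon>) \<longlonglongrightarrow> 0"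
    using lim_ln_over_power[OF assms] by simp
  \<comment> \<open>The denominator suffices for \<open>m ^ (2 * Q)\<close>, which dominates
    \<open>(m + 2) ^ Q\<close> for \<open>m \<ge> 2\<close>; the summand 1 keeps it positive when
    \<open>Q\<close> is 0.\<close>
  then have "\<forall>\<^sub>F m in sequentially. ln (real m) / real m powr \<epsilon> < ln 2 / (2 * real Q + 1)"
    by (rule order_tendstoD(2)) (simp add: add_nonneg_pos)
  with eventually_ge_at_top[of 2] show ?thesis
  proof eventually_elim
    case (elim m)
    have p: "0 < real m powr \<epsilon>" using elim(1) by simp
    have l: "0 \<le> ln (real m)" using elim(1) by simp
    have q: "0 < 2 * real Q + 1" by (simp add: add_nonneg_pos)
    have "ln (real m) * (2 * real Q + 1) < ln 2 * real m powr \<epsilon>"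
      using elim(2) by (simp only: divide_less_eq pos_less_divide_eq[OF q] p q if_True mult.commute times_divide_eq_right) (simp add: field_simps p q)
    then have le: "real (2 * Q) * ln (real m) \<le> real m powr \<epsilon> * ln 2" using l by (simp add: algebra_simps)
    have "m + 2 \<le> 2 * m" using elim(1) by simp
    also have "\<dots> \<le> m * m" by (rule mult_right_mono) (use elim(1) in simp_all)
    finally have "(m + 2) ^ Q \<le> (m * m) ^ Q" by (rule power_mono) simp
    then have "real ((m + 2) ^ Q) \<le> real ((m * m) ^ Q)" by (simp only: of_nat_le_iff)
    also have "\<dots> = real m ^ (2 * Q)" by (simp add: power_mult power2_eq_square)
    also have "\<dots> = exp (real (2 * Q) * ln (real m))"
      unfolding exp_of_nat_mult using elim(1) by simp
    also have "\<dots> \<le> exp (real m powr \<epsilon> * ln 2)" using le by simp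
    also have "\<dots> = 2 powr (real m powr \<epsilon>)" by (simp add: powr_def)
    finally show ?case .
  qed
qed

section \<open>Size of the instance\<close>

lemma length_concat_map: "(\<And>x. x \<in> set xs \<Longrightarrow> length (f x) = l) \<Longrightarrow> length (concat (map f xs)) = length xs * l"
  by (induction xs) auto

lemma length_tailw: "j < m \<Longrightarrow> length (tailw j m) = m + 11"
  by (simp add: tailw_def)

lemma length_patterns: "length (patterns ts) \<le> 3 * length ts"
proof -
  have "length (row_list ts m) \<le> 3 * m" for m
    by (induction m) (auto simp: row_list_def)
  then show ?thesis by (simp add: patterns_row_list)
qed

lemma length_ftext: "length (ftext (all_rows ts N)) = length (all_rows ts N) * (width ts + 1)"
  unfolding ftext_def by (rule length_concat_map) (auto dest: all_rows_wf)

lemma length_out_text: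
  fixes ts :: "tok list" and N :: nat
  defines "r \<equiv> length (all_rows ts N)"
  shows "length (out_text ts N) = r * (2 * (N * width ts + r) * (r + 12) + r + 13)"
proof -
  have "length (rowtext N r j (all_rows ts N ! j)) = 2 * (N * width ts + r) * (r + 12) + r + 13" if j: "j < r" for j
  proof -
    let ?cs = "cols N r j (snd (all_rows ts N ! j))"
    have c: "length ?cs = N * width ts + r" using cols_wf[of j ts N] j by (simp add: r_def)
    have "length (concat (map (colw (fst (all_rows ts N ! j)) j r) ?cs)) = length ?cs * (2 * (r + 12))"
      by (rule length_concat_map) (simp add: colw_def length_tailw[OF j])
    then show ?thesis by (simp add: rowtext_def length_tailw[OF j] c algebra_simps)
  qed
  then have "length (concat (map (\<lambda>j. rowtext N r j (all_rows ts N ! j)) (rev [0..<r]))) =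
      length (rev [0..<r]) * (2 * (N * width ts + r) * (r + 12) + r + 13)"
    by (intro length_concat_map) simp
  then show ?thesis by (simp add: out_text_def rev_map r_def)
qed

text \<open>The first symbol of an encoded series is the lowest bit of its first value, that is, the
  base level, and only row 0 has base level 1.\<close>

lemma row_word:
  fixes ts :: "tok list" and N j :: nat
  assumes j: "j < length (all_rows ts N)"
  defines "u \<equiv> concat (map enc_rat (ser ts N j))"
  shows "u \<noteq> []" "set u \<subseteq> {1, 2, 3}" "hd u = 2 \<longleftrightarrow> j = 0"
proof -
  have u: "u = concat (map (\<lambda>b. (1 + b) # tailw j (length (all_rows ts N))) (bits ts N j))"
    unfolding u_def by (rule enc_ser[OF j])
  obtain b bs where b: "bits ts N j = b # bs" using hd_bits(1) by (cases "bits ts N j") auto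
  have "b = (if j = 0 then 1 else 0)" using hd_bits(2)[of ts N j] b by simp
  with u b show "u \<noteq> []" "hd u = 2 \<longleftrightarrow> j = 0" by auto
  show "set u \<subseteq> {1, 2, 3}"
  proof
    fix x assume "x \<in> set u"
    then obtain b where "b \<in> set (bits ts N j)" "x = 1 + b \<or> x \<in> set (tailw j (length (all_rows ts N)))"
      unfolding u by auto
    moreover from this(1) have "b = 0 \<or> b = 1" using bits_le[OF j] by (auto simp: le_Suc_eq)
    ultimately show "x \<in> {1, 2, 3}" using tailw_syms[of j "length (all_rows ts N)"] by auto
  qed
qed

text \<open>Brings \<open>decision\<close> into the form demanded by the decoding program: the
  returned word is split into the words of its rows, and \<open>a\<close> is the position of row
  0.\<close>

lemma reduction:
  fixes ts :: "tok list" and N :: nat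
  defines "r \<equiv> length (all_rows ts N)"
  assumes cost: "bounded_cost ts N p cost" and p: "1 \<le> p"
    and nn: "\<And>\<pi>. \<pi> \<in> orderings (series_of ` set (instance_of ts N)) \<Longrightarrow> 0 \<le> cost (2 * (N * width ts + r) + 1) r \<pi>"
    and J: "mset J = mset (instance_of ts N)"
    and opt: "cost (2 * (N * width ts + r) + 1) r (ordering_of J) \<le>
       (1 + 1 / 40) * (INF \<pi>\<in>orderings (series_of ` set (instance_of ts N)). cost (2 * (N * width ts + r) + 1) r \<pi>)"
    and N: "0 < N" "even N" "500 * (length (patterns ts) + 2) \<le> N"
      "1000 * width ts * (length (patterns ts) + 1) ^ (p + 1) \<le> N"
  shows "\<exists>us a. enc_series_list J = concat (map (\<lambda>u. u @ [4]) us) \<and> (\<forall>u\<in>set us. u \<noteq> [] \<and> set u \<subseteq> {1, 2, 3}) \<and>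
     a < length us \<and> (\<forall>i<length us. hd (us ! i) = 2 \<longleftrightarrow> i = a) \<and>
     (a \<le> 2 * (length us - a - 1) \<longleftrightarrow> (\<exists>T. exact_cover ts T))"
proof -
  from mset_instance_D[OF J] obtain js where
    js: "J = map (ser ts N) js" "distinct js" "set js = {..<r}" unfolding r_def by blast
  have "0 \<in> set js" unfolding js(3) r_def by (simp add: all_rows_def)
  then obtain xs ys where sp: "js = xs @ 0 # ys" by (meson split_list)
  have dec: "length xs \<le> 2 * length ys \<longleftrightarrow> (\<exists>T. exact_cover ts T)"
    by (rule decision[OF cost p _ js(2) js(3)[unfolded r_def] sp _ N])
      (fact nn[unfolded r_def], fact opt[unfolded r_def js(1)])
  define us where "us = map (\<lambda>j. concat (map enc_rat (ser ts N j))) js"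
  show ?thesis
  proof (intro exI[of _ us] exI[of _ "length xs"] conjI allI impI ballI)
    show "enc_series_list J = concat (map (\<lambda>u. u @ [4]) us)"
      unfolding enc_series_list_def js(1) us_def map_map comp_def by (rule refl)
    show "u \<noteq> []" "set u \<subseteq> {1, 2, 3}" if "u \<in> set us" for u
    proof -
      from that obtain j where j: "j < length (all_rows ts N)" and u: "u = concat (map enc_rat (ser ts N j))"
        unfolding us_def using js(3) r_def by auto
      show "u \<noteq> []" "set u \<subseteq> {1, 2, 3}" unfolding u using row_word[OF j] by simp_all
    qed
    show "length xs < length us" by (simp add: us_def sp)
    have "length us - length xs - 1 = length ys" by (simp add: us_def sp)
    with dec show "length xs \<le> 2 * (length us - length xs - 1) \<longleftrightarrow> (\<exists>T. exact_cover ts T)" by (simp only:)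
    fix i assume i: "i < length us"
    then have i': "i < length js" by (simp add: us_def)
    have "js ! i < length (all_rows ts N)" using nth_mem[OF i'] js(3) r_def by simp
    then have "hd (us ! i) = 2 \<longleftrightarrow> js ! i = 0" using row_word(3) i' by (simp add: us_def)
    also have "\<dots> \<longleftrightarrow> js ! i = js ! length xs" by (simp add: sp)
    also have "\<dots> \<longleftrightarrow> i = length xs" by (rule nth_eq_iff_index_eq[OF js(2) i']) (simp add: sp)
    finally show "hd (us ! i) = 2 \<longleftrightarrow> i = length xs" .
  qed
qed

text \<open>The exponent is dictated by the last inequality: \<open>1000 * z\<close> is at most K^2
  and \<open>r + 1\<close> at most K^2, which together require 2 + 2 (p + 1) = 2 p + 4.\<close>

lemma dummy_count:
  fixes m p r z :: nat
  assumes r: "r \<le> 3 * m" and z: "z \<le> m"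
  defines "N \<equiv> (2 * m + 2000) ^ (2 * p + 4)"
  shows "0 < N" "even N" "500 * (r + 2) \<le> N" "1000 * z * (r + 1) ^ (p + 1) \<le> N"
proof -
  define K where "K = 2 * m + 2000"
  have N: "N = K ^ (2 * p + 4)" by (simp only: N_def K_def)
  show "0 < N" "even N" by (simp_all add: N_def)
  have "2 * K \<le> K * K" by (rule mult_right_mono) (simp_all add: K_def)
  moreover have "r + 2 \<le> 2 * K" using r by (simp add: K_def)
  ultimately have r2: "r + 2 \<le> K ^ 2" unfolding power2_eq_square by (rule order_trans[rotated])
  have "500 * (r + 2) \<le> K * K ^ 2" by (rule mult_mono[OF _ r2]) (simp_all add: K_def)
  also have "\<dots> = K ^ 3" by (simp only: power_Suc[symmetric] numeral_3_eq_3 numeral_2_eq_2)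
  also have "\<dots> \<le> N" unfolding N by (rule power_increasing) (simp_all add: K_def)
  finally show "500 * (r + 2) \<le> N" .
  have "1000 * z \<le> K * K" by (rule mult_mono) (use z in \<open>simp_all add: K_def\<close>)
  moreover have "(r + 1) ^ (p + 1) \<le> (K ^ 2) ^ (p + 1)" by (rule power_mono) (use r2 in simp_all)
  ultimately have "1000 * z * (r + 1) ^ (p + 1) \<le> K * K * (K ^ 2) ^ (p + 1)" by (rule mult_mono) simp_all
  also have "\<dots> = K ^ (2 + 2 * (p + 1))" by (simp only: power_add power_mult power2_eq_square)
  also have "2 + 2 * (p + 1) = 2 * p + 4" by simp
  finally show "1000 * z * (r + 1) ^ (p + 1) \<le> N" unfolding N .
qed

section \<open>Assembly of the decision procedure\<close>

lemma init_conf: "init_config w = conf 0 (\<lambda>i. if i = 0 then rtape w 0 else rtape [] 0)"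
  by (auto simp: init_config_def conf_def rtape_def fun_eq_iff)

lemma halts_with_bit:
  "s 0 = act (x, 0) (rtape [] 0) \<Longrightarrow> x \<noteq> 0 \<Longrightarrow> halts_with (conf 1 s) [x]"
  by (simp add: halts_with_def conf_def act_def rtape_def)

lemma sure_output:
  assumes "\<And>bs. length bs = t \<Longrightarrow> halts_with (run M w bs) v"
  shows "prob_output M w t v = 1"
proof -
  let ?S = "{bs :: bool list. length bs = t}"
  have "finite ?S" using finite_lists_length_eq[of "UNIV :: bool set" t] by simp
  moreover have "?S \<noteq> {}" using length_replicate[of t True] by blast
  ultimately have "set_pmf (pmf_of_set ?S) = ?S" by simp
  then have "AE bs in measure_pmf (pmf_of_set ?S). bs \<in> {bs. halts_with (run M w bs) v}"
    unfolding AE_measure_pmf_iff using assms by simp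
  then show ?thesis
    unfolding prob_output_def by (subst measure_pmf.prob_eq_1) simp_all
qed

text \<open>Only the accuracy 1/40 of the scheme is used. The resulting algorithm is deterministic,
  so its success probability is 1.\<close>

lemma ptas_decides_sat:
  assumes bounded: "\<And>ts N. bounded_cost ts N p cost" and p: "1 \<le> p"
    and nn: "\<And>l I \<pi>. series_instance l I \<Longrightarrow> \<pi> \<in> orderings (series_of ` set I) \<Longrightarrow> 0 \<le> cost l (length I) \<pi>"
    and ptas: "has_ptas cost"
  shows "\<exists>M Q. wf_tm M \<and> decides_sat_within M (\<lambda>m. (m + 2) ^ Q)"
proof -
  from ptas[unfolded has_ptas_def, rule_format, of "1 / 40"] obtain M T where
    M: "wf_tm M" "deterministic M" and T: "polynomially_bounded T" and
    sol: "\<And>l I. series_instance l I \<Longrightarrow> \<exists>J. mset J = mset I \<and>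
      computes_within M (enc_series_list I) (T (length (enc_series_list I))) (enc_series_list J) \<and>
      cost l (length I) (ordering_of J) \<le> (1 + 1 / 40) * (INF \<pi>\<in>orderings (series_of ` set I). cost l (length I) \<pi>)"
    by auto
  from polynomially_bounded_growth[OF T] obtain D where D: "\<And>m. T m \<le> (m + 2) ^ D"
    unfolding poly_growth_def by blast
  define k c h E where "k = 40 + num_tapes M" and "c = (2000::nat)" and "h = 2 * p + 4" and "E = 2 * c + 41 * h + 2000"
  have "1 \<le> k" "5 \<le> max 6 (num_symbols M)" "prog M h c \<noteq> Skip" by (simp_all add: k_def prog_def)
  then obtain M' where M': "wf_tm M'" "deterministic M'" "num_tapes M' = k" and run: "\<And>s s' t bs. (cstep k ^^ t) (prog M h c, s) = (Skip, s') \<Longrightarrow> length bs \<ge> t \<Longrightarrow>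
       fold (step M') bs (conf 0 s) = conf 1 s'"
  proof (rule compile[OF wfc_prog[OF M(1), of h c, folded k_def]])
    fix M' assume a: "wf_tm M'" "deterministic M'" "num_tapes M' = k" "\<And>s s' t bs. (cstep k ^^ t) (prog M h c, s) = (Skip, s') \<Longrightarrow>
      length bs \<ge> t \<Longrightarrow> fold (step M') bs (conf 0 s) = conf 1 s'"
    show thesis by (rule that[OF a])
  qed
  define NN where "NN m = (2 * m + c) ^ h" for m
  define rb where "rb m = NN m + 3 * m + 1" for m
  define lb where "lb m = rb m * (2 * (NN m * m + rb m) * (rb m + 12) + rb m + 13)" for m
  \<comment> \<open>A sum of upper bounds for all quantities that \<open>prog_runs\<close> requires
    to be below \<open>B\<close>, expressed in the length \<open>m\<close> of the formula; the
    summand 16 meets the locale assumption.\<close>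
  define B where "B m = 16 + (2 * m + c) + NN m + rb m * (m + 1) + (NN m * m + 2 * rb m + 1) + lb m + (lb m + 2) ^ D" for m
  have "poly_growth (\<lambda>m. B m ^ E)"
    unfolding B_def lb_def rb_def NN_def
    by (intro poly_growth_const poly_growth_id poly_growth_add poly_growth_mult poly_growth_power)
  then obtain Q where Q: "\<And>m. B m ^ E \<le> (m + 2) ^ Q" unfolding poly_growth_def by blast
  have "\<exists>s'. s' 0 = act (enc_bool (satisfiable \<phi>), 0) (rtape [] 0) \<and>
     (\<forall>bs. length bs = (length (enc_cnf \<phi>) + 2) ^ Q \<longrightarrow> run M' (enc_cnf \<phi>) bs = conf 1 s')" for \<phi>
  proof -
    define ts where "ts = toks \<phi>"
    define m where "m = length (etoks ts)"
    define N where "N = NN m"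
    define r where "r = length (all_rows ts N)"
    have w: "enc_cnf \<phi> = etoks ts" unfolding ts_def by (rule enc_cnf_toks)
    have z: "width ts \<le> m" unfolding m_def by (rule width_le)
    have pl: "length (patterns ts) \<le> 3 * m"
      using length_patterns[of ts] length_etoks[of ts] unfolding m_def by linarith
    have r: "r \<le> rb m" using pl by (simp add: r_def rb_def N_def all_rows_def)
    have Neq: "N = (2 * m + 2000) ^ (2 * p + 4)" by (simp only: N_def NN_def c_def h_def)
    have inst: "series_instance (2 * (N * width ts + r) + 1) (instance_of ts N)"
      unfolding instance_of_def r_def by (rule series_ser)
    have lI: "length (instance_of ts N) = r" by (simp add: instance_of_def r_def)
    have ot: "enc_series_list (instance_of ts N) = out_text ts N"
      unfolding instance_of_def by (rule out_text_series[symmetric])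
    from sol[OF inst] obtain J where J: "mset J = mset (instance_of ts N)"
      "computes_within M (out_text ts N) (T (length (out_text ts N))) (enc_series_list J)"
      "cost (2 * (N * width ts + r) + 1) r (ordering_of J) \<le>
        (1 + 1 / 40) * (INF \<pi>\<in>orderings (series_of ` set (instance_of ts N)). cost (2 * (N * width ts + r) + 1) r \<pi>)"
      unfolding lI ot by blast
    have nn': "0 \<le> cost (2 * (N * width ts + r) + 1) r \<pi>" if "\<pi> \<in> orderings (series_of ` set (instance_of ts N))" for \<pi>
      using nn[OF inst that] unfolding lI .
    have "\<exists>us a. enc_series_list J = concat (map (\<lambda>u. u @ [4]) us) \<and> (\<forall>u\<in>set us. u \<noteq> [] \<and> set u \<subseteq> {1, 2, 3}) \<and>
     a < length us \<and> (\<forall>i<length us. hd (us ! i) = 2 \<longleftrightarrow> i = a) \<and>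
     (a \<le> 2 * (length us - a - 1) \<longleftrightarrow> (\<exists>T. exact_cover ts T))"
      by (rule reduction[OF bounded p _ J(1) J(3)[unfolded r_def] dummy_count[OF pl z, of p, folded Neq]])
        (rule nn'[unfolded r_def])
    then obtain us a where us: "enc_series_list J = concat (map (\<lambda>u. u @ [4]) us)"
      "\<And>u. u \<in> set us \<Longrightarrow> u \<noteq> [] \<and> set u \<subseteq> {1, 2, 3}"
      and a: "a < length us" "\<And>i. i < length us \<Longrightarrow> hd (us ! i) = 2 \<longleftrightarrow> i = a"
      and dec: "a \<le> 2 * (length us - a - 1) \<longleftrightarrow> (\<exists>T. exact_cover ts T)"
      by (elim exE conjE) simp
    have "(\<exists>T. exact_cover ts T) \<longleftrightarrow> satisfiable \<phi>"
      unfolding satisfiable_models ts_def using cover_imp_models models_imp_cover by blast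
    with dec have bit: "(if a \<le> 2 * (length us - a - 1) then 2 else 1) = enc_bool (satisfiable \<phi>)"
      by (simp only: enc_bool_def)
    have zN: "N * width ts \<le> NN m * m" unfolding N_def using z by simp
    have out: "length (out_text ts N) \<le> lb m"
      unfolding length_out_text lb_def r_def[symmetric]
      by (intro mult_mono add_mono order_refl r zN) simp_all
    \<comment> \<open>A rearrangement of the series has a code of the same length, so the answer of
      the called machine is as long as its input.\<close>
    have len: "length (enc_series_list J) = length (out_text ts N)"
    proof -
      have "length (enc_series_list K) = sum_mset (image_mset (\<lambda>xs. length (concat (map enc_rat xs)) + 1) (mset K))" for K
        by (induction K) (simp_all add: enc_series_list_def)
      then show ?thesis using J(1) unfolding ot[symmetric] by simp
    qed
    have "length (ftext (all_rows ts N)) \<le> rb m * (m + 1)"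
      unfolding length_ftext r_def[symmetric] by (intro mult_mono add_mono order_refl r z) simp_all
    moreover have "T (length (out_text ts N)) \<le> (lb m + 2) ^ D"
      by (rule order_trans[OF D]) (use out in \<open>simp add: power_mono\<close>)
    ultimately have Bs: "2 * length (etoks ts) + c \<le> B m" "N \<le> B m" "length (ftext (all_rows ts N)) \<le> B m"
      "N * width ts + 2 * length (all_rows ts N) + 1 \<le> B m" "length (out_text ts N) \<le> B m"
      "T (length (out_text ts N)) < B m" "length (concat (map (\<lambda>u. u @ [4]) us)) \<le> B m" "16 \<le> B m"
      using r zN out len unfolding us(1) B_def m_def[symmetric] r_def[symmetric] N_def[symmetric] by linarith+
    interpret tapes k "B m" by unfold_locales (use Bs(8) in \<open>simp_all add: k_def\<close>)
    let ?s = "\<lambda>i. if i = 0 then rtape (etoks ts) 0 else rtape [] 0"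
    have NL: "(2 * length (etoks ts) + c) ^ h = N" by (simp only: N_def NN_def m_def)
    have "\<exists>s'. runs E (prog M h c) ?s s' \<and>
        s' 0 = act (if a \<le> 2 * (length us - a - 1) then 2 else 1, 0) (rtape [] 0)"
      unfolding E_def
      by (rule prog_runs[OF M k_def, where ts = ts and us = us and t = "T (length (out_text ts N))" and c = c and h = h,
            unfolded NL, OF _ J(2)[unfolded us(1)] _ a(1) _ Bs(1-7)], simp add: c_def, erule us(2), erule a(2), simp_all)
    then obtain s' where s': "runs E (prog M h c) ?s s'" "s' 0 = act (enc_bool (satisfiable \<phi>), 0) (rtape [] 0)"
      unfolding bit by blast
    from s'(1) obtain t where t: "t \<le> B m ^ E" "(cstep k ^^ t) (prog M h c, ?s) = (Skip, s')"
      unfolding runs_def by blast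
    have "run M' (enc_cnf \<phi>) bs = conf 1 s'" if "length bs = (length (enc_cnf \<phi>) + 2) ^ Q" for bs
      unfolding run_def w init_conf
      by (rule run[OF t(2)]) (use order_trans[OF t(1) Q[of m]] that w in \<open>simp add: m_def\<close>)
    with s'(2) show ?thesis by blast
  qed
  then have key: "\<exists>s'. halts_with (conf 1 s') [enc_bool (satisfiable \<phi>)] \<and>
     (\<forall>bs. length bs = (length (enc_cnf \<phi>) + 2) ^ Q \<longrightarrow> run M' (enc_cnf \<phi>) bs = conf 1 s')" for \<phi>
    using halts_with_bit[where x = "enc_bool (satisfiable \<phi>)"] by (metis enc_bool_def zero_neq_numeral zero_neq_one)
  have "decides_sat_within M' (\<lambda>m. (m + 2) ^ Q)"
    unfolding decides_sat_within_def Let_def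
  proof (intro allI conjI)
    fix \<phi>
    from key[of \<phi>] obtain s' where s': "halts_with (conf 1 s') [enc_bool (satisfiable \<phi>)]"
      "\<And>bs. length bs = (length (enc_cnf \<phi>) + 2) ^ Q \<Longrightarrow> run M' (enc_cnf \<phi>) bs = conf 1 s'" by blast
    show "halts_within M' (enc_cnf \<phi>) ((length (enc_cnf \<phi>) + 2) ^ Q)"
      using s'(2) by (simp add: halts_within_def conf_def)
    have "prob_output M' (enc_cnf \<phi>) ((length (enc_cnf \<phi>) + 2) ^ Q) [enc_bool (satisfiable \<phi>)] = 1"
      by (rule sure_output) (simp only: s')
    then show "2 / 3 \<le> prob_output M' (enc_cnf \<phi>) ((length (enc_cnf \<phi>) + 2) ^ Q) [enc_bool (satisfiable \<phi>)]"
      by simp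
  qed
  with M' show ?thesis by blast
qed

theorem theorem15:
  fixes p :: nat and \<epsilon> :: real
  assumes "p \<ge> 1" and "\<epsilon> > 0"
    and "has_ptas (wiggle p) \<or> has_ptas (weighted_wiggle p)"
  shows "\<exists>M T. wf_tm M \<and> decides_sat_within M T \<and>
           (\<forall>\<^sub>F n in sequentially. real (T n) \<le> 2 powr (real n powr \<epsilon>))"
proof -
  from assms(3) have "\<exists>M Q. wf_tm M \<and> decides_sat_within M (\<lambda>m. (m + 2) ^ Q)"
  proof
    assume "has_ptas (wiggle p)"
    from ptas_decides_sat[OF wiggle_bounded assms(1) wiggle_nonneg this] show ?thesis .
  next
    assume "has_ptas (weighted_wiggle p)"
    from ptas_decides_sat[OF weighted_bounded assms(1) _ this] weighted_nonneg show ?thesis by blast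
  qed
  then show ?thesis using polynomial_below_exponential[OF assms(2)] by blast
qed

end
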